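(* There are universal constants $C_1,C_2>0$ and an algorithm that takes as input $\kappa\ge2$ and $M$ elements from $\{1,\dots,N\}$ and outputs a sequence of elements from $\{1,\dots,N\}$ such that: (1) the running time is $M\cdot\mathrm{poly}(\log\kappa,\log N)$; (2) each $i\in\{1,\dots,N\}$ appears at least twice as often in the input as in the output; and (3) if the input consists of $M\ge 10\kappa^2/\max_i p_i$ independent samples from the distribution assigning probability $p_i$ to element $i$ (where $p\in[0,1]^N$, $\sum_i p_i=1$), then the output is within statistical distance $C_1 MN\log N\exp(-C_2\kappa)$ of $m$ independent samples from the distribution $\vec{p}^2$, where $m\ge M\cdot\sum_i p_i^2/(32\kappa\max_i p_i)$ is a random variable.
   Context: For $\vec{p}\in[0,1]^N$ with $\sum_i p_i=1$, $\vec{p}^2$ denotes the probability vector $(p_1^2/p_{\mathrm{col}},\dots,p_N^2/p_{\mathrm{col}})$ where $p_{\mathrm{col}}=\sum_i p_i^2$. *)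

theory Defs
  imports
    "HOL-Probability.Probability"
    "HOL-Library.Discrete_Functions"
    "HOL-Computational_Algebra.Polynomial"
begin

section \<open>Probability vectors and statistical distance\<close>

definition collision_prob :: "nat \<Rightarrow> nat pmf \<Rightarrow> real" where
  "collision_prob N p = (\<Sum>i\<in>{1..N}. (pmf p i)\<^sup>2)"

definition max_prob :: "nat \<Rightarrow> nat pmf \<Rightarrow> real" where
  "max_prob N p = Max (pmf p ` {1..N})"

text \<open>A probability vector \<open>(p\<^sub>1, \<dots>, p\<^sub>N)\<close> is a \<^typ>\<open>nat pmf\<close> supported in \<open>{1..N}\<close>.
  For such \<open>p\<close> the embedded function really is a probability mass function, see \<open>pmf_squared\<close>.\<close>

definition squared_pmf :: "nat \<Rightarrow> nat pmf \<Rightarrow> nat pmf" where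
  "squared_pmf N p = embed_pmf (\<lambda>i. (pmf p i)\<^sup>2 / collision_prob N p)"

lemma pmf_squared:
  assumes "set_pmf p \<subseteq> {1..N}"
  shows "pmf (squared_pmf N p) i = (pmf p i)\<^sup>2 / collision_prob N p"
proof -
  have zero: "pmf p i = 0" if "i \<notin> {1..N}" for i
    using assms that by (auto simp: set_pmf_iff)
  obtain j where j: "j \<in> set_pmf p" using set_pmf_not_empty by fast
  have jN: "j \<in> {1..N}" using j assms by blast
  have "0 < (pmf p j)\<^sup>2" using j by (simp add: set_pmf_iff)
  also have "\<dots> \<le> collision_prob N p"
    unfolding collision_prob_def using jN by (intro member_le_sum) auto
  finally have pos: "0 < collision_prob N p" .
  have "(\<integral>\<^sup>+ i. ennreal ((pmf p i)\<^sup>2 / collision_prob N p) \<partial>count_space UNIV)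
      = (\<Sum>i\<in>{1..N}. ennreal ((pmf p i)\<^sup>2 / collision_prob N p))"
    by (rule nn_integral_count_space'[where A = "{1..N}"]) (use zero in auto)
  also have "\<dots> = ennreal (\<Sum>i\<in>{1..N}. (pmf p i)\<^sup>2 / collision_prob N p)"
    using pos by (intro sum_ennreal) auto
  also have "\<dots> = 1"
    using pos by (simp flip: sum_divide_distrib add: collision_prob_def)
  finally show ?thesis
    unfolding squared_pmf_def using pos by (intro pmf_embed_pmf) auto
qed

definition stat_dist :: "'a pmf \<Rightarrow> 'a pmf \<Rightarrow> real" where
  "stat_dist P Q = (SUP A. \<bar>measure_pmf.prob P A - measure_pmf.prob Q A\<bar>)"

section \<open>Randomised random access machines with logarithmic cost\<close>

text \<open>Algorithms are programs for a random access machine over the natural numbers with finitely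
  many named registers, an indirectly addressed memory, a read-only input tape, a write-only output
  tape and fair coin flips. Control flow is structured (\<open>If\<close>, \<open>While\<close>) instead of jumps.

  Numbers are unbounded, so every instruction is charged the number of bits of all operands
  it handles (including memory addresses): the logarithmic cost criterion.\<close>

datatype arith = Add | Sub | Mul | Div

fun arith_op :: "arith \<Rightarrow> nat \<Rightarrow> nat \<Rightarrow> nat" where
  "arith_op Add a b = a + b"
| "arith_op Sub a b = a - b"
| "arith_op Mul a b = a * b"
| "arith_op Div a b = a div b"

datatype com =
    Skip
  | Const nat nat            \<comment> \<open>\<open>Const r n\<close>: \<open>r := n\<close>\<close>
  | Arith arith nat nat nat  \<comment> \<open>\<open>Arith f r a b\<close>: \<open>r := f a b\<close>\<close>
  | Load nat nat             \<comment> \<open>\<open>Load r a\<close>: \<open>r := memory[a]\<close>\<close>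
  | Store nat nat            \<comment> \<open>\<open>Store a r\<close>: \<open>memory[a] := r\<close>\<close>
  | Read nat
  | Write nat
  | Flip nat                 \<comment> \<open>\<open>Flip r\<close>: \<open>r\<close> becomes a fair random bit\<close>
  | Seq com com
  | If nat com com           \<comment> \<open>condition: the register is nonzero\<close>
  | While nat com

record state =
  reg :: "nat \<Rightarrow> nat"
  memory :: "nat \<Rightarrow> nat"
  inp :: "nat list"
  outp :: "nat list"
  cost :: nat

definition bits :: "nat \<Rightarrow> nat" where
  "bits n = floor_log n + 1"

definition charge :: "nat \<Rightarrow> state \<Rightarrow> state" where
  "charge n s = s\<lparr>cost := cost s + n\<rparr>"

definition set_reg :: "nat \<Rightarrow> nat \<Rightarrow> state \<Rightarrow> state" where
  "set_reg r v s = s\<lparr>reg := (reg s)(r := v)\<rparr>"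

partial_function (spmf) while_spmf :: "('s \<Rightarrow> bool) \<Rightarrow> ('s \<Rightarrow> 's spmf) \<Rightarrow> 's \<Rightarrow> 's spmf" where
  "while_spmf b f s = (if b s then bind_spmf (f s) (while_spmf b f) else return_spmf s)"

text \<open>The subprobability distribution of the final state; missing mass is the probability
  of divergence. Reading past the end of the input yields \<open>0\<close>, which is not a legal input
  element. A test in a loop is charged each time it is evaluated, including the last time.\<close>

primrec exec :: "com \<Rightarrow> state \<Rightarrow> state spmf" where
  "exec Skip s = return_spmf s"
| "exec (Const r n) s = return_spmf (charge (bits n) (set_reg r n s))"
| "exec (Arith f r a b) s =
     return_spmf (charge (bits (reg s a) + bits (reg s b))
       (set_reg r (arith_op f (reg s a) (reg s b)) s))"
| "exec (Load r a) s =
     (let v = memory s (reg s a)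
      in return_spmf (charge (bits (reg s a) + bits v) (set_reg r v s)))"
| "exec (Store a r) s =
     return_spmf (charge (bits (reg s a) + bits (reg s r))
       (s\<lparr>memory := (memory s)(reg s a := reg s r)\<rparr>))"
| "exec (Read r) s =
     (let v = (case inp s of [] \<Rightarrow> 0 | x # _ \<Rightarrow> x)
      in return_spmf (charge (bits v) (set_reg r v (s\<lparr>inp := tl (inp s)\<rparr>))))"
| "exec (Write r) s =
     return_spmf (charge (bits (reg s r)) (s\<lparr>outp := outp s @ [reg s r]\<rparr>))"
| "exec (Flip r) s =
     map_spmf (\<lambda>b. charge 1 (set_reg r (of_bool b) s)) coin_spmf"
| "exec (Seq c d) s = bind_spmf (exec c s) (exec d)"
| "exec (If r c d) s =
     (let s' = charge (bits (reg s r)) s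
      in if reg s r \<noteq> 0 then exec c s' else exec d s')"
| "exec (While r c) s =
     map_spmf (\<lambda>t. charge (bits (reg t r)) t)
       (while_spmf (\<lambda>t. reg t r \<noteq> 0) (\<lambda>t. exec c (charge (bits (reg t r)) t)) s)"

text \<open>The real parameter \<open>\<kappa>\<close> is passed to the program through its integer part, in register 0;
  all other registers and the memory start at \<open>0\<close>. The program is told neither \<open>N\<close> nor the
  length \<open>M\<close> of the input.\<close>

definition run :: "com \<Rightarrow> real \<Rightarrow> nat list \<Rightarrow> state spmf" where
  "run c \<kappa> xs = exec c
     \<lparr>reg = (\<lambda>_. 0)(0 := nat \<lfloor>\<kappa>\<rfloor>), memory = (\<lambda>_. 0), inp = xs, outp = [], cost = 0\<rparr>"

text \<open>Since every test and every instruction other than \<^const>\<open>Skip\<close> has positive cost, a program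
  that halts with probability 1 and whose terminating runs all cost at most \<open>t\<close> halts within
  cost \<open>t\<close> for all outcomes of the coin flips.\<close>

definition halts_within :: "com \<Rightarrow> real \<Rightarrow> nat list \<Rightarrow> real \<Rightarrow> bool" where
  "halts_within c \<kappa> xs t \<longleftrightarrow>
     lossless_spmf (run c \<kappa> xs) \<and> (\<forall>s\<in>set_spmf (run c \<kappa> xs). real (cost s) \<le> t)"

end

theory Submission
  imports Defs
begin

text \<open>
  An item \<open>x\<close> of a fresh sample \<open>T\<close> of size \<open>L\<close> should be output with probability proportional to
  \<open>p\<^sub>x\<close>, independently of everything else. A further \<open>K * L\<close> samples, the balls, are thrown into \<open>K\<close>
  pools uniformly at random, and the \<open>j\<close>-th occurrence of \<open>x\<close> in \<open>T\<close> is output with probability \<open>k / K\<close>,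
  where \<open>k\<close> counts the balls labelled \<open>x\<close> in pool \<open>j\<close>. Different occurrences of the same element see
  different pools. With pools of a fixed size the counts of distinct elements in a pool would be
  correlated in a way that depends on the pattern of \<open>T\<close>; the random assignment removes this.

  To see that the output is close to independent samples from the squared distribution, resample the
  label of one output. An accepted item is matched to a ball with the same label \<open>x\<close>, which
  happens with probability \<open>p\<^sub>x\<^sup>2 / K\<^sup>2\<close> for each ball; given this, the rest of the pattern has the law of a
  block without that item and that ball, because the pools are exchangeable. This is exact except when
  some multiplicity exceeds \<open>K\<close>, which is exponentially unlikely if \<open>L * max p \<le> K / 2\<close>.

  A suitable \<open>L\<close> is found by doubling, until a fresh sample of size \<open>L\<close> contains some element
  \<open>T = K / 8\<close> times. If this happens for \<open>L = T\<close> already, the distribution is concentrated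
  enough for the parameters \<open>K = L = 1\<close>: output the common value of a pair of equal samples. For \<open>N = 1\<close>
  the bound on the distance is \<open>0\<close>, and this mode is then exact.
\<close>

section \<open>Expectations over finitely supported distributions\<close>

text \<open>The output length is random and may depend on the labels. Every estimate therefore
  compares the output with independent samples of the same random length, and the law of
  \<open>m\<close> is fixed only at the end. The lower bound on \<open>m\<close> comes from the mean
  of \<open>(1/2) ^ length\<close>, which multiplies over blocks. One error per resampled position
  together with the union bounds gives a distance of order \<open>N * M ^ 3 * exp (- T / 8)\<close>,
  whereas the theorem allows only the first power of \<open>M\<close>. No distance exceeds 1, so a
  bound \<open>z ^ 3\<close> may be replaced by \<open>z\<close>; this repairs the power of
  \<open>M\<close> and divides the rate in the exponent by 3. On the machine side, the program knows
  neither \<open>N\<close> nor \<open>M\<close>. Counters are cleared through a log of the cells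
  touched, so that a pass takes time linear in its length, and the size of the numbers is controlled
  by the pigeonhole principle: a sample without a \<open>T\<close>-fold element has length at most
  \<open>N * T\<close>. The number \<open>K\<close> of pools is a power of two, so that fair bits
  suffice for exact draws.\<close>

abbreviation E :: "'a pmf \<Rightarrow> ('a \<Rightarrow> real) \<Rightarrow> real" where
  "E \<equiv> measure_pmf.expectation"

lemma E_sum_set: "finite (set_pmf P) \<Longrightarrow> E P f = (\<Sum>x\<in>set_pmf P. pmf P x * f x)"
  by (subst integral_measure_pmf[of "set_pmf P"]) auto

lemma E_bind:
  assumes "finite (set_pmf P)" "\<And>x. x \<in> set_pmf P \<Longrightarrow> finite (set_pmf (f x))"
  shows "E (bind_pmf P f) h = E P (\<lambda>x. E (f x) h)"
proof -
  have *: "bind_pmf P f = bind_pmf P (\<lambda>x. if x \<in> set_pmf P then f x else return_pmf undefined)"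
    by (intro bind_pmf_cong) auto
  have "E (bind_pmf P f) h = (\<Sum>a\<in>set_pmf P. pmf P a *\<^sub>R E (if a \<in> set_pmf P then f a else return_pmf undefined) h)"
    by (subst *, rule pmf_expectation_bind) (use assms in auto)
  also have "\<dots> = E P (\<lambda>x. E (f x) h)"
    by (subst E_sum_set) (use assms in \<open>auto intro!: sum.cong\<close>)
  finally show ?thesis .
qed

lemma E_mono:
  assumes "finite (set_pmf P)" "\<And>x. x \<in> set_pmf P \<Longrightarrow> f x \<le> g x"
  shows "E P f \<le> E P g"
  using assms by (auto simp: E_sum_set intro!: sum_mono mult_left_mono)

lemma E_cong: "(\<And>x. x \<in> set_pmf P \<Longrightarrow> f x = g x) \<Longrightarrow> E P f = E P g"
  by (intro integral_cong_AE) (auto simp: AE_measure_pmf_iff)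

lemma E_add: "finite (set_pmf P) \<Longrightarrow> E P (\<lambda>x. f x + g x) = E P f + E P g"
  by (simp add: E_sum_set distrib_left sum.distrib)

lemma E_diff: "finite (set_pmf P) \<Longrightarrow> E P (\<lambda>x. f x - g x) = E P f - E P g"
  by (simp add: E_sum_set right_diff_distrib sum_subtractf)

lemma E_const: "E P (\<lambda>_. c) = c" by simp

lemma E_abs: "\<bar>E P f\<bar> \<le> E P (\<lambda>x. \<bar>f x\<bar>)"
  by (rule integral_abs_bound)

lemma E_commute:
  assumes "finite (set_pmf P)" "finite (set_pmf Q)"
  shows "E P (\<lambda>x. E Q (\<lambda>y. f x y)) = E Q (\<lambda>y. E P (\<lambda>x. f x y))"
  using assms by (simp add: E_sum_set sum_distrib_left)
    (subst sum.swap, simp add: mult_ac)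

lemma E_ge0: "(\<And>x. x \<in> set_pmf P \<Longrightarrow> 0 \<le> f x) \<Longrightarrow> 0 \<le> E P f"
  by (intro integral_nonneg_AE) (auto simp: AE_measure_pmf_iff)

lemma E_le:
  assumes "finite (set_pmf P)" "\<And>x. x \<in> set_pmf P \<Longrightarrow> f x \<le> c"
  shows "E P f \<le> c"
  using E_mono[of P f "\<lambda>_. c"] assms by simp

lemma E_indicator: "E P (\<lambda>x. of_bool (Q x)) = measure_pmf.prob P {x. Q x}"
proof -
  have "(\<lambda>x. of_bool (Q x)) = (indicator {x. Q x} :: _ \<Rightarrow> real)" by (auto simp: indicator_def)
  then show ?thesis by simp
qed

lemma finite_replicate_pmf[simp]: "finite (set_pmf p) \<Longrightarrow> finite (set_pmf (replicate_pmf n p))"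
  by (induction n) auto

lemma E_replicate_Suc:
  "finite (set_pmf p) \<Longrightarrow> E (replicate_pmf (Suc n) p) f = E p (\<lambda>x. E (replicate_pmf n p) (\<lambda>xs. f (x # xs)))"
  by (simp add: E_bind)

lemma E_replicate_add:
  "finite (set_pmf p) \<Longrightarrow> E (replicate_pmf (m + n) p) f =
     E (replicate_pmf m p) (\<lambda>xs. E (replicate_pmf n p) (\<lambda>ys. f (xs @ ys)))"
  by (simp add: E_bind replicate_pmf_distrib)

lemma E_replicate_prod:
  assumes "finite (set_pmf p)"
  shows "E (replicate_pmf n p) (\<lambda>xs. prod_list (map f xs)) = E p f ^ n"
proof (induction n)
  case (Suc n)
  show ?case unfolding E_replicate_Suc[OF assms] using Suc by simp
qed simp

lemma map_replicate_pmf: "map_pmf (map f) (replicate_pmf n p) = replicate_pmf n (map_pmf f p)"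
proof (induction n)
  case (Suc n)
  show ?case by (simp add: map_bind_pmf bind_map_pmf flip: Suc)
qed simp

text \<open>The Mecke formula for a fixed number of samples: each of the \<open>Suc n\<close>
  positions carries \<open>k\<close> with probability \<open>pmf \<beta> k\<close>, and removing it
  leaves \<open>n\<close> independent samples. \<open>H\<close> reads only the multiset, so the
  place of the marked copy does not matter.\<close>

lemma E_count_replicate:
  fixes H :: "'a multiset \<Rightarrow> real"
  assumes fin: "finite (set_pmf \<beta>)"
  shows "E (replicate_pmf (Suc n) \<beta>) (\<lambda>bs. count_list bs k * H (mset bs)) =
    Suc n * pmf \<beta> k * E (replicate_pmf n \<beta>) (\<lambda>bs. H (add_mset k (mset bs)))"
proof (induction n arbitrary: H)
  have hit: "E \<beta> (\<lambda>b. of_bool (b = k) * f b) = pmf \<beta> k * f k" for f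
  proof -
    have "E \<beta> (\<lambda>b. of_bool (b = k) * f b) = E \<beta> (\<lambda>b. f k * of_bool (b = k))"
      by (intro E_cong) auto
    also have "\<dots> = f k * pmf \<beta> k" by (simp add: E_indicator measure_pmf_single)
    finally show ?thesis by simp
  qed
  {
    case 0
    have "E (replicate_pmf (Suc 0) \<beta>) (\<lambda>bs. count_list bs k * H (mset bs)) =
        E \<beta> (\<lambda>b. of_bool (b = k) * H {#b#})"
      by (subst E_replicate_Suc[OF fin]) (auto intro!: E_cong)
    then show ?case by (simp add: hit)
  next
    case (Suc n)
    let ?R = "replicate_pmf (Suc n) \<beta>"
    have finR: "finite (set_pmf ?R)" by (rule finite_replicate_pmf[OF fin])
    have "E (replicate_pmf (Suc (Suc n)) \<beta>) (\<lambda>bs. count_list bs k * H (mset bs)) =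
        E \<beta> (\<lambda>b. E ?R (\<lambda>bs. of_bool (b = k) * H (add_mset b (mset bs)) +
          count_list bs k * H (add_mset b (mset bs))))"
      by (subst E_replicate_Suc[OF fin]) (auto intro!: E_cong simp: algebra_simps simp del: replicate_pmf.simps)
    also have "\<dots> = E \<beta> (\<lambda>b. of_bool (b = k) * E ?R (\<lambda>bs. H (add_mset b (mset bs)))) +
        E \<beta> (\<lambda>b. Suc n * pmf \<beta> k * E (replicate_pmf n \<beta>) (\<lambda>bs. H (add_mset b (add_mset k (mset bs)))))"
      using Suc[of "\<lambda>m. H (add_mset _ m)"]
      by (simp add: E_add fin finR del: replicate_pmf.simps)
    also have "\<dots> = pmf \<beta> k * E ?R (\<lambda>bs. H (add_mset k (mset bs))) +
        Suc n * pmf \<beta> k * E ?R (\<lambda>bs. H (add_mset k (mset bs)))"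
      by (subst hit, subst (3) E_replicate_Suc[OF fin])
        (simp add: add_mset_commute del: replicate_pmf.simps)
    finally show ?case by (simp add: algebra_simps del: replicate_pmf.simps)
  }
qed

section \<open>Screening a sample against random pools\<close>

text \<open>True has probability \<open>min k K / K\<close>. Up to \<open>K\<close> this is linear
  in the count, which is what the Mecke formula \<open>E_count_replicate\<close> needs; beyond
  \<open>K\<close> it is truncated.\<close>

definition coin :: "nat \<Rightarrow> nat \<Rightarrow> bool pmf" where
  "coin K k = map_pmf (\<lambda>r. r < k) (pmf_of_set {..<K})"

text \<open>Rejected items leave a \<open>None\<close>, so that positions survive and a single one
  can be resampled. Pools are numbered from 1; index 0 stays free for the item counters of the
  program.\<close>

primrec screen :: "nat \<Rightarrow> (nat \<times> nat) multiset \<Rightarrow> nat list \<Rightarrow> nat list \<Rightarrow> nat option list pmf" where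
  "screen K B pre [] = return_pmf []"
| "screen K B pre (x # xs) =
     bind_pmf (coin K (count B (x, Suc (count_list pre x))))
       (\<lambda>b. map_pmf ((#) (if b then Some x else None)) (screen K B (pre @ [x]) xs))"

primrec somes :: "'a option list \<Rightarrow> 'a list" where
  "somes [] = []"
| "somes (x # xs) = (case x of None \<Rightarrow> somes xs | Some y \<Rightarrow> y # somes xs)"

text \<open>The ideal process with the accept pattern kept and only the labels redrawn. After
  \<open>somes\<close> its law depends on the number of accepted items alone, by
  \<open>map_somes_fresh\<close>.\<close>

primrec fresh :: "'a pmf \<Rightarrow> 'a option list \<Rightarrow> 'a option list pmf" where
  "fresh s [] = return_pmf []"
| "fresh s (x # xs) = (case x of None \<Rightarrow> map_pmf ((#) None) (fresh s xs)
     | Some _ \<Rightarrow> bind_pmf s (\<lambda>y. map_pmf ((#) (Some y)) (fresh s xs)))"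

definition resample :: "'a pmf \<Rightarrow> nat \<Rightarrow> 'a option list \<Rightarrow> 'a option list pmf" where
  "resample s i os = (case os ! i of None \<Rightarrow> return_pmf os | Some _ \<Rightarrow> map_pmf (\<lambda>y. os[i := Some y]) s)"

lemma finite_coin[simp]: "finite (set_pmf (coin K k))"
  by (rule finite_subset[of _ UNIV]) auto

lemma E_coin:
  assumes "K > 0"
  shows "E (coin K k) f = real (min k K) / K * f True + (1 - real (min k K) / K) * f False"
proof -
  have eq: "{..<K} \<inter> {..<k} = {..<min k K}" by auto
  have "measure_pmf.prob (coin K k) {True} = real (min k K) / K"
    using assms eq unfolding coin_def
    by (simp add: measure_pmf_of_set vimage_def lessThan_empty_iff flip: lessThan_def)
  then have "pmf (coin K k) True = real (min k K) / K" by (simp add: measure_pmf_single)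
  moreover have "pmf (coin K k) True + pmf (coin K k) False = 1"
  proof -
    have "(\<Sum>b\<in>{True, False}. pmf (coin K k) b) = 1" by (rule sum_pmf_eq_1) auto
    then show ?thesis by simp
  qed
  ultimately have "pmf (coin K k) True = real (min k K) / K" "pmf (coin K k) False = 1 - real (min k K) / K"
    by simp_all
  then show ?thesis
    by (subst integral_measure_pmf[of UNIV]) (auto simp: UNIV_bool simp del: of_nat_min)
qed

lemma finite_screen[simp]: "finite (set_pmf (screen K B pre xs))"
  by (induction xs arbitrary: pre) auto

lemma length_screen: "os \<in> set_pmf (screen K B pre xs) \<Longrightarrow> length os = length xs"
  by (induction xs arbitrary: pre os) auto

lemma finite_fresh[simp]: "finite (set_pmf s) \<Longrightarrow> finite (set_pmf (fresh s os))"
  by (induction os) (auto split: option.splits)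

lemma finite_resample[simp]: "finite (set_pmf s) \<Longrightarrow> finite (set_pmf (resample s i os))"
  by (auto simp: resample_def split: option.splits)

text \<open>Screening \<open>xs\<close> after \<open>pre\<close> consults for each \<open>y\<close>
  only the pools right after the first \<open>count_list pre y\<close>, as many as \<open>xs\<close>
  has occurrences of \<open>y\<close>. This locality justifies removing a ball, dropping an item and
  renumbering pools.\<close>

lemma screen_cong:
  assumes "\<And>y i. i < count_list xs y \<Longrightarrow>
    count B (y, Suc (count_list pre y + i)) = count B' (y, Suc (count_list pre' y + i))"
  shows "screen K B pre xs = screen K B' pre' xs"
  using assms
proof (induction xs arbitrary: pre pre')
  case (Cons x xs)
  have "screen K B (pre @ [x]) xs = screen K B' (pre' @ [x]) xs"
  proof (rule Cons.IH)
    fix y i assume "i < count_list xs y"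
    then show "count B (y, Suc (count_list (pre @ [x]) y + i)) = count B' (y, Suc (count_list (pre' @ [x]) y + i))"
      using Cons.prems[of "if y = x then Suc i else i" y] by (auto split: if_splits)
  qed
  with Cons.prems[of 0 x] show ?case by simp
qed simp

lemma E_screen_append:
  "E (screen K B pre (xs @ ys)) g =
     E (screen K B pre xs) (\<lambda>a. E (screen K B (pre @ xs) ys) (\<lambda>b. g (a @ b)))"
  by (induction xs arbitrary: pre g) (simp_all add: E_bind)

lemma E_fresh_append:
  assumes "finite (set_pmf s)"
  shows "E (fresh s (u @ v)) g = E (fresh s u) (\<lambda>a. E (fresh s v) (\<lambda>b. g (a @ b)))"
  by (induction u arbitrary: g) (use assms in \<open>auto simp: E_bind split: option.splits\<close>)

lemma map_somes_fresh: "map_pmf somes (fresh s os) = replicate_pmf (length (somes os)) s"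
proof (induction os)
  case (Cons x os)
  show ?case
    by (auto simp: pmf.map_comp o_def map_bind_pmf bind_map_pmf simp flip: Cons split: option.splits)
       (simp add: map_pmf_def bind_assoc_pmf bind_return_pmf)
qed simp

text \<open>A hybrid argument carried out on the test functions: \<open>G i\<close> refreshes the
  first \<open>i\<close> positions and takes values in [0,1] again, so \<open>step\<close> is always
  applied to the original \<open>D\<close>, and consecutive hybrids differ by one
  resampling.\<close>

lemma fresh_approx:
  assumes finD: "finite (set_pmf D)" and fins: "finite (set_pmf s)"
    and len: "\<And>os. os \<in> set_pmf D \<Longrightarrow> length os = t"
    and step: "\<And>i g. i < t \<Longrightarrow> (\<And>os. 0 \<le> g os \<and> g os \<le> 1) \<Longrightarrow>
        \<bar>E D g - E D (\<lambda>os. E (resample s i os) g)\<bar> \<le> \<epsilon>"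
    and g: "\<And>os. 0 \<le> g os \<and> g os \<le> 1"
  shows "\<bar>E D g - E D (\<lambda>os. E (fresh s os) g)\<bar> \<le> t * \<epsilon>"
proof -
  define G where "G i os = E (fresh s (take i os)) (\<lambda>a. g (a @ drop i os))" for i os
  have G01: "0 \<le> G i os \<and> G i os \<le> 1" for i os
    unfolding G_def using fins g by (intro conjI E_le E_ge0) auto
  have G_Suc: "G (Suc i) os = E (resample s i os) (G i)" if "os \<in> set_pmf D" "i < t" for i os
  proof -
    have i: "i < length os" using that len by simp
    define u c v where "u = take i os" and "c = os ! i" and "v = drop (Suc i) os"
    have os: "os = u @ c # v" "length u = i"
      using i by (auto simp: u_def c_def v_def id_take_nth_drop[symmetric])
    show ?thesis
    proof (cases c)
      case None
      then show ?thesis using os by (simp add: G_def resample_def nth_append E_fresh_append[OF fins])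
    next
      case (Some z)
      have "G (Suc i) os = E (fresh s u) (\<lambda>a. E s (\<lambda>y. g (a @ Some y # v)))"
        using os Some by (simp add: G_def E_fresh_append[OF fins] E_bind fins)
      \<comment> \<open>The prefix and position \<open>i\<close> are redrawn independently, so
        position \<open>i\<close> may come first.\<close>
      also have "\<dots> = E s (\<lambda>y. E (fresh s u) (\<lambda>a. g (a @ Some y # v)))"
        by (rule E_commute) (use fins in auto)
      finally show ?thesis using os Some by (simp add: G_def resample_def nth_append list_update_append)
    qed
  qed
  have "\<bar>E D g - E D (G i)\<bar> \<le> i * \<epsilon>" if "i \<le> t" for i
    using that
  proof (induction i)
    case 0
    then show ?case by (simp add: G_def)
  next
    case (Suc i)
    have "E D (G (Suc i)) = E D (\<lambda>os. E (resample s i os) (G i))"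
      using Suc.prems G_Suc by (intro E_cong) auto
    then have "\<bar>E D (G i) - E D (G (Suc i))\<bar> \<le> \<epsilon>"
      using step[of i "G i"] G01 Suc.prems by auto
    then show ?case using Suc.IH Suc.prems by (simp add: algebra_simps)
  qed
  from this[of t] have "\<bar>E D g - E D (G t)\<bar> \<le> t * \<epsilon>" by simp
  moreover have "E D (G t) = E D (\<lambda>os. E (fresh s os) g)"
    using len by (intro E_cong) (auto simp: G_def)
  ultimately show ?thesis by simp
qed

section \<open>Balls and the exchangeability of the pools\<close>

definition balls :: "nat \<Rightarrow> nat pmf \<Rightarrow> (nat \<times> nat) pmf" where
  "balls K p = pair_pmf p (pmf_of_set {1..K})"

lemma finite_balls[simp]: "K > 0 \<Longrightarrow> finite (set_pmf p) \<Longrightarrow> finite (set_pmf (balls K p))"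
  by (simp add: balls_def)

lemma pmf_balls: "K > 0 \<Longrightarrow> pmf (balls K p) (x, j) = (if j \<in> {1..K} then pmf p x / K else 0)"
  by (simp add: balls_def pmf_pair)

text \<open>The pool of a ball is uniform and independent of its label, so the pools may be
  renumbered for the single element \<open>x\<close> without changing the law; balls of other
  elements keep theirs.\<close>

lemma E_balls_permute:
  fixes f :: "(nat \<times> nat) multiset \<Rightarrow> real" and x :: nat
  assumes "K > 0" "bij_betw \<pi> {1..K} {1..K}"
  defines "\<Phi> \<equiv> \<lambda>(y, g). (y, if y = x then \<pi> g else g)"
  shows "E (replicate_pmf n (balls K p)) (\<lambda>bs. f (image_mset \<Phi> (mset bs))) =
    E (replicate_pmf n (balls K p)) (\<lambda>bs. f (mset bs))"
proof -
  have \<pi>: "map_pmf (\<lambda>g. if y = x then \<pi> g else g) (pmf_of_set {1..K}) = pmf_of_set {1..K}" for y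
    using map_pmf_of_set_bij_betw[OF assms(2)] assms(1) by (cases "y = x") (simp_all add: pmf.map_ident)
  have "map_pmf \<Phi> (balls K p) =
      bind_pmf p (\<lambda>y. map_pmf (Pair y) (map_pmf (\<lambda>g. if y = x then \<pi> g else g) (pmf_of_set {1..K})))"
    by (simp add: balls_def pair_pmf_def map_bind_pmf \<Phi>_def map_pmf_def bind_assoc_pmf bind_return_pmf)
  also have "\<dots> = balls K p"
    unfolding \<pi> by (simp add: balls_def pair_pmf_def map_pmf_def)
  finally have inv: "map_pmf \<Phi> (balls K p) = balls K p" .
  have "E (replicate_pmf n (balls K p)) (\<lambda>bs. f (mset bs)) =
      E (map_pmf (map \<Phi>) (replicate_pmf n (balls K p))) (\<lambda>bs. f (mset bs))"
    by (simp add: map_replicate_pmf inv)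
  then show ?thesis by (simp add: mset_map)
qed

lemma bij_betw_skip:
  assumes "c \<le> n" "n < K"
  defines "\<pi> \<equiv> \<lambda>g. if g = Suc c then Suc n else if Suc c < g \<and> g \<le> Suc n then g - 1 else g :: nat"
  shows "bij_betw \<pi> {1..K} {1..K}"
proof -
  have "inj_on \<pi> {1..K}" using assms(1) by (auto simp: inj_on_def \<pi>_def split: if_splits)
  moreover have "\<pi> ` {1..K} \<subseteq> {1..K}" using assms(1,2) by (auto simp: \<pi>_def)
  ultimately show ?thesis by (simp add: bij_betw_def endo_inj_surj)
qed

lemma count_image_inj: "inj f \<Longrightarrow> count (image_mset f M) (f b) = count M b"
  by (induction M) (auto dest: injD)

text \<open>The pools that serve the later occurrences of \<open>x\<close> are exchangeable, so a further occurrence of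
  \<open>x\<close> in between, which shifts them by one, is invisible.\<close>

lemma E_screen_shift:
  assumes "K > 0" "count_list T1 x + count_list T2 x < K"
  shows "E (replicate_pmf n (balls K p)) (\<lambda>bs. E (screen K (mset bs) [] T1)
           (\<lambda>a. E (screen K (mset bs) (T1 @ [x]) T2) (f a))) =
    E (replicate_pmf n (balls K p)) (\<lambda>bs. E (screen K (mset bs) [] T1)
           (\<lambda>a. E (screen K (mset bs) T1 T2) (f a)))"
proof -
  define c where "c = count_list T1 x"
  define m where "m = c + count_list T2 x"
  \<comment> \<open>A cycle: pool \<open>Suc c\<close>, which served the extra occurrence, goes
    behind the pools that \<open>T2\<close> uses, and these move down by one. The largest index
    moved is \<open>Suc m\<close>, hence the hypothesis that fewer than \<open>K\<close> occurrences
    surround \<open>x\<close>.\<close>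
  define \<pi> :: "nat \<Rightarrow> nat" where
    "\<pi> = (\<lambda>g. if g = Suc c then Suc m else if Suc c < g \<and> g \<le> Suc m then g - 1 else g)"
  define \<Phi> :: "nat \<times> nat \<Rightarrow> nat \<times> nat" where "\<Phi> = (\<lambda>(y, g). (y, if y = x then \<pi> g else g))"
  have "c \<le> m" by (simp add: m_def)
  then have inj: "inj \<Phi>"
    by (auto simp: inj_def \<Phi>_def \<pi>_def split: if_splits)
  have cnt: "count (image_mset \<Phi> M) (\<Phi> b) = count M b" for M b
    by (rule count_image_inj[OF inj])
  have 1: "screen K (image_mset \<Phi> M) [] T1 = screen K M [] T1" for M
  proof (rule screen_cong)
    fix y i assume "i < count_list T1 y"
    then have "\<Phi> (y, Suc i) = (y, Suc i)" by (auto simp: \<Phi>_def \<pi>_def c_def)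
    with cnt[of M "(y, Suc i)"] show "count (image_mset \<Phi> M) (y, Suc (count_list [] y + i)) = count M (y, Suc (count_list [] y + i))"
      by simp
  qed
  have 2: "screen K (image_mset \<Phi> M) T1 T2 = screen K M (T1 @ [x]) T2" for M
  proof (rule screen_cong)
    fix y i assume i: "i < count_list T2 y"
    then have "\<Phi> (y, Suc (count_list (T1 @ [x]) y + i)) = (y, Suc (count_list T1 y + i))"
      by (auto simp: \<Phi>_def \<pi>_def c_def m_def)
    with cnt[of M "(y, Suc (count_list (T1 @ [x]) y + i))"]
    show "count (image_mset \<Phi> M) (y, Suc (count_list T1 y + i)) = count M (y, Suc (count_list (T1 @ [x]) y + i))"
      by simp
  qed
  have "bij_betw \<pi> {1..K} {1..K}"
    unfolding \<pi>_def by (rule bij_betw_skip) (use assms in \<open>auto simp: c_def m_def\<close>)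
  from E_balls_permute[OF assms(1) this, of n p "\<lambda>M. E (screen K M [] T1) (\<lambda>a. E (screen K M T1 T2) (f a))" x]
  show ?thesis unfolding \<Phi>_def[symmetric] 1 2 .
qed

lemma E_replicate_split:
  assumes "finite (set_pmf p)" "i < t"
  shows "E (replicate_pmf t p) f = E (replicate_pmf i p) (\<lambda>T1. E (replicate_pmf (t - 1 - i) p)
    (\<lambda>T2. E p (\<lambda>x. f (T1 @ x # T2))))"
proof -
  have t: "t = i + Suc (t - 1 - i)" using assms(2) by simp
  show ?thesis
    by (subst t, subst E_replicate_add[OF assms(1)], subst E_replicate_Suc[OF assms(1)],
        subst E_commute) (use assms in auto)
qed

section \<open>Resampling the label at one position\<close>

lemma abs_mult_le_left:
  fixes w y :: real
  assumes "0 \<le> w" "\<bar>y\<bar> \<le> 1"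
  shows "\<bar>w * y\<bar> \<le> w"
  using mult_left_mono[OF assms(2,1)] assms(1) by (simp add: abs_mult)

lemma resample_approx:
  fixes p s :: "nat pmf"
  assumes finp: "finite (set_pmf p)" and fins: "finite (set_pmf s)" and K: "K > 0" and i: "i < t"
    and s: "\<And>x. pmf s x * pc = (pmf p x)\<^sup>2"
    and e1: "\<And>x j. x \<in> set_pmf p \<Longrightarrow> E (replicate_pmf (Suc n) (balls K p))
        (\<lambda>bs. (real (count_list bs (x, j)) - real (min (count_list bs (x, j)) K)) / K) \<le> \<epsilon>1"
    and e2: "\<And>x. x \<in> set_pmf p \<Longrightarrow> measure_pmf.prob (replicate_pmf (t - 1) p) {T. K \<le> count_list T x} \<le> \<epsilon>2"
    and g: "\<And>os. 0 \<le> g os \<and> g os \<le> 1"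
  defines "D \<equiv> bind_pmf (replicate_pmf t p)
      (\<lambda>T. bind_pmf (replicate_pmf (Suc n) (balls K p)) (\<lambda>bs. screen K (mset bs) [] T))"
  shows "\<bar>E D g - E D (\<lambda>os. E (resample s i os) g)\<bar> \<le> \<epsilon>1 + 2 * (Suc n / (K * K)) * pc * \<epsilon>2"
proof -
  define u where "u = t - 1 - i"
  define R where "R m = replicate_pmf m (balls K p)" for m
  define q where "q = Suc n / (K * K)"
  have finR[simp]: "finite (set_pmf (R m))" for m
    unfolding R_def by (intro finite_replicate_pmf finite_balls K finp)
  have finrep[simp]: "finite (set_pmf (replicate_pmf m p))" for m by (rule finite_replicate_pmf[OF finp])
  note [simp] = finp fins
  \<comment> \<open>The effect of the true label against a fresh one. It averages to 0 when
    \<open>x\<close> is drawn from \<open>s\<close>, and the proof steers towards this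
    average.\<close>
  define d where "d x a b = g (a @ Some x # b) - E s (\<lambda>y. g (a @ Some y # b))" for x a b
  define H where "H pre x M T1 T2 = E (screen K M [] T1) (\<lambda>a. E (screen K M pre T2) (d x a))"
    for pre x M T1 T2
  define \<theta> where "\<theta> k = real (min k K) / K" for k
  have "\<bar>d x a b\<bar> \<le> 1" for x a b
  proof -
    have "0 \<le> E s (\<lambda>y. g (a @ Some y # b))" "E s (\<lambda>y. g (a @ Some y # b)) \<le> 1"
      using g by (auto intro!: E_ge0 E_le)
    with g[of "a @ Some x # b"] show ?thesis by (auto simp: d_def)
  qed
  then have H1: "\<bar>H pre x M T1 T2\<bar> \<le> 1" for pre x M T1 T2
    unfolding H_def by (intro order_trans[OF E_abs] E_le) auto
  have q0: "0 \<le> q" by (simp add: q_def)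

  let ?h = "\<lambda>os. g os - E (resample s i os) g"
  have inner: "E (screen K M [] (T1 @ x # T2)) ?h = \<theta> (count M (x, Suc (count_list T1 x))) * H (T1 @ [x]) x M T1 T2"
    if "length T1 = i" for M T1 x T2
  proof -
    have "E (screen K M [] (T1 @ x # T2)) ?h = E (screen K M [] T1) (\<lambda>a.
       \<theta> (count M (x, Suc (count_list T1 x))) * E (screen K M (T1 @ [x]) T2) (\<lambda>b. ?h (a @ Some x # b)) +
       (1 - \<theta> (count M (x, Suc (count_list T1 x)))) * E (screen K M (T1 @ [x]) T2) (\<lambda>b. ?h (a @ None # b)))"
      unfolding E_screen_append by (simp add: E_bind E_coin[OF K] \<theta>_def del: of_nat_min)
    \<comment> \<open>\<open>resample\<close> leaves a rejected item alone, so the branch with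
      \<open>None\<close> cancels and only acceptance contributes.\<close>
    also have "\<dots> = E (screen K M [] T1) (\<lambda>a. \<theta> (count M (x, Suc (count_list T1 x))) * E (screen K M (T1 @ [x]) T2) (d x a))"
      using that by (intro E_cong) (auto dest!: length_screen simp: resample_def d_def[abs_def] nth_append list_update_append)
    finally show ?thesis by (simp add: H_def)
  qed
  have "E D g - E D (\<lambda>os. E (resample s i os) g) = E D ?h"
    unfolding D_def by (subst E_diff) (use K in \<open>auto simp: R_def[symmetric]\<close>)
  also have "\<dots> = E (replicate_pmf t p) (\<lambda>T. E (R (Suc n)) (\<lambda>bs. E (screen K (mset bs) [] T) ?h))"
    unfolding D_def R_def[symmetric] by (simp add: E_bind del: replicate_pmf.simps)
  also have "\<dots> = E (replicate_pmf i p) (\<lambda>T1. E (replicate_pmf u p) (\<lambda>T2. E p (\<lambda>x.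
      E (R (Suc n)) (\<lambda>bs. \<theta> (count_list bs (x, Suc (count_list T1 x))) * H (T1 @ [x]) x (mset bs) T1 T2))))"
    unfolding E_replicate_split[OF finp i] u_def[symmetric]
    by (intro E_cong) (auto simp: inner set_replicate_pmf count_mset)
  finally have main: "E D g - E D (\<lambda>os. E (resample s i os) g) = \<dots>" .

  define A where "A T1 T2 x = E (R (Suc n)) (\<lambda>bs. \<theta> (count_list bs (x, Suc (count_list T1 x))) * H (T1 @ [x]) x (mset bs) T1 T2)"
    for T1 T2 x
  \<comment> \<open>The target, with item and matched ball removed: \<open>n\<close> balls, and
    \<open>T2\<close> screened as if \<open>x\<close> had not occurred in between. The label
    \<open>x\<close> now enters through \<open>d\<close> alone.\<close>
  define Z where "Z T1 T2 x = E (R n) (\<lambda>bs. H T1 x (mset bs) T1 T2)" for T1 T2 x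
  define bad where "bad T1 T2 x = (of_bool (K \<le> count_list (T1 @ T2) x) :: real)" for T1 T2 and x :: nat
  have A: "\<bar>A T1 T2 x - q * pmf p x * Z T1 T2 x\<bar> \<le> \<epsilon>1 + 2 * q * (pmf p x * bad T1 T2 x)"
    if x: "x \<in> set_pmf p" for T1 T2 x
  proof -
    define k where "k = (x, Suc (count_list T1 x))"
    let ?H = "\<lambda>bs. H (T1 @ [x]) x (mset bs) T1 T2"
    \<comment> \<open>The truncated coin is replaced by the linear weight \<open>count / K\<close>.
      The difference is the excess over \<open>K\<close>, which \<open>\<epsilon>1\<close>
      controls.\<close>
    have "A T1 T2 x - E (R (Suc n)) (\<lambda>bs. count_list bs k / K * ?H bs)
        = E (R (Suc n)) (\<lambda>bs. (\<theta> (count_list bs k) - count_list bs k / K) * ?H bs)"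
      unfolding A_def k_def[symmetric] by (subst E_diff[symmetric]) (auto simp: algebra_simps)
    also have "\<bar>\<dots>\<bar> \<le> E (R (Suc n)) (\<lambda>bs. \<bar>(\<theta> (count_list bs k) - count_list bs k / K) * ?H bs\<bar>)"
      by (rule E_abs)
    also have "\<dots> \<le> E (R (Suc n)) (\<lambda>bs. (real (count_list bs k) - real (min (count_list bs k) K)) / K)"
    proof (rule E_mono)
      fix bs
      have "\<bar>\<theta> (count_list bs k) - count_list bs k / K\<bar> = (real (count_list bs k) - real (min (count_list bs k) K)) / K"
        using K by (auto simp: \<theta>_def min_def field_simps)
      moreover have "\<bar>\<theta> (count_list bs k) - count_list bs k / K\<bar> * \<bar>?H bs\<bar> \<le> \<bar>\<theta> (count_list bs k) - count_list bs k / K\<bar> * 1"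
        by (intro mult_left_mono H1) auto
      ultimately show "\<bar>(\<theta> (count_list bs k) - count_list bs k / K) * ?H bs\<bar>
          \<le> (real (count_list bs k) - real (min (count_list bs k) K)) / K"
        by (simp add: abs_mult)
    qed simp
    also have "\<dots> \<le> \<epsilon>1" unfolding R_def k_def by (rule e1[OF x])
    finally have 1: "\<bar>A T1 T2 x - E (R (Suc n)) (\<lambda>bs. count_list bs k / K * ?H bs)\<bar> \<le> \<epsilon>1" .
    \<comment> \<open>The matched ball is invisible to the rest: \<open>T1\<close> reads smaller
      pool indices of \<open>x\<close>, and \<open>T2\<close> after \<open>T1 @ [x]\<close> larger
      ones.\<close>
    have inv: "H (T1 @ [x]) x (add_mset k M) T1 T2 = H (T1 @ [x]) x M T1 T2" for M
    proof -
      have "screen K (add_mset k M) [] T1 = screen K M [] T1"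
        by (rule screen_cong) (auto simp: k_def)
      moreover have "screen K (add_mset k M) (T1 @ [x]) T2 = screen K M (T1 @ [x]) T2"
        by (rule screen_cong) (auto simp: k_def)
      ultimately show ?thesis by (simp add: H_def)
    qed
    have "E (R (Suc n)) (\<lambda>bs. count_list bs k / K * ?H bs) = E (R (Suc n)) (\<lambda>bs. count_list bs k * (?H bs / K))"
      by (simp add: field_simps)
    also have "\<dots> = Suc n * pmf (balls K p) k * E (R n) (\<lambda>bs. H (T1 @ [x]) x (add_mset k (mset bs)) T1 T2 / K)"
      unfolding R_def by (rule E_count_replicate) (use K in simp)
    finally have 2: "E (R (Suc n)) (\<lambda>bs. count_list bs k / K * ?H bs) =
        Suc n / K * pmf (balls K p) k * E (R n) ?H"
      by (simp add: inv)
    have "\<bar>Suc n / K * pmf (balls K p) k * E (R n) ?H - q * pmf p x * Z T1 T2 x\<bar> \<le> 2 * q * (pmf p x * bad T1 T2 x)"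
    proof (cases "count_list T1 x + count_list T2 x < K")
      case True
      then have "E (R n) ?H = Z T1 T2 x"
        unfolding Z_def H_def R_def by (rule E_screen_shift[OF K])
      moreover have "pmf (balls K p) k = pmf p x / K" using True K by (simp add: k_def pmf_balls)
      ultimately show ?thesis using True by (simp add: q_def bad_def)
    next
      case False
      \<comment> \<open>Once the pools may run out, both terms are bounded by the weight
        \<open>q * pmf p x\<close>, hence the factor 2.\<close>
      have "\<bar>E (R n) ?H\<bar> \<le> 1" "\<bar>Z T1 T2 x\<bar> \<le> 1"
        unfolding Z_def by (intro order_trans[OF E_abs] E_le; simp add: H1)+
      note le1 = this
      define w where "w = Suc n / K * pmf (balls K p) k"
      have w: "0 \<le> w" "w \<le> q * pmf p x"
        using K by (auto simp: w_def k_def pmf_balls q_def)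
      have "\<bar>w * E (R n) ?H\<bar> \<le> w" "\<bar>(q * pmf p x) * Z T1 T2 x\<bar> \<le> q * pmf p x"
        using le1 w q0 by (auto intro!: abs_mult_le_left)
      with w have "\<bar>w * E (R n) ?H - q * pmf p x * Z T1 T2 x\<bar> \<le> 2 * (q * pmf p x)"
        by linarith
      then show ?thesis using False by (simp add: bad_def w_def)
    qed
    with 1 2 show ?thesis by linarith
  qed

  have pc: "(\<Sum>x\<in>set_pmf p. (pmf p x)\<^sup>2 * f x) = pc * E s f" for f
  proof -
    have "pc \<noteq> 0"
    proof
      assume "pc = 0"
      then have "pmf p x = 0" for x using s[of x] by simp
      then show False using set_pmf_not_empty[of p] by (auto simp: set_pmf_iff)
    qed
    then have "set_pmf s = set_pmf p" using s by (auto simp: set_pmf_iff) (metis mult_eq_0_iff power2_eq_square)+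
    then show ?thesis by (simp add: E_sum_set sum_distrib_left flip: s) (simp add: mult_ac)
  qed
  \<comment> \<open>One factor \<open>pmf p x\<close> comes from the item and one from the matched
    ball. Their product is \<open>pc * pmf s x\<close>, so the average over \<open>p\<close> becomes
    an average of \<open>d\<close> over \<open>s\<close>, which vanishes. This is where the squared
    distribution enters.\<close>
  have zero: "E p (\<lambda>x. q * pmf p x * Z T1 T2 x) = 0" for T1 T2
  proof -
    have "E p (\<lambda>x. q * pmf p x * Z T1 T2 x) = q * (\<Sum>x\<in>set_pmf p. (pmf p x)\<^sup>2 * Z T1 T2 x)"
      by (simp add: E_sum_set sum_distrib_left power2_eq_square mult_ac)
    also have "\<dots> = q * (pc * E s (Z T1 T2))" by (simp only: pc)
    also have "E s (Z T1 T2) = E (R n) (\<lambda>bs. E (screen K (mset bs) [] T1) (\<lambda>a. E (screen K (mset bs) T1 T2) (\<lambda>b. E s (\<lambda>x. d x a b))))"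
      unfolding Z_def[abs_def] H_def by (subst E_commute[of s], simp, simp)+ (rule refl)
    also have "(\<lambda>a b. E s (\<lambda>x. d x a b)) = (\<lambda>a b. 0)"
      unfolding d_def by (subst E_diff) auto
    finally show ?thesis by simp
  qed
  have "\<bar>E p (A T1 T2)\<bar> \<le> \<epsilon>1 + 2 * q * E p (\<lambda>x. pmf p x * bad T1 T2 x)" for T1 T2
  proof -
    have "\<bar>E p (A T1 T2)\<bar> = \<bar>E p (\<lambda>x. A T1 T2 x - q * pmf p x * Z T1 T2 x)\<bar>"
      by (subst E_diff) (auto simp: zero)
    also have "\<dots> \<le> E p (\<lambda>x. \<bar>A T1 T2 x - q * pmf p x * Z T1 T2 x\<bar>)" by (rule E_abs)
    also have "\<dots> \<le> E p (\<lambda>x. \<epsilon>1 + 2 * q * (pmf p x * bad T1 T2 x))" by (rule E_mono) (use A in auto)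
    finally show ?thesis by (simp add: E_add)
  qed
  then have "\<bar>E (replicate_pmf u p) (\<lambda>T2. E p (A T1 T2))\<bar> \<le>
      E (replicate_pmf u p) (\<lambda>T2. \<epsilon>1 + 2 * q * E p (\<lambda>x. pmf p x * bad T1 T2 x))" for T1
    by - (rule order_trans[OF E_abs], rule E_mono, auto)
  then have "\<bar>E D g - E D (\<lambda>os. E (resample s i os) g)\<bar> \<le>
      E (replicate_pmf i p) (\<lambda>T1. E (replicate_pmf u p) (\<lambda>T2. \<epsilon>1 + 2 * q * E p (\<lambda>x. pmf p x * bad T1 T2 x)))"
    unfolding main A_def[symmetric]
    by - (rule order_trans[OF E_abs], rule E_mono, auto)
  also have "\<dots> = \<epsilon>1 + 2 * q * E p (\<lambda>x. pmf p x * E (replicate_pmf i p) (\<lambda>T1. E (replicate_pmf u p) (\<lambda>T2. bad T1 T2 x)))"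
    by (simp add: E_add E_commute[of _ p])
  finally have total: "\<bar>E D g - E D (\<lambda>os. E (resample s i os) g)\<bar> \<le> \<epsilon>1 + 2 * q * E p (\<lambda>x. pmf p x * E (replicate_pmf i p) (\<lambda>T1. E (replicate_pmf u p) (\<lambda>T2. bad T1 T2 x)))" .
  have "E p (\<lambda>x. pmf p x * E (replicate_pmf i p) (\<lambda>T1. E (replicate_pmf u p) (\<lambda>T2. bad T1 T2 x))) \<le> E p (\<lambda>x. pmf p x * \<epsilon>2)"
  proof (intro E_mono mult_left_mono)
    fix x assume x: "x \<in> set_pmf p"
    have "E (replicate_pmf i p) (\<lambda>T1. E (replicate_pmf u p) (\<lambda>T2. bad T1 T2 x)) =
        E (replicate_pmf (i + u) p) (\<lambda>T. of_bool (K \<le> count_list T x))"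
      by (simp add: E_replicate_add bad_def)
    also have "\<dots> \<le> \<epsilon>2" unfolding E_indicator using e2[OF x] i by (simp add: u_def)
    finally show "E (replicate_pmf i p) (\<lambda>T1. E (replicate_pmf u p) (\<lambda>T2. bad T1 T2 x)) \<le> \<epsilon>2" .
  qed auto
  also have "E p (\<lambda>x. pmf p x * \<epsilon>2) = pc * \<epsilon>2"
    using pc[of "\<lambda>_. 1"] by (simp add: E_sum_set power2_eq_square sum_distrib_right)
  finally have "2 * q * E p (\<lambda>x. pmf p x * E (replicate_pmf i p) (\<lambda>T1. E (replicate_pmf u p) (\<lambda>T2. bad T1 T2 x))) \<le> 2 * q * (pc * \<epsilon>2)"
    by (rule mult_left_mono) (use q0 in simp)
  with total show ?thesis by (simp add: q_def)
qed

section \<open>The sampling algorithm on lists\<close>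

text \<open>\<open>m\<close> counts the symbols still to be read as balls. The recursion reads one
  symbol at a time, like the program; an input that ends among the balls yields nothing.\<close>

primrec block :: "nat \<Rightarrow> nat \<Rightarrow> (nat \<times> nat) list \<Rightarrow> nat list \<Rightarrow> nat list pmf" where
  "block K 0 B xs = map_pmf somes (screen K (mset B) [] xs)"
| "block K (Suc m) B xs = (case xs of [] \<Rightarrow> return_pmf []
     | x # ys \<Rightarrow> bind_pmf (pmf_of_set {1..K}) (\<lambda>g. block K m (B @ [(x, g)]) ys))"

function stream :: "nat \<Rightarrow> nat \<Rightarrow> nat list \<Rightarrow> nat list pmf" where
  "stream K L xs = (if xs = [] \<or> L = 0 then return_pmf [] else
     bind_pmf (block K (K * L) [] (take (K * L + L) xs))
       (\<lambda>ys. map_pmf ((@) ys) (stream K L (drop (K * L + L) xs))))"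
  by auto
termination by (relation "Wellfounded.measure (\<lambda>(K, L, xs). length xs)") auto

declare stream.simps[simp del]

definition hit :: "nat \<Rightarrow> nat list \<Rightarrow> bool" where
  "hit T xs \<longleftrightarrow> (\<exists>x. T \<le> count_list xs x)"

definition harvest :: "nat \<Rightarrow> nat \<Rightarrow> nat list \<Rightarrow> nat list pmf" where
  "harvest T L = (if L = T then stream 1 1 else stream (8 * T) L)"

text \<open>Every probe uses up its \<open>L\<close> symbols, so that what follows sees samples
  independent of the decision to stop or to double.\<close>

function algo :: "nat \<Rightarrow> nat \<Rightarrow> nat list \<Rightarrow> nat list pmf" where
  "algo T L xs = (if L = 0 \<or> length xs < L then return_pmf []
     else if hit T (take L xs) then harvest T L (drop L xs)
     else algo T (2 * L) (drop L xs))"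
  by auto
termination by (relation "Wellfounded.measure (\<lambda>(T, L, xs). length xs)") auto

declare algo.simps[simp del]

lemma finite_block[simp]: "K > 0 \<Longrightarrow> finite (set_pmf (block K m B xs))"
  by (induction m arbitrary: B xs) (auto split: list.splits)

lemma finite_stream[simp]: "K > 0 \<Longrightarrow> finite (set_pmf (stream K L xs))"
  by (induction K L xs rule: stream.induct) (subst stream.simps, auto)

lemma finite_harvest[simp]: "T > 0 \<Longrightarrow> finite (set_pmf (harvest T L xs))"
  by (simp add: harvest_def)

lemma finite_algo[simp]: "T > 0 \<Longrightarrow> finite (set_pmf (algo T L xs))"
  by (induction T L xs rule: algo.induct) (subst algo.simps, auto)

lemma block_short: "length xs < m \<Longrightarrow> block K m B xs = return_pmf []"
proof (induction m arbitrary: B xs)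
  case (Suc m)
  then show ?case by (cases xs) auto
qed simp

lemma stream_short:
  assumes "length xs < K * L + L" "K > 0" "L > 0"
  shows "stream K L xs = block K (K * L) [] xs"
proof (cases "xs = []")
  case True
  then show ?thesis using assms by (simp add: stream.simps block_short)
next
  case False
  have "stream K L [] = return_pmf []" by (simp add: stream.simps)
  with False show ?thesis
    using assms by (subst stream.simps) (simp add: bind_return_pmf' map_pmf_def bind_assoc_pmf bind_return_pmf)
qed

text \<open>Attaching an independent uniform pool to each of the first \<open>m\<close> samples
  turns them into independent samples from \<open>balls\<close>, independent of the items that
  follow.\<close>

lemma bind_replicate_block:
  "bind_pmf (replicate_pmf (m + t) p) (block K m B) =
   bind_pmf (replicate_pmf m (balls K p)) (\<lambda>bs. bind_pmf (replicate_pmf t p)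
     (\<lambda>T. map_pmf somes (screen K (mset (B @ bs)) [] T)))"
proof (induction m arbitrary: B)
  case 0
  then show ?case by (simp add: bind_return_pmf cong: bind_pmf_cong)
next
  case (Suc m)
  have "bind_pmf (replicate_pmf (Suc m + t) p) (block K (Suc m) B) =
      bind_pmf p (\<lambda>x. bind_pmf (replicate_pmf (m + t) p) (\<lambda>xs. bind_pmf (pmf_of_set {1..K})
        (\<lambda>g. block K m (B @ [(x, g)]) xs)))"
    by (simp add: bind_assoc_pmf bind_return_pmf)
  also have "\<dots> = bind_pmf p (\<lambda>x. bind_pmf (pmf_of_set {1..K}) (\<lambda>g. bind_pmf (replicate_pmf (m + t) p)
        (block K m (B @ [(x, g)]))))"
    by (subst (2) bind_commute_pmf) (rule refl)
  also have "\<dots> = bind_pmf (balls K p) (\<lambda>b. bind_pmf (replicate_pmf m (balls K p))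
      (\<lambda>bs. bind_pmf (replicate_pmf t p) (\<lambda>T. map_pmf somes (screen K (mset (B @ b # bs)) [] T))))"
    unfolding Suc by (simp add: balls_def pair_pmf_def bind_assoc_pmf bind_return_pmf)
  finally show ?case by (simp add: bind_assoc_pmf bind_return_pmf)
qed

text \<open>The reference law keeps the length of the list and redraws its entries, so the bound
  also covers the dependence of the entries on the length. Test functions with values in [0,1],
  rather than events, let partial averages serve as tests again.\<close>

definition near_iid :: "'a pmf \<Rightarrow> real \<Rightarrow> 'a list pmf \<Rightarrow> bool" where
  "near_iid s \<epsilon> D \<longleftrightarrow> (\<forall>g. (\<forall>l. 0 \<le> g l \<and> g l \<le> 1) \<longrightarrow>
     \<bar>E D g - E D (\<lambda>l. E (replicate_pmf (length l) s) g)\<bar> \<le> \<epsilon>)"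

text \<open>Outside an event of probability \<open>\<delta>\<close> the mean of \<open>2\<close> to the power minus the length is at most \<open>a\<close>; stated with
  test functions, such bounds multiply along concatenation of independent lists.\<close>

definition decays :: "'a list pmf \<Rightarrow> real \<Rightarrow> real \<Rightarrow> bool" where
  "decays D a \<delta> \<longleftrightarrow> (\<forall>F c d. 0 \<le> c \<longrightarrow> 0 \<le> d \<longrightarrow>
     (\<forall>l. 0 \<le> F l \<and> F l \<le> 1 \<and> F l \<le> d + c * (1/2) ^ length l) \<longrightarrow> E D F \<le> d + \<delta> + c * a)"

text \<open>The second list is redrawn with the first one fixed, then the first one. The averaged
  test \<open>h\<close> has values in [0,1] again, and independent samples of length
  \<open>length (u @ v)\<close> split into two parts.\<close>

lemma near_iid_append:
  assumes fin: "finite (set_pmf D1)" "finite (set_pmf D2)" "finite (set_pmf s)"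
    and near: "near_iid s \<epsilon>1 D1" "near_iid s \<epsilon>2 D2"
  shows "near_iid s (\<epsilon>1 + \<epsilon>2) (bind_pmf D1 (\<lambda>u. map_pmf ((@) u) D2))"
  unfolding near_iid_def
proof (intro allI impI)
  fix g :: "'a list \<Rightarrow> real" assume g: "\<forall>l. 0 \<le> g l \<and> g l \<le> 1"
  let ?R = "\<lambda>l. replicate_pmf (length l) s"
  define h where "h u = E D2 (\<lambda>v. E (?R v) (\<lambda>r. g (u @ r)))" for u
  have h: "0 \<le> h u \<and> h u \<le> 1" for u
    unfolding h_def using g fin by (auto intro!: E_ge0 E_le)
  have "\<bar>E D1 (\<lambda>u. E D2 (\<lambda>v. g (u @ v))) - E D1 h\<bar> \<le> E D1 (\<lambda>u. \<bar>E D2 (\<lambda>v. g (u @ v)) - h u\<bar>)"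
    by (subst E_diff[symmetric, OF fin(1)]) (rule E_abs)
  also have "\<dots> \<le> \<epsilon>2"
    using near(2) g fin unfolding near_iid_def h_def by (intro E_le) auto
  finally have 1: "\<bar>E D1 (\<lambda>u. E D2 (\<lambda>v. g (u @ v))) - E D1 h\<bar> \<le> \<epsilon>2" .
  have 2: "\<bar>E D1 h - E D1 (\<lambda>u. E (?R u) h)\<bar> \<le> \<epsilon>1"
    using near(1) h unfolding near_iid_def by auto
  have "E D1 (\<lambda>u. E (?R u) h) = E D1 (\<lambda>u. E D2 (\<lambda>v. E (?R (u @ v)) g))"
    unfolding h_def length_append by (simp add: E_replicate_add fin E_commute[of _ D2])
  with 1 2 show "\<bar>E (bind_pmf D1 (\<lambda>u. map_pmf ((@) u) D2)) g -
      E (bind_pmf D1 (\<lambda>u. map_pmf ((@) u) D2)) (\<lambda>l. E (?R l) g)\<bar> \<le> \<epsilon>1 + \<epsilon>2"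
    by (simp add: E_bind fin)
qed

lemma near_iid_bind:
  fixes s :: "'b pmf" and D :: "'a \<Rightarrow> 'b list pmf"
  assumes fin: "finite (set_pmf P)" "\<And>x. x \<in> set_pmf P \<Longrightarrow> finite (set_pmf (D x))" "finite (set_pmf s)"
    and near: "\<And>x. x \<in> set_pmf P \<Longrightarrow> x \<notin> B \<Longrightarrow> near_iid s \<epsilon> (D x)" and \<epsilon>: "0 \<le> \<epsilon>"
  shows "near_iid s (\<epsilon> + measure_pmf.prob P B) (bind_pmf P D)"
  unfolding near_iid_def
proof (intro allI impI)
  fix g :: "'b list \<Rightarrow> real" assume g: "\<forall>l. 0 \<le> g l \<and> g l \<le> 1"
  define m where "m = (\<lambda>l::'b list. E (replicate_pmf (length l) s) g)"
  have m: "0 \<le> m l \<and> m l \<le> 1" for l unfolding m_def using g fin by (auto intro!: E_ge0 E_le)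
  have "\<bar>E P (\<lambda>x. E (D x) g) - E P (\<lambda>x. E (D x) m)\<bar> \<le> E P (\<lambda>x. \<bar>E (D x) g - E (D x) m\<bar>)"
    by (subst E_diff[symmetric, OF fin(1)]) (rule E_abs)
  also have "\<dots> \<le> E P (\<lambda>x. \<epsilon> + of_bool (x \<in> B))"
  proof (rule E_mono[OF fin(1)])
    fix x assume x: "x \<in> set_pmf P"
    show "\<bar>E (D x) g - E (D x) m\<bar> \<le> \<epsilon> + of_bool (x \<in> B)"
    proof (cases "x \<in> B")
      case True
      have "0 \<le> E (D x) g" "E (D x) g \<le> 1" "0 \<le> E (D x) m" "E (D x) m \<le> 1"
        using g m fin x by (auto intro!: E_ge0 E_le)
      then show ?thesis using True \<epsilon> by (simp add: abs_le_iff)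
    next
      case False
      then show ?thesis using near[OF x False] g by (auto simp: near_iid_def m_def)
    qed
  qed
  also have "\<dots> = \<epsilon> + measure_pmf.prob P B" by (simp add: E_add fin E_indicator)
  finally show "\<bar>E (bind_pmf P D) g - E (bind_pmf P D) (\<lambda>l. E (replicate_pmf (length l) s) g)\<bar> \<le> \<epsilon> + measure_pmf.prob P B"
    unfolding m_def by (simp add: E_bind fin)
qed

lemma near_iid_return_Nil: "0 \<le> \<epsilon> \<Longrightarrow> near_iid s \<epsilon> (return_pmf [])"
  by (simp add: near_iid_def)

lemma near_iid_mono: "near_iid s \<epsilon> D \<Longrightarrow> \<epsilon> \<le> \<epsilon>' \<Longrightarrow> near_iid s \<epsilon>' D"
  unfolding near_iid_def by (meson order_trans)

lemma decays_trivial: "finite (set_pmf D) \<Longrightarrow> decays D 1 0"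
  unfolding decays_def
proof (intro allI impI)
  fix F :: "'a list \<Rightarrow> real" and c d :: real
  assume fin: "finite (set_pmf D)" and cd: "0 \<le> c" "0 \<le> d"
    and F: "\<forall>l. 0 \<le> F l \<and> F l \<le> 1 \<and> F l \<le> d + c * (1/2) ^ length l"
  have "F l \<le> d + c" for l
  proof -
    have "c * (1/2) ^ length l \<le> c * 1" using cd by (intro mult_left_mono power_le_one) auto
    with F show ?thesis by (smt (verit))
  qed
  then show "E D F \<le> d + 0 + c * 1" using fin by (intro E_le) auto
qed

text \<open>With the first list \<open>u\<close> fixed, the second hypothesis is used with
  \<open>c\<close> scaled by \<open>(1/2) ^ length u\<close>. The result has the form that the first
  hypothesis accepts, with \<open>d + \<delta>2\<close> and \<open>c * a2\<close>.\<close>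

lemma decays_append:
  assumes fin: "finite (set_pmf D1)" "finite (set_pmf D2)"
    and "decays D1 a1 \<delta>1" "decays D2 a2 \<delta>2" "0 \<le> a2" "0 \<le> \<delta>2"
  shows "decays (bind_pmf D1 (\<lambda>u. map_pmf ((@) u) D2)) (a1 * a2) (\<delta>1 + \<delta>2)"
  unfolding decays_def
proof (intro allI impI)
  fix F :: "'a list \<Rightarrow> real" and c d :: real
  assume cd: "0 \<le> c" "0 \<le> d"
    and F: "\<forall>l. 0 \<le> F l \<and> F l \<le> 1 \<and> F l \<le> d + c * (1/2) ^ length l"
  define G where "G u = E D2 (\<lambda>v. F (u @ v))" for u
  have "0 \<le> G u \<and> G u \<le> 1 \<and> G u \<le> (d + \<delta>2) + (c * a2) * (1/2) ^ length u" for u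
  proof -
    have "E D2 (\<lambda>v. F (u @ v)) \<le> d + \<delta>2 + (c * (1/2) ^ length u) * a2"
      using assms(4)[unfolded decays_def, rule_format, of "c * (1/2) ^ length u" d "\<lambda>v. F (u @ v)"] cd F
      by (auto simp: power_add mult.assoc) (metis length_append power_add)
    then show ?thesis using F fin by (auto simp: G_def mult_ac intro!: E_ge0 E_le)
  qed
  then have "E D1 G \<le> (d + \<delta>2) + \<delta>1 + (c * a2) * a1"
    using assms(3)[unfolded decays_def, rule_format, of "c * a2" "d + \<delta>2" G] cd assms(5,6) by auto
  then show "E (bind_pmf D1 (\<lambda>u. map_pmf ((@) u) D2)) F \<le> d + (\<delta>1 + \<delta>2) + c * (a1 * a2)"
    by (simp add: E_bind fin G_def[abs_def] algebra_simps)
qed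

text \<open>Markov's inequality: \<open>2 ^ n * (1/2) ^ length l\<close> is at least 1 on lists
  shorter than \<open>n\<close>.\<close>

lemma decays_tail:
  assumes "decays D a \<delta>"
  shows "measure_pmf.prob D {l. length l < n} \<le> \<delta> + 2 ^ n * a"
proof -
  have "E D (\<lambda>l. of_bool (length l < n)) \<le> 0 + \<delta> + 2 ^ n * a"
  proof (rule assms[unfolded decays_def, rule_format])
    fix l :: "'a list"
    show "0 \<le> (of_bool (length l < n) :: real) \<and> of_bool (length l < n) \<le> (1::real) \<and>
         of_bool (length l < n) \<le> 0 + 2 ^ n * (1 / 2 :: real) ^ length l"
    proof (cases "length l < n")
      case True
      then have "(2::real) ^ n * (1/2) ^ length l = 2 ^ (n - length l)"
        by (simp add: power_diff power_one_over field_simps)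
      then show ?thesis by simp
    qed simp
  qed auto
  then show ?thesis by (simp add: E_indicator)
qed

section \<open>The program\<close>

lemma exec_While:
  "exec (While r c) s = (let s' = charge (bits (reg s r)) s in
     if reg s r \<noteq> 0 then bind_spmf (exec c s') (exec (While r c)) else return_spmf s')"
proof -
  let ?W = "while_spmf (\<lambda>t. reg t r \<noteq> 0) (\<lambda>t. exec c (charge (bits (reg t r)) t))"
  have "exec (While r c) = (\<lambda>s. map_spmf (\<lambda>t. charge (bits (reg t r)) t) (?W s))" by (rule ext) simp
  then show ?thesis
    by (subst exec.simps, subst while_spmf.simps) (simp add: Let_def map_spmf_bind_spmf o_def)
qed

lemma state_simps[simp]:
  "reg (charge n s) = reg s" "memory (charge n s) = memory s" "inp (charge n s) = inp s"
  "outp (charge n s) = outp s" "cost (charge n s) = cost s + n"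
  "reg (set_reg r v s) = (reg s)(r := v)" "memory (set_reg r v s) = memory s"
  "inp (set_reg r v s) = inp s" "outp (set_reg r v s) = outp s" "cost (set_reg r v s) = cost s"
  by (auto simp: charge_def set_reg_def)

section \<open>The code of the sampler\<close>

fun prog :: "com list \<Rightarrow> com" where
  "prog [] = Skip"
| "prog [c] = c"
| "prog (c # cs) = Seq c (prog cs)"

abbreviation (input) "rKap \<equiv> 0 :: nat"
abbreviation (input) "rOne \<equiv> 1 :: nat"
abbreviation (input) "rX \<equiv> 2 :: nat"
abbreviation (input) "rRem \<equiv> 3 :: nat"
abbreviation (input) "rAddr \<equiv> 4 :: nat"
abbreviation (input) "rCnt \<equiv> 5 :: nat"
abbreviation (input) "rTmp \<equiv> 6 :: nat"
abbreviation (input) "rIdx \<equiv> 7 :: nat"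
abbreviation (input) "rFlips \<equiv> 8 :: nat"
abbreviation (input) "rCoin \<equiv> 9 :: nat"
abbreviation (input) "rZero \<equiv> 10 :: nat"
abbreviation (input) "rT \<equiv> 11 :: nat"
abbreviation (input) "rLg \<equiv> 12 :: nat"
abbreviation (input) "rL \<equiv> 13 :: nat"
abbreviation (input) "rK \<equiv> 14 :: nat"
abbreviation (input) "rK1 \<equiv> 15 :: nat"
abbreviation (input) "rHit \<equiv> 16 :: nat"
abbreviation (input) "rGo \<equiv> 17 :: nat"
abbreviation (input) "rTwo \<equiv> 18 :: nat"

text \<open>Horner's scheme on random bits, most significant first: started with
  \<open>rIdx = 0\<close>, it leaves \<open>rIdx\<close> uniform below 2 to the power of the initial
  \<open>rFlips\<close>.\<close>

definition draw_loop :: com where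
  "draw_loop = While rFlips (prog [Flip rCoin, Arith Add rIdx rIdx rIdx, Arith Add rIdx rIdx rCoin,
     Arith Sub rFlips rFlips rOne])"

definition draw :: com where
  "draw = prog [Const rIdx 0, Arith Add rFlips rLg rZero, draw_loop]"

text \<open>The cell for element \<open>rX\<close> and pool \<open>rIdx\<close> is
  \<open>2 * (rX * rK1 + rIdx)\<close>. While sieving, \<open>rK1\<close> is \<open>K + 1\<close>,
  which leaves index 0 for counting items. \<open>rCnt\<close> keeps the count before the
  increment.\<close>

definition tally :: com where
  "tally = prog [Arith Mul rAddr rX rK1, Arith Add rAddr rAddr rIdx, Arith Add rAddr rAddr rAddr,
     Load rCnt rAddr, Arith Add rTmp rCnt rOne, Store rAddr rTmp,
     Arith Add rTmp rRem rRem, Arith Sub rTmp rTmp rOne, Store rTmp rAddr]"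

text \<open>Reading past the end yields 0, which is no element, so \<open>rX = 0\<close> after the
  loop signals that the input is exhausted.\<close>

definition scan :: "com \<Rightarrow> com" where
  "scan act = While rRem (Seq (Read rX) (If rX (Seq act (Arith Sub rRem rRem rOne)) (Const rRem 0)))"

definition wipe :: com where
  "wipe = While rRem (prog [Arith Add rTmp rRem rRem, Arith Sub rTmp rTmp rOne, Load rAddr rTmp,
     Store rAddr rZero, Arith Sub rRem rRem rOne])"

text \<open>Once the input is exhausted nothing is tallied any more, so the counters are cleared
  only if \<open>rX\<close> is nonzero.\<close>

definition pass :: "com \<Rightarrow> com" where
  "pass act = prog [Arith Mul rRem rK1 rL, scan act, If rX (Seq (Arith Mul rRem rK1 rL) wipe) Skip]"

text \<open>Truncated subtraction tests \<open>rT \<le> rCnt + 1\<close>, that is, whether the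
  present symbol brings its count to at least \<open>rT\<close>.\<close>

definition probe :: com where
  "probe = prog [Const rIdx 0, tally, Arith Add rTmp rCnt rOne, Arith Sub rTmp rT rTmp,
     If rTmp Skip (Const rHit 1)]"

text \<open>\<open>rCnt\<close> is the number \<open>v\<close> of earlier items equal to
  \<open>rX\<close>, and \<open>rAddr\<close> is the cell of pool 0, so the pool to consult,
  \<open>v + 1\<close>, lies \<open>2 * (v + 1)\<close> addresses higher. For
  \<open>v \<ge> K\<close> there is no such pool and the item is rejected.\<close>

definition judge :: com where
  "judge = prog [Arith Sub rTmp rK rCnt, If rTmp (prog [Arith Add rTmp rCnt rOne, Arith Add rTmp rTmp rTmp,
     Arith Add rTmp rAddr rTmp, Load rCnt rTmp, draw, Arith Sub rTmp rCnt rIdx, If rTmp (Write rX) Skip]) Skip]"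

text \<open>A pass has \<open>(K + 1) * L\<close> symbols, counted down in \<open>rRem\<close>. The
  first \<open>K * L\<close> are balls and the last \<open>L\<close> are items, so
  \<open>rRem > rL\<close> marks a ball.\<close>

definition sieve :: com where
  "sieve = Seq (Arith Sub rTmp rRem rL) (If rTmp (prog [draw, Arith Add rIdx rIdx rOne, tally])
     (prog [Const rIdx 0, tally, judge]))"

text \<open>\<open>rT\<close> doubles once per binary digit of the integer part of
  \<open>\<kappa>\<close> divided by 512, and \<open>rLg\<close> counts along from 3, so
  \<open>2 ^ rLg = 8 * rT\<close> is the number of pools.\<close>

definition startup :: com where
  "startup = prog [Const rOne 1, Const rTwo 2, Const rT 1, Const rLg 3, Const rTmp 512, Arith Div rTmp rKap rTmp,
     While rTmp (prog [Arith Add rT rT rT, Arith Add rLg rLg rOne, Arith Div rTmp rTmp rTwo]),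
     Const rK1 1, Arith Add rL rT rZero, Const rX 1, Const rGo 1]"

definition search :: com where
  "search = While rGo (Seq (pass probe) (If rX (If rHit (Const rGo 0) (Arith Add rL rL rL)) (Const rGo 0)))"

definition prepare :: com where
  "prepare = prog [Arith Sub rTmp rL rT, If rTmp (prog [Arith Add rK rT rT, Arith Add rK rK rK, Arith Add rK rK rK])
     (prog [Const rL 1, Const rK 1, Const rLg 0]), Arith Add rK1 rK rOne]"

definition collect :: com where
  "collect = While rX (pass sieve)"

definition sampler :: com where
  "sampler = prog [startup, search, If rX (Seq prepare collect) Skip]"

section \<open>Simulation of laws on lists by runs of the program\<close>

text \<open>Besides equality of the laws up to \<open>R\<close>, this includes termination with probability 1.\<close>

definition sim :: "('a \<Rightarrow> 'b \<Rightarrow> bool) \<Rightarrow> 'a pmf \<Rightarrow> 'b spmf \<Rightarrow> bool" where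
  "sim R P q = rel_spmf R (spmf_of_pmf P) q"

lemma sim_bind:
  assumes "sim R P q" "\<And>a b. R a b \<Longrightarrow> sim S (f a) (g b)"
  shows "sim S (bind_pmf P f) (bind_spmf q g)"
proof -
  have "spmf_of_pmf (bind_pmf P f) = bind_spmf (spmf_of_pmf P) (\<lambda>a. spmf_of_pmf (f a))"
    by (simp add: spmf_of_pmf_bind)
  with assms show ?thesis unfolding sim_def by (simp only:) (rule rel_spmf_bindI)
qed

lemma sim_return: "R a b \<Longrightarrow> sim R (return_pmf a) (return_spmf b)"
  by (simp add: sim_def)

lemma sim_map_left: "sim R (map_pmf h P) q \<longleftrightarrow> sim (\<lambda>a. R (h a)) P q"
  unfolding sim_def map_spmf_of_pmf[symmetric] spmf_rel_map ..

lemma sim_mono: "sim R P q \<Longrightarrow> (\<And>a b. R a b \<Longrightarrow> S a b) \<Longrightarrow> sim S P q"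
  unfolding sim_def by (erule rel_spmf_mono)

lemma bits_mono: "m \<le> n \<Longrightarrow> bits m \<le> bits n"
  by (simp add: bits_def floor_log_mono[THEN monoD])

lemma bits_pos: "1 \<le> bits n" by (simp add: bits_def)

lemma uniform_Suc:
  "pmf_of_set {..<2 ^ Suc c :: nat} = bind_pmf (pmf_of_set UNIV) (\<lambda>z. map_pmf ((+) (of_bool z * 2 ^ c)) (pmf_of_set {..<2 ^ c}))"
proof -
  let ?f = "\<lambda>(z, u). of_bool z * 2 ^ c + u :: nat"
  have ne: "{..<2 ^ c :: nat} \<noteq> {}" by (metis empty_iff lessThan_iff zero_less_numeral zero_less_power)
  have bij: "bij_betw ?f (UNIV \<times> {..<2 ^ c}) {..<2 ^ Suc c}"
  proof (rule bij_betw_byWitness[where f' = "\<lambda>n. (2 ^ c \<le> n, n mod 2 ^ c)"])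
    show "\<forall>a\<in>UNIV \<times> {..<2 ^ c}. (2 ^ c \<le> ?f a, ?f a mod 2 ^ c) = a" by auto
    show "\<forall>n\<in>{..<2 ^ Suc c}. ?f (2 ^ c \<le> n, n mod 2 ^ c) = n"
      by (auto simp: le_mod_geq)
  qed auto
  have "pmf_of_set {..<2 ^ Suc c} = map_pmf ?f (pmf_of_set (UNIV \<times> {..<2 ^ c}))"
    by (rule map_pmf_of_set_bij_betw[OF bij, symmetric]) (use ne in auto)
  also have "pmf_of_set ((UNIV :: bool set) \<times> {..<2 ^ c :: nat}) = pair_pmf (pmf_of_set UNIV) (pmf_of_set {..<2 ^ c})"
  proof (rule pmf_eqI)
    fix i :: "bool \<times> nat"
    show "pmf (pmf_of_set (UNIV \<times> {..<2 ^ c})) i = pmf (pair_pmf (pmf_of_set UNIV) (pmf_of_set {..<2 ^ c})) i"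
      using ne by (cases i) (auto simp: pmf_pair split: split_indicator)
  qed
  finally show ?thesis
    by (simp add: pair_pmf_def map_bind_pmf map_pmf_def bind_assoc_pmf bind_return_pmf)
qed

lemma sim_flip:
  assumes "\<And>z. R z (charge 1 (set_reg r (of_bool z) s))"
  shows "sim R (pmf_of_set UNIV) (exec (Flip r) s)"
proof -
  have "spmf_of_pmf (pmf_of_set (UNIV :: bool set)) = coin_spmf" by simp
  then show ?thesis
    unfolding sim_def exec.simps spmf_rel_map by (simp only:) (rule rel_spmf_reflI, rule assms)
qed

definition drawn :: "state \<Rightarrow> nat \<Rightarrow> nat \<Rightarrow> state \<Rightarrow> bool" where
  "drawn s k u t \<longleftrightarrow> reg t rIdx = u \<and> (\<forall>r. r \<notin> {rIdx, rFlips, rCoin} \<longrightarrow> reg t r = reg s r) \<and>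
      memory t = memory s \<and> inp t = inp s \<and> outp t = outp s \<and> cost t \<le> cost s + k"

text \<open>The hypothesis on \<open>(rIdx + 1) * 2 ^ c\<close> keeps all values below
  \<open>V\<close> and survives an iteration, because
  \<open>2 * rIdx + z + 1 \<le> 2 * (rIdx + 1)\<close> for a bit \<open>z\<close>.\<close>

lemma draw_loop_sim:
  assumes "reg s rFlips = c" "reg s rOne = 1"
    and "(reg s rIdx + 1) * 2 ^ c \<le> V" "c \<le> V" "1 \<le> V"
  shows "sim (drawn s (8 * bits V * c + 1))
    (map_pmf ((+) (reg s rIdx * 2 ^ c)) (pmf_of_set {..<2 ^ c})) (exec draw_loop s)"
  using assms
proof (induction c arbitrary: s)
  case 0
  have "pmf_of_set {..<2 ^ 0 :: nat} = return_pmf 0" by (simp add: lessThan_Suc pmf_of_set_singleton)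
  with 0 show ?case
    unfolding draw_loop_def by (subst exec_While) (auto simp: Let_def bits_def drawn_def intro!: sim_return)
next
  case (Suc c)
  let ?b = "bits V"
  define s1 where "s1 = charge (bits (reg s rFlips)) s"
  have law: "map_pmf ((+) (reg s rIdx * 2 ^ Suc c)) (pmf_of_set {..<2 ^ Suc c}) =
      bind_pmf (pmf_of_set UNIV) (\<lambda>z. map_pmf ((+) ((2 * reg s rIdx + of_bool z) * 2 ^ c)) (pmf_of_set {..<2 ^ c}))"
    unfolding uniform_Suc
    by (auto simp: map_bind_pmf pmf.map_comp o_def algebra_simps intro!: bind_pmf_cong pmf.map_cong)
  have le: "2 * (reg s rIdx + 1) * 2 ^ c \<le> V" using Suc.prems by simp
  have "2 * (reg s rIdx + 1) * 1 \<le> 2 * (reg s rIdx + 1) * 2 ^ c" by (intro mult_left_mono) auto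
  from order_trans[OF this le] have le2: "2 * reg s rIdx + 2 \<le> V" by simp
  have b: "bits (reg s rIdx) \<le> ?b" "bits (reg s rIdx + reg s rIdx) \<le> ?b" "bits 1 \<le> ?b" "bits 0 \<le> ?b"
    "bits (Suc c) \<le> ?b" and bz: "bits (of_bool z) \<le> ?b" for z
    using le2 Suc.prems by (auto intro!: bits_mono)
  note b = b bits_pos[of V]
  have loop: "exec draw_loop s = bind_spmf (exec (Flip rCoin) s1) (\<lambda>t. bind_spmf (exec (prog [Arith Add rIdx rIdx rIdx,
      Arith Add rIdx rIdx rCoin, Arith Sub rFlips rFlips rOne]) t) (exec draw_loop))"
    unfolding draw_loop_def using Suc.prems(1) by (subst exec_While) (simp add: Let_def s1_def)
  show ?case
    unfolding law loop
  proof (rule sim_bind[OF sim_flip[where R = "\<lambda>z t. t = charge 1 (set_reg rCoin (of_bool z) s1)"]])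
    fix z t assume t: "t = charge 1 (set_reg rCoin (of_bool z) s1)"
    obtain t' where exec: "exec (prog [Arith Add rIdx rIdx rIdx, Arith Add rIdx rIdx rCoin, Arith Sub rFlips rFlips rOne]) t
          = return_spmf t'"
      and t': "reg t' rIdx = 2 * reg s rIdx + of_bool z" "reg t' rFlips = c"
        "\<forall>r. r \<notin> {rIdx, rFlips, rCoin} \<longrightarrow> reg t' r = reg s r"
        "memory t' = memory s" "inp t' = inp s" "outp t' = outp s" "cost t' \<le> cost s + 8 * ?b"
      using Suc.prems b bz[of z] by (simp add: t s1_def)
    have "(2 * reg s rIdx + of_bool z + 1) * 2 ^ c \<le> (2 * (reg s rIdx + 1)) * 2 ^ c"
      by (intro mult_right_mono) (cases z; simp)+
    from order_trans[OF this le] have *: "(reg t' rIdx + 1) * 2 ^ c \<le> V" unfolding t' .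
    have "sim (drawn t' (8 * ?b * c + 1)) (map_pmf ((+) (reg t' rIdx * 2 ^ c)) (pmf_of_set {..<2 ^ c})) (exec draw_loop t')"
      by (rule Suc.IH) (use t' * Suc.prems in auto)
    then have "sim (drawn s (8 * ?b * Suc c + 1)) (map_pmf ((+) (reg t' rIdx * 2 ^ c)) (pmf_of_set {..<2 ^ c})) (exec draw_loop t')"
      by (rule sim_mono) (use t' in \<open>auto simp: drawn_def\<close>)
    then show "sim (drawn s (8 * ?b * Suc c + 1)) (map_pmf ((+) ((2 * reg s rIdx + of_bool z) * 2 ^ c)) (pmf_of_set {..<2 ^ c}))
        (bind_spmf (exec (prog [Arith Add rIdx rIdx rIdx,
      Arith Add rIdx rIdx rCoin, Arith Sub rFlips rFlips rOne]) t) (exec draw_loop))"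
      unfolding exec t' by simp
  qed simp
qed

lemma draw_sim:
  assumes "reg s rOne = 1" "reg s rZero = 0" "reg s rLg = lg" "2 ^ lg \<le> V"
  shows "sim (drawn s (12 * bits V * bits V)) (pmf_of_set {..<2 ^ lg}) (exec draw s)"
proof -
  have V: "lg < V" "1 \<le> V"
    using assms(4) less_exp[of lg] by linarith+
  define t where "t = charge (bits 0) (set_reg rIdx 0 s)"
  define t' where "t' = charge (bits (reg t rLg) + bits (reg t rZero)) (set_reg rFlips (reg t rLg + reg t rZero) t)"
  have exec: "exec draw s = exec draw_loop t'"
    by (simp add: draw_def t_def t'_def)
  have b: "bits 0 \<le> bits V" "bits lg \<le> bits V" "1 \<le> bits V" using V by (auto intro: bits_mono bits_pos simp del: One_nat_def)
  \<comment> \<open>At most \<open>bits V\<close> iterations at \<open>8 * bits V\<close> each: this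
    is the origin of the square of \<open>bits V\<close> in the cost of a symbol.\<close>
  have lgb: "lg \<le> bits V"
  proof -
    have "floor_log (2 ^ lg) \<le> floor_log V" by (rule monoD[OF floor_log_mono assms(4)])
    then show ?thesis by (simp add: bits_def)
  qed
  have t': "reg t' rIdx = 0" "reg t' rFlips = lg" "reg t' rOne = 1" "cost t' \<le> cost s + 3 * bits V"
    "memory t' = memory s" "inp t' = inp s" "outp t' = outp s"
    "\<forall>r. r \<notin> {rIdx, rFlips, rCoin} \<longrightarrow> reg t' r = reg s r"
    using assms b by (simp_all add: t_def t'_def)
  have id: "map_pmf ((+) (0 * 2 ^ lg)) (pmf_of_set {..<2 ^ lg :: nat}) = pmf_of_set {..<2 ^ lg}"
  proof -
    have "(+) (0 * 2 ^ lg) = (id :: nat \<Rightarrow> nat)" by auto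
    then show ?thesis by (simp only: pmf.map_id id_apply)
  qed
  have loop: "sim (drawn t' (8 * bits V * lg + 1)) (pmf_of_set {..<2 ^ lg}) (exec draw_loop t')"
    using draw_loop_sim[OF t'(2,3), of V] assms V t'(1) unfolding t'(1) id by simp
  have "8 * bits V * lg \<le> 8 * bits V * bits V" using lgb by simp
  moreover have "bits V \<le> bits V * bits V" using b(3) by simp
  ultimately have "cost t' + (8 * bits V * lg + 1) \<le> cost s + 12 * bits V * bits V"
    using b(3) t'(4) by linarith
  then have "drawn s (12 * bits V * bits V) u w" if "drawn t' (8 * bits V * lg + 1) u w" for u w
    using that t' unfolding drawn_def by (metis (no_types, lifting) order_trans)
  with loop show ?thesis unfolding exec by (rule sim_mono)
qed

section \<open>Counters in memory and their log\<close>

text \<open>Even addresses hold the counters; the odd address \<open>2 * r - 1\<close> records the counter that was used when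
  \<open>r\<close> symbols were left in the pass, so that the counters can be cleared in time linear in the pass.\<close>

definition tallied :: "nat \<Rightarrow> nat list \<Rightarrow> state \<Rightarrow> bool" where
  "tallied n cs s \<longleftrightarrow> (\<forall>c. memory s (2 * c) = count_list cs c) \<and>
     (\<forall>i<length cs. memory s (2 * (n - i) - 1) = 2 * cs ! i)"

lemma tally_exec:
  assumes s: "reg s rOne = 1" "reg s rRem + length cs = n" "0 < reg s rRem" "tallied n cs s"
    and c: "c = reg s rX * reg s rK1 + reg s rIdx" and V: "2 * c \<le> V" "2 * n \<le> V" "reg s rK1 \<le> V" "reg s rIdx \<le> V" "reg s rX \<le> V"
  shows "\<exists>t. exec tally s = return_spmf t \<and> tallied n (cs @ [c]) t \<and>
    reg t rAddr = 2 * c \<and> reg t rCnt = count_list cs c \<and>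
    (\<forall>r. r \<notin> {rAddr, rCnt, rTmp} \<longrightarrow> reg t r = reg s r) \<and> inp t = inp s \<and> outp t = outp s \<and>
    cost t \<le> cost s + 18 * bits V"
proof -
  let ?v = "count_list cs c" and ?m = "(memory s)(2 * c := Suc (count_list cs c), 2 * reg s rRem - 1 := 2 * c)"
  have v: "memory s (2 * c) = ?v" using s by (simp add: tallied_def)
  have "?v \<le> length cs" by (rule count_le_length)
  then have "Suc ?v \<le> V" using s V by linarith
  then have b: "bits (reg s rX) \<le> bits V" "bits (reg s rK1) \<le> bits V" "bits (reg s rIdx) \<le> bits V"
    "bits (reg s rX * reg s rK1) \<le> bits V" "bits c \<le> bits V" "bits (2 * c) \<le> bits V"
    "bits ?v \<le> bits V" "bits (Suc ?v) \<le> bits V" "bits 1 \<le> bits V" "bits (reg s rRem) \<le> bits V"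
    "bits (2 * reg s rRem) \<le> bits V" "bits (2 * reg s rRem - 1) \<le> bits V"
    using s V c by (auto intro!: bits_mono)
  have ex: "\<exists>t. exec tally s = return_spmf t \<and> memory t = ?m \<and>
    reg t rAddr = 2 * c \<and> reg t rCnt = ?v \<and>
    (\<forall>r. r \<notin> {rAddr, rCnt, rTmp} \<longrightarrow> reg t r = reg s r) \<and> inp t = inp s \<and> outp t = outp s \<and>
    cost t \<le> cost s + 18 * bits V"
    using s b v by (simp add: tally_def Let_def flip: c mult_2)
  then obtain t where t: "exec tally s = return_spmf t" "memory t = ?m"
    "reg t rAddr = 2 * c" "reg t rCnt = ?v"
    "\<And>r. r \<notin> {rAddr, rCnt, rTmp} \<Longrightarrow> reg t r = reg s r" "inp t = inp s" "outp t = outp s"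
    "cost t \<le> cost s + 18 * bits V" by blast
  \<comment> \<open>Parity separates the log from the counters: writing the log entry changes no
    counter.\<close>
  have odd: "2 * reg s rRem - 1 \<noteq> 2 * d" for d using s(3) by presburger
  have "tallied n (cs @ [c]) t"
    unfolding tallied_def
  proof (intro conjI allI impI)
    fix d
    show "memory t (2 * d) = count_list (cs @ [c]) d"
      using s(4) odd[of d] by (auto simp: t(2) tallied_def)
  next
    fix i assume i: "i < length (cs @ [c])"
    show "memory t (2 * (n - i) - 1) = 2 * (cs @ [c]) ! i"
    proof (cases "i = length cs")
      case True
      then show ?thesis using s(2) by (auto simp: t(2))
    next
      case False
      then have "i < length cs" "2 * (n - i) - 1 \<noteq> 2 * reg s rRem - 1" "2 * (n - i) - 1 \<noteq> 2 * c"
        using i s(2,3) by (auto, presburger)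
      then show ?thesis using s(4) by (simp add: t(2) tallied_def nth_append)
    qed
  qed
  with t show ?thesis by blast
qed

definition keep :: "state \<Rightarrow> state \<Rightarrow> bool" where
  "keep s t \<longleftrightarrow> (\<forall>r\<in>{rOne, rZero, rT, rLg, rL, rK, rK1, rGo}. reg t r = reg s r)"

lemma keepD:
  assumes "keep s t"
  shows "reg t rOne = reg s rOne" "reg t rZero = reg s rZero" "reg t rT = reg s rT" "reg t rLg = reg s rLg"
    "reg t rL = reg s rL" "reg t rK = reg s rK" "reg t rK1 = reg s rK1" "reg t rGo = reg s rGo"
  using assms by (simp_all add: keep_def)

lemma keep_trans: "keep s t \<Longrightarrow> keep t u \<Longrightarrow> keep s u"
  by (simp add: keep_def)

lemma coin_0: "K > 0 \<Longrightarrow> coin K 0 = return_pmf False"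
  by (simp add: coin_def map_pmf_const)

lemma bits_sq: "bits V \<le> bits V * bits V"
  using bits_pos[of V] by simp

lemma draw_sim_less:
  assumes "reg s rOne = 1" "reg s rZero = 0" "reg s rLg = lg" "2 ^ lg \<le> V"
  shows "sim (\<lambda>u t. drawn s (12 * bits V * bits V) u t \<and> u < 2 ^ lg) (pmf_of_set {..<2 ^ lg}) (exec draw s)"
proof -
  have "{..<2 ^ lg :: nat} \<noteq> {}" by (metis empty_iff lessThan_iff zero_less_numeral zero_less_power)
  then have "set_spmf (spmf_of_pmf (pmf_of_set {..<2 ^ lg :: nat})) = {..<2 ^ lg}" by simp
  then show ?thesis
    using draw_sim[OF assms] unfolding sim_def by - (erule rel_spmf_mono_strong, simp)
qed

text \<open>A uniform \<open>u\<close> below \<open>K\<close> is compared with the number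
  \<open>k\<close> of balls; \<open>k - u\<close> is nonzero exactly if \<open>u < k\<close>. So
  \<open>k > K\<close> means certain acceptance, in agreement with the truncation in
  \<open>coin\<close>.\<close>

lemma judge_sim:
  assumes s: "reg s rOne = 1" "reg s rZero = 0" "reg s rLg = lg" "reg s rK = 2 ^ lg"
    and a: "reg s rAddr = 2 * c" "reg s rCnt = v" "v < 2 ^ lg \<Longrightarrow> memory s (2 * (c + Suc v)) = k"
    and V: "2 * (c + 2 ^ lg) \<le> V" "k \<le> V" "v \<le> V" "reg s rX \<le> V"
  shows "sim (\<lambda>z t. keep s t \<and> reg t rX = reg s rX \<and> reg t rRem = reg s rRem \<and> memory t = memory s \<and>
      inp t = inp s \<and> outp t = outp s @ (if z then [reg s rX] else []) \<and> cost t \<le> cost s + 30 * bits V * bits V)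
    (coin (2 ^ lg) (if v < 2 ^ lg then k else 0)) (exec judge s)"
    (is "sim ?R _ _")
proof -
  let ?b = "bits V"
  define s1 where "s1 = charge (bits (reg s rK) + bits (reg s rCnt)) (set_reg rTmp (reg s rK - reg s rCnt) s)"
  define s2 where "s2 = charge (bits (reg s1 rTmp)) s1"
  have kV: "1 \<le> (2::nat) ^ lg" "2 ^ lg \<le> V" "1 \<le> V"
  proof -
    have "2 ^ lg \<le> 2 * (c + 2 ^ lg)" by simp
    with V(1) show "2 ^ lg \<le> V" by (rule order_trans[rotated])
    moreover show "1 \<le> (2::nat) ^ lg" by simp
    ultimately show "1 \<le> V" by linarith
  qed
  have b: "bits (2 ^ lg) \<le> ?b" "bits v \<le> ?b" "bits (2 ^ lg - v) \<le> ?b" "bits 1 \<le> ?b" "bits (reg s rX) \<le> ?b"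
    using V kV by (auto intro!: bits_mono simp del: One_nat_def)
  note sq = bits_sq[of V] bits_pos[of V]
  show ?thesis
  proof (cases "v < 2 ^ lg")
    case False
    then have "exec judge s = return_spmf s2"
      using s a by (simp add: judge_def s1_def s2_def Let_def)
    moreover have "?R False s2"
    proof -
      have "cost s2 \<le> cost s + 3 * ?b" using s a b False by (simp add: s1_def s2_def)
      then have "cost s2 \<le> cost s + 30 * ?b * ?b" using sq by linarith
      then show ?thesis by (simp add: s1_def s2_def keep_def)
    qed
    ultimately show ?thesis using False by (simp add: coin_0 sim_return)
  next
    case True
    define s3 where "s3 = charge (bits (reg s2 rCnt) + bits (reg s2 rOne)) (set_reg rTmp (reg s2 rCnt + reg s2 rOne) s2)"
    define s4 where "s4 = charge (bits (reg s3 rTmp) + bits (reg s3 rTmp)) (set_reg rTmp (reg s3 rTmp + reg s3 rTmp) s3)"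
    define s5 where "s5 = charge (bits (reg s4 rAddr) + bits (reg s4 rTmp)) (set_reg rTmp (reg s4 rAddr + reg s4 rTmp) s4)"
    define s6 where "s6 = charge (bits (reg s5 rTmp) + bits (memory s5 (reg s5 rTmp))) (set_reg rCnt (memory s5 (reg s5 rTmp)) s5)"
    have b2: "bits (Suc v) \<le> ?b" "bits (2 * Suc v) \<le> ?b" "bits (2 * c) \<le> ?b" "bits (2 * (c + Suc v)) \<le> ?b" "bits k \<le> ?b"
      using V True by (auto intro!: bits_mono)
    have r3: "reg s3 rTmp = Suc v" using s a by (simp add: s3_def s2_def s1_def)
    have r4: "reg s4 rTmp = 2 * Suc v" using r3 by (simp add: s4_def)
    have r5: "reg s5 rTmp = 2 * (c + Suc v)" using r4 a by (simp add: s5_def s4_def s3_def s2_def s1_def)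
    have m5: "memory s5 = memory s" by (simp add: s5_def s4_def s3_def s2_def s1_def)
    have m6: "memory s5 (reg s5 rTmp) = k" using a(3)[OF True] by (simp only: r5 m5)
    have c2: "cost s2 \<le> cost s + 3 * ?b" using s a b by (simp add: s2_def s1_def)
    have r: "reg s4 rAddr = 2 * c" "reg s2 rCnt = v" "reg s2 rOne = 1"
      using s a by (simp_all add: s4_def s3_def s2_def s1_def)
    have "cost s3 = cost s2 + (bits (reg s2 rCnt) + bits (reg s2 rOne))" by (simp add: s3_def)
    moreover have "cost s4 = cost s3 + (bits (reg s3 rTmp) + bits (reg s3 rTmp))" by (simp add: s4_def)
    moreover have "cost s5 = cost s4 + (bits (reg s4 rAddr) + bits (reg s4 rTmp))" by (simp add: s5_def)
    moreover have "cost s6 = cost s5 + (bits (reg s5 rTmp) + bits (memory s5 (reg s5 rTmp)))" by (simp add: s6_def)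
    ultimately have c6: "cost s6 \<le> cost s + 11 * ?b"
      using c2 b b2 unfolding r r3 r4 r5 m5 m6[unfolded r5 m5] by linarith
    have s6: "reg s6 rCnt = k" "keep s s6" "reg s6 rX = reg s rX" "reg s6 rRem = reg s rRem" "memory s6 = memory s"
      "inp s6 = inp s" "outp s6 = outp s"
      using m6 by (simp_all add: s6_def s5_def s4_def s3_def s2_def s1_def keep_def)
    have exec: "exec judge s = bind_spmf (exec draw s6) (exec (prog [Arith Sub rTmp rCnt rIdx, If rTmp (Write rX) Skip]))"
      using s a True by (simp add: judge_def s1_def s2_def s3_def s4_def s5_def s6_def Let_def)
    have "sim ?R (bind_pmf (pmf_of_set {..<2 ^ lg}) (\<lambda>u. return_pmf (u < k)))
       (bind_spmf (exec draw s6) (exec (prog [Arith Sub rTmp rCnt rIdx, If rTmp (Write rX) Skip])))"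
    proof (rule sim_bind[where R = "\<lambda>u t. drawn s6 (12 * ?b * ?b) u t \<and> u < 2 ^ lg"])
      show "sim (\<lambda>u t. drawn s6 (12 * ?b * ?b) u t \<and> u < 2 ^ lg) (pmf_of_set {..<2 ^ lg}) (exec draw s6)"
        by (rule draw_sim_less) (use s kV keepD[OF s6(2)] in auto)
      fix u t assume ut: "drawn s6 (12 * ?b * ?b) u t \<and> u < 2 ^ lg"
      then have u: "bits u \<le> ?b" "bits (k - u) \<le> ?b" using kV V by (auto intro!: bits_mono)
      have t: "reg t rIdx = u" "reg t rCnt = k" "keep s t" "reg t rX = reg s rX" "reg t rRem = reg s rRem" "memory t = memory s"
        "inp t = inp s" "outp t = outp s" "cost t \<le> cost s + 11 * ?b + 12 * ?b * ?b"
        using ut s6 c6 by (auto simp: drawn_def keep_def)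
      obtain t' where t': "exec (prog [Arith Sub rTmp rCnt rIdx, If rTmp (Write rX) Skip]) t = return_spmf t'"
        "keep s t'" "reg t' rX = reg s rX" "reg t' rRem = reg s rRem" "memory t' = memory s" "inp t' = inp s"
        "outp t' = outp s @ (if u < k then [reg s rX] else [])" "cost t' \<le> cost t + 4 * ?b"
        using t u b b2(5) by (cases "u < k") (auto simp: Let_def keep_def)
      have "cost t' \<le> cost s + 30 * bits V * bits V" using t'(8) t(9) sq by linarith
      with t'(2-7) have "?R (u < k) t'" by simp
      then show "sim ?R (return_pmf (u < k)) (exec (prog [Arith Sub rTmp rCnt rIdx, If rTmp (Write rX) Skip]) t)"
        unfolding t'(1) by (rule sim_return)
    qed
    then show ?thesis using True by (simp add: exec coin_def map_pmf_def)
  qed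
qed

definition enc :: "nat \<Rightarrow> nat \<times> nat \<Rightarrow> nat" where
  "enc K b = fst b * (K + 1) + snd b"

lemma enc_inj: "g \<le> K \<Longrightarrow> j \<le> K \<Longrightarrow> enc K (x, g) = enc K (y, j) \<longleftrightarrow> x = y \<and> g = j"
proof
  assume gj: "g \<le> K" "j \<le> K" and eq: "enc K (x, g) = enc K (y, j)"
  have "enc K (x, g) div (K + 1) = x" "enc K (x, g) mod (K + 1) = g"
    using gj by (auto simp: enc_def simp del: mult_Suc_right)
  moreover have "enc K (y, j) div (K + 1) = y" "enc K (y, j) mod (K + 1) = j"
    using gj by (auto simp: enc_def simp del: mult_Suc_right)
  ultimately show "x = y \<and> g = j" using eq by metis
qed simp

lemma count_enc:
  assumes "\<forall>b\<in>set ps. snd b \<le> K" "j \<le> K"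
  shows "count_list (map (enc K) ps) (enc K (x, j)) = count_list ps (x, j)"
  using assms
proof (induction ps)
  case (Cons b ps)
  then show ?case using enc_inj[of "snd b" K j "fst b" x] by (cases b) auto
qed simp

text \<open>The cells used so far in a pass, in order, with items filed under pool 0. The list is at
  once the log and, through its counts, the content of the counters.\<close>

definition cells :: "nat \<Rightarrow> (nat \<times> nat) list \<Rightarrow> nat list \<Rightarrow> nat list" where
  "cells K B pre = map (enc K) (B @ map (\<lambda>x. (x, 0)) pre)"

lemma count_cells:
  assumes "\<forall>b\<in>set B. 1 \<le> snd b \<and> snd b \<le> K" "j \<le> K"
  shows "count_list (cells K B pre) (enc K (x, j)) = (if j = 0 then count_list pre x else count_list B (x, j))"
proof -
  have "count_list (map (\<lambda>x. (x, 0)) pre) (x, j) = (if j = 0 then count_list pre x else 0)"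
    by (induction pre) auto
  moreover have "count_list B (x, 0) = 0" using assms by (auto simp: count_list_0_iff)
  moreover have "count_list (cells K B pre) (enc K (x, j)) = count_list (B @ map (\<lambda>x. (x, 0)) pre) (x, j)"
    unfolding cells_def using assms by (intro count_enc) auto
  ultimately show ?thesis by simp
qed

text \<open>All quantities stored during a pass over \<open>n\<close> symbols are at most \<open>V\<close>.\<close>

definition bounded :: "nat \<Rightarrow> nat \<Rightarrow> nat \<Rightarrow> nat \<Rightarrow> nat \<Rightarrow> bool" where
  "bounded N K n L V \<longleftrightarrow> 2 * (N * (K + 1) + K) \<le> V \<and> 2 * n \<le> V \<and> L \<le> V \<and> K + 1 \<le> V \<and> N \<le> V"

lemma bounded_enc: "bounded N K n L V \<Longrightarrow> x \<le> N \<Longrightarrow> j \<le> K \<Longrightarrow> 2 * enc K (x, j) \<le> V"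
proof -
  assume b: "bounded N K n L V" and x: "x \<le> N" and j: "j \<le> K"
  have "x * (K + 1) \<le> N * (K + 1)" using x by (rule mult_right_mono) simp
  with b j show "2 * enc K (x, j) \<le> V" by (simp add: bounded_def enc_def)
qed

lemma sieve_item_sim:
  assumes s: "reg s rOne = 1" "reg s rZero = 0" "reg s rLg = lg" "reg s rK = K" "K = 2 ^ lg" "reg s rK1 = K + 1" "reg s rL = L"
    and rem: "0 < reg s rRem" "reg s rRem \<le> L" "reg s rRem + length (cells K B pre) = n"
    and tal: "tallied n (cells K B pre) s" and B: "\<forall>b\<in>set B. 1 \<le> snd b \<and> snd b \<le> K"
    and V: "bounded N K n L V" "reg s rX \<le> N"
  shows "sim (\<lambda>z t. tallied n (cells K B (pre @ [reg s rX])) t \<and> keep s t \<and> reg t rX = reg s rX \<and> reg t rRem = reg s rRem \<and>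
      inp t = inp s \<and> outp t = outp s @ (if z then [reg s rX] else []) \<and> cost t \<le> cost s + 60 * bits V * bits V)
    (coin K (count (mset B) (reg s rX, Suc (count_list pre (reg s rX))))) (exec sieve s)"
    (is "sim ?R _ _")
proof -
  let ?b = "bits V" and ?x = "reg s rX"
  let ?cs = "cells K B pre"
  define c where "c = enc K (?x, 0)"
  define v where "v = count_list pre ?x"
  note sq = bits_sq[of V] bits_pos[of V]
  define s1' where "s1' = charge (bits 0) (set_reg rIdx 0 (charge (bits 0)
    (charge (bits (reg s rRem) + bits L) (set_reg rTmp 0 s))))"
  have exec: "exec sieve s = bind_spmf (exec tally s1') (exec judge)"
    using s rem by (simp add: sieve_def s1'_def Let_def)
  have b: "bits (reg s rRem) \<le> ?b" "bits L \<le> ?b" "bits 0 \<le> ?b"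
    using V rem by (auto intro!: bits_mono simp: bounded_def)
  have c1: "cost s1' \<le> cost s + 4 * ?b" using b by (simp add: s1'_def)
  have V': "2 * c \<le> V" "2 * n \<le> V" "K + 1 \<le> V" "?x \<le> V" "2 * (c + K) \<le> V"
    using V bounded_enc[OF V(1,2), of 0] bounded_enc[OF V(1,2), of K] by (auto simp: bounded_def c_def enc_def)
  have p: "reg s1' rOne = 1" "reg s1' rRem + length ?cs = n" "0 < reg s1' rRem" "tallied n ?cs s1'"
    "c = reg s1' rX * reg s1' rK1 + reg s1' rIdx"
    using s rem tal by (simp_all add: s1'_def tallied_def c_def enc_def)
  have q: "reg s1' rK1 \<le> V" "reg s1' rIdx \<le> V" "reg s1' rX \<le> V"
    using s V' by (simp_all add: s1'_def)
  obtain t where t: "exec tally s1' = return_spmf t" "tallied n (?cs @ [c]) t"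
    "reg t rAddr = 2 * c" "reg t rCnt = count_list ?cs c"
    "\<forall>r. r \<notin> {rAddr, rCnt, rTmp} \<longrightarrow> reg t r = reg s1' r" "inp t = inp s1'" "outp t = outp s1'"
    "cost t \<le> cost s1' + 18 * bits V"
    using tally_exec[OF p V'(1,2) q] by blast
  have cv: "count_list ?cs c = v" using count_cells[OF B, of 0 pre ?x] by (simp add: c_def v_def)
  \<comment> \<open>\<open>judge\<close> runs after the item has been tallied, but the tally touches
    only pool 0, so the ball count that is read is not affected.\<close>
  have mem: "memory t (2 * (c + Suc v)) = count_list B (?x, Suc v)" if "v < K"
  proof -
    have e: "c + Suc v = enc K (?x, Suc v)" "c \<noteq> enc K (?x, Suc v)" by (simp_all add: c_def enc_def)
    have "memory t (2 * (c + Suc v)) = count_list (?cs @ [c]) (c + Suc v)"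
      using t(2) unfolding tallied_def by blast
    also have "\<dots> = count_list B (?x, Suc v)"
      using count_cells[OF B, of "Suc v" pre ?x] that e by simp
    finally show ?thesis .
  qed
  have len: "length B \<le> n" "v \<le> n"
    using rem count_le_length[of pre ?x] by (auto simp: cells_def v_def)
  have kV: "count_list B (?x, Suc v) \<le> V" "v \<le> V"
    using count_le_length[of B "(?x, Suc v)"] len V' by linarith+
  \<comment> \<open>No ball lies in a pool beyond \<open>K\<close>, so for \<open>v \<ge> K\<close>
    the count is 0 by itself and the case split of the code agrees with
    \<open>screen\<close>.\<close>
  have "(if v < K then count_list B (?x, Suc v) else 0) = count_list B (?x, Suc v)"
    using B by (auto simp: count_list_0_iff)
  then have law: "coin (2 ^ lg) (if v < 2 ^ lg then count_list B (?x, Suc v) else 0) =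
      coin K (count (mset B) (?x, Suc (count_list pre ?x)))"
    by (simp add: s(5) count_mset v_def)
  have "sim (\<lambda>z u. keep t u \<and> reg u rX = reg t rX \<and> reg u rRem = reg t rRem \<and> memory u = memory t \<and>
      inp u = inp t \<and> outp u = outp t @ (if z then [reg t rX] else []) \<and> cost u \<le> cost t + 30 * bits V * bits V)
    (coin (2 ^ lg) (if v < 2 ^ lg then count_list B (?x, Suc v) else 0)) (exec judge t)"
    by (rule judge_sim) (use s t cv mem V' kV in \<open>auto simp: s1'_def\<close>)
  then show ?thesis
    unfolding exec t(1) law[symmetric] return_bind_spmf
  proof (rule sim_mono)
    fix z u
    assume u: "keep t u \<and> reg u rX = reg t rX \<and> reg u rRem = reg t rRem \<and> memory u = memory t \<and>
      inp u = inp t \<and> outp u = outp t @ (if z then [reg t rX] else []) \<and> cost u \<le> cost t + 30 * bits V * bits V"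
    have "keep s t" using t(5) by (simp add: keep_def s1'_def)
    moreover have "tallied n (cells K B (pre @ [?x])) u"
      using t(2) u by (simp add: tallied_def cells_def c_def)
    moreover have "cost u \<le> cost s + 60 * bits V * bits V"
      using u c1 t(8) sq by linarith
    ultimately show "?R z u" using u t by (auto simp: s1'_def intro: keep_trans)
  qed
qed

lemma uniform_shift: "pmf_of_set {1..K} = map_pmf Suc (pmf_of_set {..<K})" if "K > 0"
proof -
  have "bij_betw Suc {..<K} {1..K}"
    by (rule bij_betw_byWitness[where f' = "\<lambda>n. n - 1"]) auto
  from map_pmf_of_set_bij_betw[OF this] that show ?thesis by (auto simp: lessThan_empty_iff)
qed

lemma sieve_ball_sim:
  assumes s: "reg s rOne = 1" "reg s rZero = 0" "reg s rLg = lg" "K = 2 ^ lg" "reg s rK1 = K + 1" "reg s rL = L"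
    and rem: "L < reg s rRem" "reg s rRem + length (cells K B []) = n"
    and tal: "tallied n (cells K B []) s"
    and V: "bounded N K n L V" "reg s rX \<le> N"
  shows "sim (\<lambda>g t. 1 \<le> g \<and> g \<le> K \<and> tallied n (cells K (B @ [(reg s rX, g)]) []) t \<and> keep s t \<and> reg t rX = reg s rX \<and>
      reg t rRem = reg s rRem \<and> inp t = inp s \<and> outp t = outp s \<and> cost t \<le> cost s + 60 * bits V * bits V)
    (pmf_of_set {1..K}) (exec sieve s)"
    (is "sim ?R _ _")
proof -
  let ?b = "bits V" and ?x = "reg s rX"
  note sq = bits_sq[of V] bits_pos[of V]
  define s1 where "s1 = charge (bits (reg s rRem - L)) (charge (bits (reg s rRem) + bits L) (set_reg rTmp (reg s rRem - L) s))"
  have exec: "exec sieve s = bind_spmf (exec draw s1) (exec (prog [Arith Add rIdx rIdx rOne, tally]))"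
    using s rem by (simp add: sieve_def s1_def Let_def)
  have b: "bits (reg s rRem) \<le> ?b" "bits L \<le> ?b" "bits (reg s rRem - L) \<le> ?b" "bits 1 \<le> ?b"
    using V rem by (auto intro!: bits_mono simp: bounded_def)
  have c1: "cost s1 \<le> cost s + 3 * ?b" using b by (simp add: s1_def)
  have kV: "2 ^ lg \<le> V" using V s by (simp add: bounded_def)
  have "sim ?R (bind_pmf (pmf_of_set {..<2 ^ lg}) (\<lambda>u. return_pmf (Suc u)))
      (bind_spmf (exec draw s1) (exec (prog [Arith Add rIdx rIdx rOne, tally])))"
  proof (rule sim_bind[where R = "\<lambda>u t. drawn s1 (12 * ?b * ?b) u t \<and> u < 2 ^ lg"])
    show "sim (\<lambda>u t. drawn s1 (12 * ?b * ?b) u t \<and> u < 2 ^ lg) (pmf_of_set {..<2 ^ lg}) (exec draw s1)"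
      by (rule draw_sim_less) (use s(1-3) kV in \<open>simp_all add: s1_def\<close>)
    fix u t assume ut: "drawn s1 (12 * ?b * ?b) u t \<and> u < 2 ^ lg"
    define t1 where "t1 = charge (bits u + bits 1) (set_reg rIdx (Suc u) t)"
    have bu: "bits u \<le> ?b" by (rule bits_mono) (use ut kV in linarith)
    have t: "reg t rIdx = u" "keep s t" "reg t rX = ?x" "reg t rRem = reg s rRem" "memory t = memory s"
      "inp t = inp s" "outp t = outp s" "cost t \<le> cost s + 3 * ?b + 12 * ?b * ?b"
      using ut c1 by (auto simp: drawn_def keep_def s1_def)
    have e: "exec (prog [Arith Add rIdx rIdx rOne, tally]) t = exec tally t1"
      using keepD[OF t(2)] s t by (simp add: t1_def)
    define c where "c = enc K (?x, Suc u)"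
    have V': "2 * c \<le> V" "2 * n \<le> V" "K + 1 \<le> V" "?x \<le> V" "Suc u \<le> V"
      using V bounded_enc[OF V, of "Suc u"] ut s(4) by (auto simp: bounded_def c_def)
    have p: "reg t1 rOne = 1" "reg t1 rRem + length (cells K B []) = n" "0 < reg t1 rRem" "tallied n (cells K B []) t1"
      "c = reg t1 rX * reg t1 rK1 + reg t1 rIdx"
      using s rem tal t keepD[OF t(2)] by (simp_all add: t1_def tallied_def c_def enc_def)
    have q: "reg t1 rK1 \<le> V" "reg t1 rIdx \<le> V" "reg t1 rX \<le> V"
      using s t keepD[OF t(2)] V' by (simp_all add: t1_def)
    obtain t' where t': "exec tally t1 = return_spmf t'" "tallied n (cells K B [] @ [c]) t'"
      "reg t' rAddr = 2 * c" "reg t' rCnt = count_list (cells K B []) c"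
      "\<forall>r. r \<notin> {rAddr, rCnt, rTmp} \<longrightarrow> reg t' r = reg t1 r" "inp t' = inp t1" "outp t' = outp t1"
      "cost t' \<le> cost t1 + 18 * bits V"
      using tally_exec[OF p V'(1,2) q] by blast
    have "keep s t'" using t'(5) t(2) by (simp add: keep_def t1_def)
    moreover have "cost t' \<le> cost s + 60 * bits V * bits V"
    proof -
      have "cost t1 \<le> cost t + 2 * ?b" using bu b(4) unfolding t1_def by simp
      then show ?thesis using t'(8) t(8) sq by linarith
    qed
    moreover have "cells K B [] @ [c] = cells K (B @ [(?x, Suc u)]) []" by (simp add: cells_def c_def)
    moreover have "reg t' rX = ?x" "reg t' rRem = reg s rRem" "inp t' = inp s" "outp t' = outp s"
      using t'(5-7) t(3,4,6,7) by (simp_all add: t1_def)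
    ultimately have "?R (Suc u) t'"
      using t'(2) ut unfolding s(4) by simp
    then show "sim ?R (return_pmf (Suc u)) (exec (prog [Arith Add rIdx rIdx rOne, tally]) t)"
      unfolding e t'(1) by (rule sim_return)
  qed
  moreover have "pmf_of_set {1..K} = map_pmf Suc (pmf_of_set {..<2 ^ lg})"
    using uniform_shift[of K] s(4) by simp
  ultimately show ?thesis by (simp add: exec map_pmf_def)
qed

section \<open>Passes over the input\<close>

definition dec :: "state \<Rightarrow> state" where
  "dec t = charge (bits (reg t rRem) + bits (reg t rOne)) (set_reg rRem (reg t rRem - reg t rOne) t)"

lemma scan_done: "reg s rRem = 0 \<Longrightarrow> exec (scan act) s = return_spmf (charge (bits 0) s)"
  unfolding scan_def by (subst exec_While) (simp add: Let_def)

lemma scan_eof: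
  assumes "0 < reg s rRem" "inp s = []" "reg s rRem \<le> V"
  shows "\<exists>t. exec (scan act) s = return_spmf t \<and> keep s t \<and> reg t rX = 0 \<and> reg t rRem = 0 \<and>
    memory t = memory s \<and> outp t = outp s \<and> inp t = [] \<and> cost t \<le> cost s + 5 * bits V"
proof -
  define s1 where "s1 = charge (bits 0) (set_reg rX 0 (charge (bits (reg s rRem)) s\<lparr>inp := []\<rparr>))"
  define s2 where "s2 = charge (bits 0) (set_reg rRem 0 (charge (bits 0) s1))"
  have "exec (scan act) s = exec (scan act) s2"
    unfolding scan_def using assms
    by (subst exec_While) (simp add: Let_def s1_def s2_def charge_def set_reg_def)
  also have "\<dots> = return_spmf (charge (bits 0) s2)"
    by (rule scan_done) (simp add: s2_def)
  finally have "exec (scan act) s = return_spmf (charge (bits 0) s2)" .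
  moreover have "bits 0 \<le> bits V" "bits (reg s rRem) \<le> bits V" using assms by (auto intro: bits_mono)
  then have "cost (charge (bits 0) s2) \<le> cost s + 5 * bits V" by (simp add: s2_def s1_def)
  ultimately show ?thesis by (intro exI[of _ "charge (bits 0) s2"]) (simp add: s2_def s1_def keep_def)
qed

lemma scan_step:
  assumes "0 < reg s rRem" "inp s = x # zs" "x \<noteq> 0" "reg s rRem \<le> V" "x \<le> V"
  shows "\<exists>s2. exec (scan act) s = bind_spmf (exec act s2) (\<lambda>t. exec (scan act) (dec t)) \<and> keep s s2 \<and>
    reg s2 rX = x \<and> reg s2 rRem = reg s rRem \<and> reg s2 rHit = reg s rHit \<and>
    memory s2 = memory s \<and> outp s2 = outp s \<and> inp s2 = zs \<and> cost s2 \<le> cost s + 3 * bits V"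
proof -
  define s1 where "s1 = charge (bits x) (set_reg rX x (charge (bits (reg s rRem)) s\<lparr>inp := zs\<rparr>))"
  define s2 where "s2 = charge (bits x) s1"
  have "exec (scan act) s = bind_spmf (exec act s2) (\<lambda>t. exec (scan act) (dec t))"
    unfolding scan_def using assms
    by (subst exec_While) (simp add: Let_def s1_def s2_def charge_def set_reg_def dec_def)
  moreover have "bits x \<le> bits V" "bits (reg s rRem) \<le> bits V" using assms by (auto intro: bits_mono)
  then have "cost s2 \<le> cost s + 3 * bits V" by (simp add: s2_def s1_def)
  ultimately show ?thesis by (intro exI[of _ s2]) (simp add: s2_def s1_def keep_def)
qed

lemma dec:
  assumes "reg t rOne = 1" "0 < reg t rRem" "reg t rRem \<le> V"
  shows "keep t (dec t)" "reg (dec t) rRem = reg t rRem - 1" "reg (dec t) rX = reg t rX" "reg (dec t) rHit = reg t rHit"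
    "memory (dec t) = memory t" "inp (dec t) = inp t" "outp (dec t) = outp t" "cost (dec t) \<le> cost t + 2 * bits V"
proof -
  have "bits (reg t rRem) \<le> bits V" "bits 1 \<le> bits V" using assms by (auto intro!: bits_mono simp del: One_nat_def)
  then show "cost (dec t) \<le> cost t + 2 * bits V" using assms(1) by (simp add: dec_def)
qed (use assms in \<open>simp_all add: dec_def keep_def\<close>)

lemma tallied_cong: "memory t = memory s \<Longrightarrow> tallied n cs t = tallied n cs s"
  by (simp add: tallied_def)

text \<open>If the input has run out the program is about to stop, and nothing is asserted about the
  memory. Otherwise a log \<open>cs\<close> of the pass is available, from which the counters can be
  cleared.\<close>

definition scanned :: "nat \<Rightarrow> nat \<Rightarrow> nat \<Rightarrow> state \<Rightarrow> nat list \<Rightarrow> state \<Rightarrow> bool" where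
  "scanned N n V s ys t \<longleftrightarrow> keep s t \<and> outp t = outp s @ ys \<and>
     cost t \<le> cost s + 70 * (bits V * bits V) * (min (length (inp s)) (reg s rRem) + 1) \<and>
     (if length (inp s) < reg s rRem then reg t rX = 0 \<and> inp t = []
      else reg t rX \<in> {1..N} \<and> inp t = drop (reg s rRem) (inp s) \<and>
        (\<exists>cs. length cs = n \<and> tallied n cs t \<and> (\<forall>c\<in>set cs. 2 * c \<le> V)))"

text \<open>One symbol costs at most 65 units of \<open>bits V * bits V\<close>: 3 for reading, up
  to 60 for the action, 2 for the decrement. The rate of 70, with one extra share, leaves room for
  the end of the loop.\<close>

lemma scanned_step:
  assumes t: "scanned N n V s' ys t" and ks: "keep s s'" "outp s' = outp s @ ys'"
    and c: "cost s' \<le> cost s + 65 * (bits V * bits V)" and i: "inp s = x # inp s'" "reg s rRem = Suc (reg s' rRem)"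
  shows "scanned N n V s (ys' @ ys) t"
proof -
  let ?bb = "bits V * bits V"
  have "cost t \<le> cost s + 65 * ?bb + 70 * ?bb * (min (length (inp s')) (reg s' rRem) + 1)"
    using t c by (simp add: scanned_def)
  also have "\<dots> \<le> cost s + 70 * ?bb * (min (length (inp s)) (reg s rRem) + 1)"
    unfolding i by simp
  finally show ?thesis using t ks i by (auto simp: scanned_def intro: keep_trans)
qed

definition main_ctx :: "nat \<Rightarrow> nat \<Rightarrow> nat \<Rightarrow> state \<Rightarrow> bool" where
  "main_ctx lg K L s \<longleftrightarrow> reg s rOne = 1 \<and> reg s rZero = 0 \<and> reg s rLg = lg \<and> reg s rK = K \<and> K = 2 ^ lg \<and>
     reg s rK1 = K + 1 \<and> reg s rL = L"

lemma main_ctx_keep: "main_ctx lg K L s \<Longrightarrow> keep s t \<Longrightarrow> main_ctx lg K L t"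
  by (simp add: main_ctx_def keep_def)

lemma cells_bound:
  assumes "bounded N K n L V" "\<forall>b\<in>set B. fst b \<le> N \<and> 1 \<le> snd b \<and> snd b \<le> K" "set pre \<subseteq> {..N}"
  shows "\<forall>c\<in>set (cells K B pre). 2 * c \<le> V"
  using assms bounded_enc[OF assms(1)] by (auto simp: cells_def)

lemma scan_items_sim:
  assumes "main_ctx lg K L s" "reg s rRem \<le> L" "reg s rRem + length (cells K B pre) = n"
    "tallied n (cells K B pre) s" "\<forall>b\<in>set B. fst b \<le> N \<and> 1 \<le> snd b \<and> snd b \<le> K" "set pre \<subseteq> {..N}"
    "bounded N K n L V" "set (inp s) \<subseteq> {1..N}" "reg s rX \<in> {1..N}"
  shows "sim (\<lambda>os t. scanned N n V s (somes os) t) (screen K (mset B) pre (take (reg s rRem) (inp s))) (exec (scan sieve) s)"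
  using assms
proof (induction "inp s" arbitrary: s pre)
  case Nil
  note sq = bits_sq[of V] bits_pos[of V]
  show ?case
  proof (cases "reg s rRem = 0")
    case True
    have "scanned N n V s [] (charge (bits 0) s)"
      using Nil.prems True cells_bound[OF Nil.prems(7,5,6)] sq
      by (auto simp: scanned_def keep_def tallied_cong[of "charge _ s" s] bits_def intro!: exI[of _ "cells K B pre"])
    then show ?thesis using True by (simp add: scan_done sim_return)
  next
    case False
    then have "reg s rRem \<le> V" using Nil.prems by (simp add: bounded_def)
    with False scan_eof[of s V sieve] Nil.hyps obtain t where
      t: "exec (scan sieve) s = return_spmf t" "keep s t" "reg t rX = 0" "outp t = outp s" "inp t = []" "cost t \<le> cost s + 5 * bits V"
      by auto
    have "cost t \<le> cost s + 70 * (bits V * bits V)" using t(6) sq by linarith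
    then have "scanned N n V s [] t" using t False Nil.hyps by (simp add: scanned_def)
    then show ?thesis using t(1) Nil.hyps by (simp add: sim_return)
  qed
next
  case (Cons x zs)
  note sq = bits_sq[of V] bits_pos[of V]
  show ?case
  proof (cases "reg s rRem = 0")
    case True
    have "scanned N n V s [] (charge (bits 0) s)"
      using Cons.prems True cells_bound[OF Cons.prems(7,5,6)] sq
      by (auto simp: scanned_def keep_def tallied_cong[of "charge _ s" s] bits_def intro!: exI[of _ "cells K B pre"])
    then show ?thesis using True by (simp add: scan_done sim_return)
  next
    case False
    have V: "reg s rRem \<le> V" "x \<le> V" "x \<le> N" "x \<noteq> 0" using Cons.prems Cons.hyps(2)[symmetric] by (auto simp: bounded_def)
    obtain s2 where s2: "exec (scan sieve) s = bind_spmf (exec sieve s2) (\<lambda>t. exec (scan sieve) (dec t))" "keep s s2"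
      "reg s2 rX = x" "reg s2 rRem = reg s rRem" "memory s2 = memory s" "outp s2 = outp s" "inp s2 = zs" "cost s2 \<le> cost s + 3 * bits V"
      using scan_step[of s x zs V sieve] False Cons.hyps(2)[symmetric] V by auto
    have ctx2: "main_ctx lg K L s2" by (rule main_ctx_keep[OF Cons.prems(1) s2(2)])
    have B: "\<forall>b\<in>set B. 1 \<le> snd b \<and> snd b \<le> K" using Cons.prems(5) by auto
    have law: "screen K (mset B) pre (take (reg s rRem) (inp s)) =
        bind_pmf (coin K (count (mset B) (x, Suc (count_list pre x)))) (\<lambda>z. map_pmf ((#) (if z then Some x else None))
          (screen K (mset B) (pre @ [x]) (take (reg s rRem - 1) zs)))"
      using False by (cases "reg s rRem") (simp_all flip: Cons.hyps(2))
    have step: "sim (\<lambda>z t. tallied n (cells K B (pre @ [x])) t \<and> keep s2 t \<and> reg t rX = x \<and> reg t rRem = reg s rRem \<and>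
        inp t = zs \<and> outp t = outp s @ (if z then [x] else []) \<and> cost t \<le> cost s2 + 60 * bits V * bits V)
      (coin K (count (mset B) (x, Suc (count_list pre x)))) (exec sieve s2)"
    proof -
      have pr: "reg s2 rOne = 1" "reg s2 rZero = 0" "reg s2 rLg = lg" "reg s2 rK = K" "K = 2 ^ lg" "reg s2 rK1 = K + 1" "reg s2 rL = L"
        using ctx2 by (simp_all add: main_ctx_def)
      have "tallied n (cells K B pre) s2" using Cons.prems(4) tallied_cong[OF s2(5)] by simp
      then show ?thesis
        using sieve_item_sim[OF pr, of B pre n N V] False Cons.prems(2,3,7) B V(3) unfolding s2(3,4,6,7) by simp
    qed
    show ?thesis unfolding law s2(1)
    proof (rule sim_bind[OF step])
      fix z t
      assume t: "tallied n (cells K B (pre @ [x])) t \<and> keep s2 t \<and> reg t rX = x \<and> reg t rRem = reg s rRem \<and>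
        inp t = zs \<and> outp t = outp s @ (if z then [x] else []) \<and> cost t \<le> cost s2 + 60 * bits V * bits V"
      have ctx: "main_ctx lg K L t" using main_ctx_keep[OF ctx2] t by blast
      then have "reg t rOne = 1" "0 < reg t rRem" "reg t rRem \<le> V" using t False V by (simp_all add: main_ctx_def)
      note d = dec[OF this]
      have ks: "keep s (dec t)" using keep_trans[OF keep_trans[OF s2(2)] d(1)] t by blast
      have "sim (\<lambda>os u. scanned N n V (dec t) (somes os) u)
          (screen K (mset B) (pre @ [x]) (take (reg (dec t) rRem) (inp (dec t)))) (exec (scan sieve) (dec t))"
      proof (rule Cons.hyps(1))
        show "zs = inp (dec t)" using d t by simp
        show "main_ctx lg K L (dec t)" by (rule main_ctx_keep[OF ctx d(1)])
        show "reg (dec t) rRem \<le> L" using d t Cons.prems(2) by simp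
        show "reg (dec t) rRem + length (cells K B (pre @ [x])) = n" using d t Cons.prems(3) False by (simp add: cells_def)
        show "tallied n (cells K B (pre @ [x])) (dec t)" using t tallied_cong[OF d(5)] by simp
        show "set (pre @ [x]) \<subseteq> {..N}" using Cons.prems(6) V by simp
        show "set (inp (dec t)) \<subseteq> {1..N}" using Cons.prems(8) d t by (simp flip: Cons.hyps(2))
        show "reg (dec t) rX \<in> {1..N}" using d t V by simp
      qed (fact Cons.prems)+
      then have rest: "sim (\<lambda>os u. scanned N n V (dec t) (somes os) u)
          (screen K (mset B) (pre @ [x]) (take (reg s rRem - 1) zs)) (exec (scan sieve) (dec t))"
        using d t by simp
      have "cost (dec t) \<le> cost s + 65 * (bits V * bits V)"
      proof -
        have "cost t \<le> cost s2 + 60 * (bits V * bits V)" using t by (simp add: mult.assoc)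
        then show ?thesis using d(8) s2(8) sq by linarith
      qed
      then have "scanned N n V s ((if z then [x] else []) @ ys) u" if "scanned N n V (dec t) ys u" for ys u
        using that ks d t False by (intro scanned_step[of N n V "dec t" ys u]) (auto simp flip: Cons.hyps(2))
      then have "scanned N n V s (somes ((if z then Some x else None) # os)) u" if "scanned N n V (dec t) (somes os) u" for os u
        using that by (cases z) fastforce+
      then show "sim (\<lambda>os u. scanned N n V s (somes os) u) (map_pmf ((#) (if z then Some x else None))
          (screen K (mset B) (pre @ [x]) (take (reg s rRem - 1) zs))) (exec (scan sieve) (dec t))"
        unfolding sim_map_left by (rule sim_mono[OF rest])
    qed
  qed
qed

text \<open>Induction over the balls still to come; when none is left, \<open>rRem = L\<close> and
  the item phase takes over.\<close>

lemma scan_balls_sim: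
  assumes "main_ctx lg K L s" "reg s rRem = L + m" "reg s rRem + length B = n"
    "tallied n (cells K B []) s" "\<forall>b\<in>set B. fst b \<le> N \<and> 1 \<le> snd b \<and> snd b \<le> K"
    "bounded N K n L V" "set (inp s) \<subseteq> {1..N}" "reg s rX \<in> {1..N}"
  shows "sim (scanned N n V s) (block K m B (take (reg s rRem) (inp s))) (exec (scan sieve) s)"
  using assms
proof (induction m arbitrary: s B)
  case 0
  have "sim (\<lambda>os t. scanned N n V s (somes os) t) (screen K (mset B) [] (take (reg s rRem) (inp s))) (exec (scan sieve) s)"
    by (rule scan_items_sim[of lg K L]) (use 0 in \<open>auto simp: cells_def\<close>)
  then show ?case by (simp add: sim_map_left)
next
  case (Suc m)
  note sq = bits_sq[of V] bits_pos[of V]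
  have rV: "0 < reg s rRem" "reg s rRem \<le> V" using Suc.prems by (auto simp: bounded_def)
  show ?case
  proof (cases "inp s")
    case Nil
    obtain t where
      t: "exec (scan sieve) s = return_spmf t" "keep s t" "reg t rX = 0" "outp t = outp s" "inp t = []" "cost t \<le> cost s + 5 * bits V"
      using scan_eof[OF rV(1) Nil rV(2), of sieve] by auto
    have "cost t \<le> cost s + 70 * (bits V * bits V)" using t(6) sq by linarith
    then have "scanned N n V s [] t" using t Nil rV by (simp add: scanned_def)
    then show ?thesis using t(1) Nil by (simp add: sim_return)
  next
    case (Cons x zs)
    have V: "x \<le> V" "x \<le> N" "x \<noteq> 0" using Suc.prems Cons by (auto simp: bounded_def)
    obtain s2 where s2: "exec (scan sieve) s = bind_spmf (exec sieve s2) (\<lambda>t. exec (scan sieve) (dec t))" "keep s s2"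
      "reg s2 rX = x" "reg s2 rRem = reg s rRem" "memory s2 = memory s" "outp s2 = outp s" "inp s2 = zs" "cost s2 \<le> cost s + 3 * bits V"
      using scan_step[OF rV(1) Cons V(3) rV(2) V(1), of sieve] by auto
    have ctx2: "main_ctx lg K L s2" by (rule main_ctx_keep[OF Suc.prems(1) s2(2)])
    have rS: "reg s rRem = Suc (L + m)" using Suc.prems(2) by simp
    have law: "block K (Suc m) B (take (reg s rRem) (inp s)) =
        bind_pmf (pmf_of_set {1..K}) (\<lambda>g. block K m (B @ [(x, g)]) (take (L + m) zs))"
      by (simp add: rS Cons)
    have step: "sim (\<lambda>g t. 1 \<le> g \<and> g \<le> K \<and> tallied n (cells K (B @ [(x, g)]) []) t \<and> keep s2 t \<and> reg t rX = x \<and>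
      reg t rRem = reg s rRem \<and> inp t = zs \<and> outp t = outp s \<and> cost t \<le> cost s2 + 60 * bits V * bits V)
      (pmf_of_set {1..K}) (exec sieve s2)"
    proof -
      have pr: "reg s2 rOne = 1" "reg s2 rZero = 0" "reg s2 rLg = lg" "K = 2 ^ lg" "reg s2 rK1 = K + 1" "reg s2 rL = L"
        using ctx2 by (simp_all add: main_ctx_def)
      have "tallied n (cells K B []) s2" using Suc.prems(4) tallied_cong[OF s2(5)] by simp
      moreover have "length (cells K B []) = length B" by (simp add: cells_def)
      ultimately show ?thesis
        using sieve_ball_sim[OF pr, of B n N V] Suc.prems(2,3,6) V(2) unfolding s2(3,4,6,7) by simp
    qed
    show ?thesis unfolding law s2(1)
    proof (rule sim_bind[OF step])
      fix g t
      assume t: "1 \<le> g \<and> g \<le> K \<and> tallied n (cells K (B @ [(x, g)]) []) t \<and> keep s2 t \<and> reg t rX = x \<and>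
        reg t rRem = reg s rRem \<and> inp t = zs \<and> outp t = outp s \<and> cost t \<le> cost s2 + 60 * bits V * bits V"
      have ctx: "main_ctx lg K L t" using main_ctx_keep[OF ctx2] t by blast
      then have "reg t rOne = 1" "0 < reg t rRem" "reg t rRem \<le> V" using t rV by (simp_all add: main_ctx_def)
      note d = dec[OF this]
      have ks: "keep s (dec t)" using keep_trans[OF keep_trans[OF s2(2)] d(1)] t by blast
      have "sim (scanned N n V (dec t)) (block K m (B @ [(x, g)]) (take (reg (dec t) rRem) (inp (dec t)))) (exec (scan sieve) (dec t))"
      proof (rule Suc.IH)
        show "main_ctx lg K L (dec t)" by (rule main_ctx_keep[OF ctx d(1)])
        show "reg (dec t) rRem = L + m" using d t rS by simp
        show "reg (dec t) rRem + length (B @ [(x, g)]) = n" using d t Suc.prems(3) rS by simp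
        show "tallied n (cells K (B @ [(x, g)]) []) (dec t)" using t tallied_cong[OF d(5)] by simp
        show "\<forall>b\<in>set (B @ [(x, g)]). fst b \<le> N \<and> 1 \<le> snd b \<and> snd b \<le> K" using Suc.prems(5) V t by auto
        show "set (inp (dec t)) \<subseteq> {1..N}" using Suc.prems(7) d t Cons by simp
        show "reg (dec t) rX \<in> {1..N}" using d t V by simp
      qed (fact Suc.prems)
      then have rest: "sim (scanned N n V (dec t)) (block K m (B @ [(x, g)]) (take (L + m) zs)) (exec (scan sieve) (dec t))"
        using d t rS by simp
      have "cost (dec t) \<le> cost s + 65 * (bits V * bits V)"
      proof -
        have "cost t \<le> cost s2 + 60 * (bits V * bits V)" using t by (simp add: mult.assoc)
        then show ?thesis using d(8) s2(8) sq by linarith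
      qed
      then have "scanned N n V s ([] @ ys) u" if "scanned N n V (dec t) ys u" for ys u
        using that ks d t rS by (intro scanned_step[of N n V "dec t" ys u]) (auto simp: Cons)
      then show "sim (scanned N n V s) (block K m (B @ [(x, g)]) (take (L + m) zs)) (exec (scan sieve) (dec t))"
        by (intro sim_mono[OF rest]) simp
    qed
  qed
qed

text \<open>Invariant: every nonzero counter belongs to a cell of the remaining log. Clearing the
  head \<open>d\<close> preserves it, whether or not \<open>d\<close> occurs again, and leaves the
  log at the odd addresses intact.\<close>

lemma wipe_exec:
  assumes "reg s rRem = length ds" "reg s rOne = 1" "reg s rZero = 0"
    "\<forall>c. memory s (2 * c) \<noteq> 0 \<longrightarrow> c \<in> set ds" "\<forall>i<length ds. memory s (2 * (length ds - i) - 1) = 2 * ds ! i"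
    "2 * length ds \<le> V" "\<forall>c\<in>set ds. 2 * c \<le> V" "1 \<le> V"
  shows "\<exists>t. exec wipe s = return_spmf t \<and> keep s t \<and> reg t rX = reg s rX \<and> reg t rHit = reg s rHit \<and>
    (\<forall>c. memory t (2 * c) = 0) \<and> inp t = inp s \<and> outp t = outp s \<and> cost t \<le> cost s + 11 * bits V * length ds + 1"
  using assms
proof (induction ds arbitrary: s)
  case Nil
  then have "exec wipe s = return_spmf (charge (bits 0) s)"
    unfolding wipe_def by (subst exec_While) (simp add: Let_def)
  then show ?case using Nil by (intro exI[of _ "charge (bits 0) s"]) (auto simp: keep_def bits_def)
next
  case (Cons d ds)
  let ?b = "bits V"
  define n where "n = Suc (length ds)"
  let ?body = "prog [Arith Add rTmp rRem rRem, Arith Sub rTmp rTmp rOne, Load rAddr rTmp, Store rAddr rZero, Arith Sub rRem rRem rOne]"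
  define s1 where "s1 = charge (bits (reg s rRem)) s"
  have rem: "reg s rRem = n" using Cons.prems(1) by (simp add: n_def)
  have d: "memory s (2 * n - 1) = 2 * d" using Cons.prems(5) by (force simp: n_def)
  have n1: "n + n - Suc 0 = 2 * n - 1" by simp
  have odd: "2 * k - Suc 0 \<noteq> 2 * c" if "0 < k" for k c using that by presburger
  have b: "bits n \<le> ?b" "bits (2 * n) \<le> ?b" "bits (2 * n - 1) \<le> ?b" "bits (2 * d) \<le> ?b" "bits 1 \<le> ?b" "bits 0 \<le> ?b"
    using Cons.prems by (auto intro!: bits_mono simp: n_def simp del: One_nat_def)
  define t1 where "t1 = charge (bits n + bits n) (set_reg rTmp (2 * n) s1)"
  define t2 where "t2 = charge (bits (2 * n) + bits 1) (set_reg rTmp (2 * n - 1) t1)"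
  define t3 where "t3 = charge (bits (2 * n - 1) + bits (2 * d)) (set_reg rAddr (2 * d) t2)"
  define t4 where "t4 = charge (bits (2 * d) + bits 0) (t3\<lparr>memory := (memory t3)(2 * d := 0)\<rparr>)"
  define t5 where "t5 = charge (bits n + bits 1) (set_reg rRem (n - 1) t4)"
  have e: "exec wipe s = exec wipe t5"
    unfolding wipe_def
    using Cons.prems(2,3) rem d
    by (subst exec_While) (simp add: Let_def s1_def n_def t1_def t2_def t3_def t4_def t5_def mult_2)
  have m5: "memory t5 = (memory s)(2 * d := 0)" by (simp add: t5_def t4_def t3_def t2_def t1_def s1_def)
  have c5: "cost t5 \<le> cost s + 11 * ?b"
  proof -
    have "cost t5 = cost s + bits n + (bits n + bits n) + (bits (2 * n) + bits 1) + (bits (2 * n - 1) + bits (2 * d))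
      + (bits (2 * d) + bits 0) + (bits n + bits 1)"
      by (simp add: t5_def t4_def t3_def t2_def t1_def s1_def rem)
    then show ?thesis using b by linarith
  qed
  have "\<exists>t. exec wipe t5 = return_spmf t \<and> keep t5 t \<and> reg t rX = reg t5 rX \<and> reg t rHit = reg t5 rHit \<and>
    (\<forall>c. memory t (2 * c) = 0) \<and> inp t = inp t5 \<and> outp t = outp t5 \<and> cost t \<le> cost t5 + 11 * bits V * length ds + 1"
  proof (rule Cons.IH)
    show "reg t5 rRem = length ds" by (simp add: t5_def n_def)
    show "reg t5 rOne = 1" "reg t5 rZero = 0" using Cons.prems by (simp_all add: t5_def t4_def t3_def t2_def t1_def s1_def)
    show "\<forall>c. memory t5 (2 * c) \<noteq> 0 \<longrightarrow> c \<in> set ds" using Cons.prems(4) by (auto simp: m5 split: if_splits)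
    show "\<forall>i<length ds. memory t5 (2 * (length ds - i) - 1) = 2 * ds ! i"
    proof (intro allI impI)
      fix i assume i: "i < length ds"
      then have "memory s (2 * (length (d # ds) - Suc i) - 1) = 2 * (d # ds) ! Suc i"
        using Cons.prems(5) by (metis Suc_less_eq length_Cons)
      moreover have "2 * (length ds - i) - 1 \<noteq> 2 * d" using odd[of "length ds - i" d] i by simp
      ultimately show "memory t5 (2 * (length ds - i) - 1) = 2 * ds ! i" by (simp add: m5)
    qed
  qed (use Cons.prems in auto)
  then obtain t where t: "exec wipe t5 = return_spmf t" "keep t5 t" "reg t rX = reg t5 rX" "reg t rHit = reg t5 rHit"
    "\<forall>c. memory t (2 * c) = 0" "inp t = inp t5" "outp t = outp t5" "cost t \<le> cost t5 + 11 * bits V * length ds + 1"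
    by blast
  have k5: "keep s t5" "reg t5 rX = reg s rX" "reg t5 rHit = reg s rHit" "inp t5 = inp s" "outp t5 = outp s"
    by (simp_all add: t5_def t4_def t3_def t2_def t1_def s1_def keep_def)
  have "cost t \<le> cost s + 11 * bits V * length (d # ds) + 1" using t(8) c5 by simp
  then show ?case using t k5 keep_trans[OF k5(1) t(2)] unfolding e by auto
qed

text \<open>Only counters have to vanish between passes: a log entry of an earlier pass is
  overwritten before \<open>wipe\<close> reads it.\<close>

definition clean :: "state \<Rightarrow> bool" where
  "clean s \<longleftrightarrow> (\<forall>c. memory s (2 * c) = 0)"

definition passed :: "nat \<Rightarrow> nat \<Rightarrow> nat \<Rightarrow> state \<Rightarrow> nat list \<Rightarrow> state \<Rightarrow> bool" where
  "passed N n V s ys t \<longleftrightarrow> keep s t \<and> outp t = outp s @ ys \<and>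
     cost t \<le> cost s + 90 * (bits V * bits V) * (min (length (inp s)) n + 1) \<and>
     (if length (inp s) < n then reg t rX = 0 \<and> inp t = []
      else reg t rX \<in> {1..N} \<and> inp t = drop n (inp s) \<and> clean t)"

definition pass_start :: "nat \<Rightarrow> state \<Rightarrow> state" where
  "pass_start n s = charge (bits (reg s rK1) + bits (reg s rL)) (set_reg rRem n s)"

definition pass_end :: com where
  "pass_end = If rX (Seq (Arith Mul rRem rK1 rL) wipe) Skip"

lemma pass_exec:
  "reg s rK1 * reg s rL = n \<Longrightarrow> exec (pass act) s = bind_spmf (exec (scan act) (pass_start n s)) (exec pass_end)"
  by (auto simp: pass_def pass_start_def pass_end_def)

lemma pass_end_exec:
  assumes s: "scanned N n V (pass_start n s) ys t" "reg s rK1 * reg s rL = n" "reg s rOne = 1" "reg s rZero = 0"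
    and V: "2 * n \<le> V" "reg s rK1 \<le> V" "reg s rL \<le> V" "1 \<le> V" "N \<le> V"
  shows "\<exists>u. exec pass_end t = return_spmf u \<and> passed N n V s ys u \<and>
    (n \<le> length (inp s) \<longrightarrow> reg u rHit = reg t rHit)"
proof -
  let ?b = "bits V"
  note sq = bits_sq[of V] bits_pos[of V]
  have b: "bits (reg s rK1) \<le> ?b" "bits (reg s rL) \<le> ?b" using V by (auto intro!: bits_mono)
  have p: "keep s (pass_start n s)" "outp (pass_start n s) = outp s" "inp (pass_start n s) = inp s" "reg (pass_start n s) rRem = n"
    "cost (pass_start n s) \<le> cost s + 2 * ?b"
    using b by (simp_all add: pass_start_def keep_def)
  have kt: "keep s t" using s(1) p(1) by (auto simp: scanned_def intro: keep_trans)
  let ?m = "min (length (inp s)) n"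
  have ct: "cost t \<le> cost s + 2 * ?b + 70 * (?b * ?b) * (?m + 1)" using s(1) p by (simp add: scanned_def)
  show ?thesis
  proof (cases "length (inp s) < n")
    case True
    then have t: "reg t rX = 0" "inp t = []" using s(1) p by (simp_all add: scanned_def)
    have "cost t + 1 \<le> cost s + 90 * (?b * ?b) * (?m + 1)"
    proof -
      have "(?b * ?b) * 1 \<le> (?b * ?b) * (?m + 1)" by (intro mult_left_mono) auto
      then show ?thesis using ct sq by linarith
    qed
    then have "passed N n V s ys (charge (bits 0) t)"
      using True t kt s(1) p by (simp add: passed_def scanned_def keep_def bits_def)
    then show ?thesis using t True by (simp add: pass_end_def Let_def)
  next
    case False
    then obtain cs where t: "reg t rX \<noteq> 0" "reg t rX \<le> N" "inp t = drop n (inp s)" "length cs = n" "tallied n cs t" "\<forall>c\<in>set cs. 2 * c \<le> V"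
      using s(1) p by (auto simp: scanned_def)
    define t2 where "t2 = charge (bits (reg s rK1) + bits (reg s rL)) (set_reg rRem n (charge (bits (reg t rX)) t))"
    have e: "exec pass_end t = exec wipe t2"
      using t(1) s(2) keepD[OF kt] by (simp add: pass_end_def Let_def t2_def)
    have "\<exists>u. exec wipe t2 = return_spmf u \<and> keep t2 u \<and> reg u rX = reg t2 rX \<and> reg u rHit = reg t2 rHit \<and>
      (\<forall>c. memory u (2 * c) = 0) \<and> inp u = inp t2 \<and> outp u = outp t2 \<and> cost u \<le> cost t2 + 11 * bits V * length cs + 1"
    proof (rule wipe_exec)
      show "\<forall>c. memory t2 (2 * c) \<noteq> 0 \<longrightarrow> c \<in> set cs"
        using t(5) by (auto simp: tallied_def t2_def) (metis count_notin neq0_conv)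
      show "\<forall>i<length cs. memory t2 (2 * (length cs - i) - 1) = 2 * cs ! i"
        using t(4,5) by (simp add: tallied_def t2_def)
    qed (use t V s keepD[OF kt] in \<open>simp_all add: t2_def\<close>)
    then obtain u where u: "exec wipe t2 = return_spmf u" "keep t2 u" "reg u rX = reg t2 rX" "reg u rHit = reg t2 rHit"
      "\<forall>c. memory u (2 * c) = 0" "inp u = inp t2" "outp u = outp t2" "cost u \<le> cost t2 + 11 * bits V * length cs + 1"
      by blast
    have "bits (reg t rX) \<le> ?b" using t(2) V by (auto intro: bits_mono)
    then have c2: "cost t2 \<le> cost t + 3 * ?b" using b by (simp add: t2_def)
    have "cost u \<le> cost s + 90 * (?b * ?b) * (?m + 1)"
    proof -
      define P where "P = ?b * ?b * ?m"
      have "?b * ?m \<le> P" unfolding P_def by (intro mult_right_mono sq(1)) simp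
      moreover have "length cs = ?m" using False t(4) by simp
      ultimately have "11 * ?b * length cs \<le> 11 * P" by simp
      moreover have "70 * (?b * ?b) * (?m + 1) = 70 * P + 70 * (?b * ?b)" "90 * (?b * ?b) * (?m + 1) = 90 * P + 90 * (?b * ?b)"
        by (simp_all add: P_def algebra_simps)
      ultimately show ?thesis using ct c2 u(8) sq by linarith
    qed
    moreover have "keep s u" using kt u(2) by (auto simp: keep_def t2_def)
    ultimately have "passed N n V s ys u"
      using False u t s(1) p by (simp add: passed_def t2_def clean_def scanned_def)
    then show ?thesis using u by (simp add: e t2_def)
  qed
qed

lemma pass_sieve_sim:
  assumes ctx: "main_ctx lg K L s" and "clean s" and V: "bounded N K (K * L + L) L V"
    and inp: "set (inp s) \<subseteq> {1..N}" "reg s rX \<in> {1..N}"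
  shows "sim (passed N (K * L + L) V s) (block K (K * L) [] (take (K * L + L) (inp s))) (exec (pass sieve) s)"
proof -
  let ?n = "K * L + L"
  have n: "reg s rK1 * reg s rL = ?n" using ctx by (simp add: main_ctx_def)
  have p: "keep s (pass_start ?n s)" "inp (pass_start ?n s) = inp s" "reg (pass_start ?n s) rRem = ?n"
    "reg (pass_start ?n s) rX = reg s rX" "memory (pass_start ?n s) = memory s"
    by (simp_all add: pass_start_def keep_def)
  have "sim (scanned N ?n V (pass_start ?n s)) (block K (K * L) [] (take (reg (pass_start ?n s) rRem) (inp (pass_start ?n s))))
      (exec (scan sieve) (pass_start ?n s))"
  proof (rule scan_balls_sim)
    show "main_ctx lg K L (pass_start ?n s)" by (rule main_ctx_keep[OF ctx p(1)])
    show "tallied ?n (cells K [] []) (pass_start ?n s)"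
      using \<open>clean s\<close> by (simp add: tallied_def clean_def p cells_def)
  qed (use inp V p in auto)
  then have "sim (passed N ?n V s) (bind_pmf (block K (K * L) [] (take ?n (inp s))) return_pmf)
      (bind_spmf (exec (scan sieve) (pass_start ?n s)) (exec pass_end))"
    unfolding p
  proof (rule sim_bind)
    fix ys t assume t: "scanned N ?n V (pass_start ?n s) ys t"
    have "\<exists>u. exec pass_end t = return_spmf u \<and> passed N ?n V s ys u \<and> (?n \<le> length (inp s) \<longrightarrow> reg u rHit = reg t rHit)"
      by (rule pass_end_exec[OF t n]) (use ctx V in \<open>auto simp: main_ctx_def bounded_def\<close>)
    then show "sim (passed N ?n V s) (return_pmf ys) (exec pass_end t)" by (auto intro: sim_return)
  qed
  then show ?thesis by (simp add: pass_exec[OF n] bind_return_pmf')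
qed

text \<open>A full pass over \<open>n\<close> symbols costs 90 units of
  \<open>bits V * bits V\<close> for each of \<open>n + 1\<close>, and one test. As
  \<open>n \<ge> 1\<close>, this is below 200 units per symbol read, so the total is linear in the
  input whatever the block size.\<close>

lemma collect_sim:
  assumes "main_ctx lg K L s" "clean s" "bounded N K (K * L + L) L V" "0 < L"
    "set (inp s) \<subseteq> {1..N}" "reg s rX \<in> {1..N}"
  shows "sim (\<lambda>ys t. outp t = outp s @ ys \<and> cost t \<le> cost s + 200 * (bits V * bits V) * (length (inp s) + 1))
    (stream K L (inp s)) (exec collect s)"
  using assms
proof (induction "length (inp s)" arbitrary: s rule: less_induct)
  case less
  let ?n = "K * L + L" and ?bb = "bits V * bits V"
  note sq = bits_sq[of V] bits_pos[of V]
  define s1 where "s1 = charge (bits (reg s rX)) s"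
  have K: "0 < K" using less.prems(1) by (simp add: main_ctx_def)
  have loop: "exec collect s = bind_spmf (exec (pass sieve) s1) (exec collect)"
    unfolding collect_def using less.prems(6) by (subst exec_While) (simp add: s1_def Let_def)
  have stop: "exec collect t = return_spmf (charge (bits 0) t)" if "reg t rX = 0" for t
    unfolding collect_def using that by (subst exec_While) (simp add: Let_def)
  have s1: "keep s s1" "inp s1 = inp s" "outp s1 = outp s" "reg s1 rX = reg s rX" "clean s1" "cost s1 \<le> cost s + bits V"
    using less.prems(2,3,6) by (auto simp: s1_def keep_def clean_def bounded_def intro!: bits_mono)
  have pass: "sim (passed N ?n V s1) (block K (K * L) [] (take ?n (inp s))) (exec (pass sieve) s1)"
    unfolding s1(2)[symmetric]
    by (rule pass_sieve_sim[OF main_ctx_keep[OF less.prems(1) s1(1)] s1(5) less.prems(3)]) (use less.prems s1 in auto)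
  show ?case
  proof (cases "length (inp s) < ?n")
    case True
    let ?R = "\<lambda>ys t. outp t = outp s @ ys \<and> cost t \<le> cost s + 200 * ?bb * (length (inp s) + 1)"
    have "sim ?R (bind_pmf (block K (K * L) [] (take ?n (inp s))) return_pmf) (exec collect s)"
      unfolding loop
    proof (rule sim_bind[OF pass])
      fix ys t assume t: "passed N ?n V s1 ys t"
      then have X: "reg t rX = 0" using True by (simp add: passed_def s1)
      have "cost t \<le> cost s + bits V + 90 * ?bb * (length (inp s) + 1)" using t s1 True by (simp add: passed_def)
      moreover have "200 * ?bb * (length (inp s) + 1) = 90 * ?bb * (length (inp s) + 1) + 110 * ?bb * (length (inp s) + 1)"
        by (simp add: algebra_simps)
      moreover have "?bb * 1 \<le> ?bb * (length (inp s) + 1)" by (intro mult_left_mono) auto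
      ultimately have "cost t + 1 \<le> cost s + 200 * ?bb * (length (inp s) + 1)" using sq by linarith
      then show "sim ?R (return_pmf ys) (exec collect t)"
        using t s1 unfolding stop[OF X] by (intro sim_return) (simp add: passed_def bits_def)
    qed
    then show ?thesis using True by (simp add: stream_short[OF True K less.prems(4)] bind_return_pmf')
  next
    case False
    then have ne: "inp s \<noteq> []" using less.prems(4) by auto
    have law: "stream K L (inp s) = bind_pmf (block K (K * L) [] (take ?n (inp s)))
        (\<lambda>ys. map_pmf ((@) ys) (stream K L (drop ?n (inp s))))"
      using ne less.prems(4) by (subst stream.simps) simp
    show ?thesis unfolding law loop
    proof (rule sim_bind[OF pass])
      fix ys t assume t: "passed N ?n V s1 ys t"
      have t': "reg t rX \<in> {1..N}" "inp t = drop ?n (inp s)" "clean t" "keep s t" "outp t = outp s @ ys"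
        "cost t \<le> cost s + bits V + 90 * ?bb * (?n + 1)"
        using t s1 False keep_trans[OF s1(1)] by (auto simp: passed_def)
      let ?l = "length (inp t)"
      have l: "length (inp s) = ?n + ?l" using False t'(2) by simp
      have "sim (\<lambda>ys' u. outp u = outp t @ ys' \<and> cost u \<le> cost t + 200 * ?bb * (?l + 1)) (stream K L (inp t)) (exec collect t)"
      proof (rule less.hyps)
        show "length (inp t) < length (inp s)" using l less.prems(4) by simp
        show "main_ctx lg K L t" by (rule main_ctx_keep[OF less.prems(1) t'(4)])
        show "set (inp t) \<subseteq> {1..N}" using less.prems(5) t'(2) set_drop_subset by (metis order_trans)
      qed (use less.prems t' in auto)
      moreover have "cost t + 200 * ?bb * (?l + 1) \<le> cost s + 200 * ?bb * (length (inp s) + 1)"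
      proof -
        define P where "P = ?bb * ?n"
        have "?bb * 1 \<le> P" unfolding P_def using less.prems(4) by (intro mult_left_mono) auto
        moreover have "90 * ?bb * (?n + 1) = 90 * P + 90 * ?bb" by (simp add: P_def algebra_simps)
        moreover have "200 * ?bb * (length (inp s) + 1) = 200 * P + 200 * ?bb * (?l + 1)"
          unfolding l by (simp add: P_def algebra_simps)
        ultimately show ?thesis using t'(6) sq by linarith
      qed
      ultimately show "sim (\<lambda>ys t. outp t = outp s @ ys \<and> cost t \<le> cost s + 200 * ?bb * (length (inp s) + 1))
          (map_pmf ((@) ys) (stream K L (drop ?n (inp s)))) (exec collect t)"
        unfolding sim_map_left t'(2) by (elim sim_mono) (auto simp: t'(5))
    qed
  qed
qed

section \<open>The search for a block size\<close>

lemma hit_snoc: "hit T (cs @ [x]) \<longleftrightarrow> hit T cs \<or> T \<le> Suc (count_list cs x)"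
  unfolding hit_def by (auto split: if_splits) (metis le_SucI)+

lemma probe_exec:
  assumes s: "reg s rOne = 1" "reg s rK1 = 1" "reg s rT = T" "reg s rRem + length cs = n" "0 < reg s rRem" "tallied n cs s"
    "reg s rX \<le> N" "reg s rHit = of_bool (hit T cs)" and V: "2 * N \<le> V" "2 * n \<le> V" "T \<le> V" "1 \<le> V"
  shows "\<exists>t. exec probe s = return_spmf t \<and> tallied n (cs @ [reg s rX]) t \<and> keep s t \<and> reg t rX = reg s rX \<and>
    reg t rRem = reg s rRem \<and> inp t = inp s \<and> outp t = outp s \<and> reg t rHit = of_bool (hit T (cs @ [reg s rX])) \<and>
    cost t \<le> cost s + 30 * bits V"
proof -
  let ?b = "bits V" and ?x = "reg s rX"
  let ?v = "count_list cs ?x"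
  define s1 where "s1 = charge (bits 0) (set_reg rIdx 0 s)"
  have p: "reg s1 rOne = 1" "reg s1 rRem + length cs = n" "0 < reg s1 rRem" "tallied n cs s1" "?x = reg s1 rX * reg s1 rK1 + reg s1 rIdx"
    using s by (simp_all add: s1_def tallied_def)
  have q: "2 * ?x \<le> V" "2 * n \<le> V" "reg s1 rK1 \<le> V" "reg s1 rIdx \<le> V" "reg s1 rX \<le> V" using s V by (simp_all add: s1_def)
  obtain t where t: "exec tally s1 = return_spmf t" "tallied n (cs @ [?x]) t" "reg t rCnt = ?v"
    "\<forall>r. r \<notin> {rAddr, rCnt, rTmp} \<longrightarrow> reg t r = reg s1 r" "inp t = inp s1" "outp t = outp s1" "cost t \<le> cost s1 + 18 * ?b"
    using tally_exec[OF p q] by blast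
  have "?v \<le> length cs" by (rule count_le_length)
  then have v: "Suc ?v \<le> V" using s V by linarith
  have b: "bits 0 \<le> ?b" "bits ?v \<le> ?b" "bits (Suc ?v) \<le> ?b" "bits T \<le> ?b" "bits (T - Suc ?v) \<le> ?b" "bits 1 \<le> ?b"
    using V v by (auto intro!: bits_mono simp del: One_nat_def)
  have t': "reg t rOne = 1" "reg t rT = T" "reg t rX = ?x" "reg t rRem = reg s rRem" "reg t rHit = of_bool (hit T cs)"
    "keep s t" "inp t = inp s" "outp t = outp s"
    using t s by (simp_all add: s1_def keep_def)
  define t1 where "t1 = charge (bits ?v + bits 1) (set_reg rTmp (Suc ?v) t)"
  define t2 where "t2 = charge (bits T + bits (Suc ?v)) (set_reg rTmp (T - Suc ?v) t1)"
  define t3 where "t3 = charge (bits (T - Suc ?v)) t2"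
  define t4 where "t4 = (if T \<le> Suc ?v then charge (bits 1) (set_reg rHit 1 t3) else t3)"
  have exec: "exec probe s = return_spmf t4"
  proof -
    have "exec probe s = exec (prog [Arith Add rTmp rCnt rOne, Arith Sub rTmp rT rTmp, If rTmp Skip (Const rHit 1)]) t"
      by (simp add: probe_def s1_def[symmetric] t(1))
    also have "\<dots> = return_spmf t4"
      using t(3) t'(1,2) by (simp add: t1_def t2_def t3_def t4_def Let_def)
    finally show ?thesis .
  qed
  have t4: "tallied n (cs @ [?x]) t4" "keep s t4" "reg t4 rX = ?x" "reg t4 rRem = reg s rRem" "inp t4 = inp s" "outp t4 = outp s"
    "reg t4 rHit = of_bool (hit T (cs @ [?x]))"
    using t(2) t' by (auto simp: t4_def t3_def t2_def t1_def keep_def tallied_def hit_snoc)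
  have "cost s1 \<le> cost s + ?b" using b by (simp add: s1_def)
  moreover have "cost t4 \<le> cost t + 6 * ?b" using b by (simp add: t4_def t3_def t2_def t1_def)
  ultimately have "cost t4 \<le> cost s + 30 * ?b" using t(7) by linarith
  with exec t4 show ?thesis by blast
qed

lemma scan_probe_exec:
  assumes "reg s rOne = 1" "reg s rK1 = 1" "reg s rT = T" "reg s rRem + length cs = n" "tallied n cs s"
    "reg s rX \<in> {1..N}" "set (inp s) \<subseteq> {1..N}" "set cs \<subseteq> {1..N}" "reg s rHit = of_bool (hit T cs)"
    "2 * N \<le> V" "2 * n \<le> V" "T \<le> V" "1 \<le> V"
  shows "\<exists>t. exec (scan probe) s = return_spmf t \<and> scanned N n V s [] t \<and>
    (reg s rRem \<le> length (inp s) \<longrightarrow> reg t rHit = of_bool (hit T (cs @ take (reg s rRem) (inp s))))"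
  using assms
proof (induction "reg s rRem" arbitrary: s cs)
  case 0
  note sq = bits_sq[of V] bits_pos[of V]
  have cs: "\<forall>c\<in>set cs. 2 * c \<le> V"
  proof
    fix c assume "c \<in> set cs"
    then have "c \<le> N" using 0(9) by auto
    then show "2 * c \<le> V" using 0(11) by linarith
  qed
  have "scanned N n V s [] (charge (bits 0) s)"
    using 0 sq cs by (auto simp: scanned_def keep_def tallied_cong[of "charge _ s" s] bits_def intro!: exI[of _ cs])
  then show ?case using 0 by (simp add: scan_done)
next
  case (Suc m)
  note sq = bits_sq[of V] bits_pos[of V]
  have rV: "0 < reg s rRem" "reg s rRem \<le> V" using Suc.prems(4,11) Suc.hyps(2) by auto
  show ?case
  proof (cases "inp s")
    case Nil
    obtain t where
      t: "exec (scan probe) s = return_spmf t" "keep s t" "reg t rX = 0" "outp t = outp s" "inp t = []" "cost t \<le> cost s + 5 * bits V"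
      using scan_eof[OF rV(1) Nil rV(2), of probe] by auto
    have "cost t \<le> cost s + 70 * (bits V * bits V)" using t(6) sq by linarith
    then have "scanned N n V s [] t" using t Nil rV by (simp add: scanned_def)
    then show ?thesis using t(1) Nil rV by auto
  next
    case (Cons x zs)
    have V: "x \<le> V" "x \<le> N" "x \<noteq> 0" using Suc.prems Cons by auto
    obtain s2 where s2: "exec (scan probe) s = bind_spmf (exec probe s2) (\<lambda>t. exec (scan probe) (dec t))" "keep s s2"
      "reg s2 rX = x" "reg s2 rRem = reg s rRem" "reg s2 rHit = reg s rHit"
      "memory s2 = memory s" "outp s2 = outp s" "inp s2 = zs" "cost s2 \<le> cost s + 3 * bits V"
      using scan_step[OF rV(1) Cons V(3) rV(2) V(1), of probe] by auto
    note k2 = keepD[OF s2(2)]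
    have "\<exists>t. exec probe s2 = return_spmf t \<and> tallied n (cs @ [reg s2 rX]) t \<and> keep s2 t \<and> reg t rX = reg s2 rX \<and>
      reg t rRem = reg s2 rRem \<and> inp t = inp s2 \<and> outp t = outp s2 \<and> reg t rHit = of_bool (hit T (cs @ [reg s2 rX])) \<and>
      cost t \<le> cost s2 + 30 * bits V"
      by (rule probe_exec[where N = N]) (use Suc.prems s2 k2 rV V tallied_cong[OF s2(6)] in simp_all)
    then obtain t where t: "exec probe s2 = return_spmf t" "tallied n (cs @ [x]) t" "keep s2 t" "reg t rX = x"
      "reg t rRem = reg s rRem" "inp t = zs" "outp t = outp s" "reg t rHit = of_bool (hit T (cs @ [x]))"
      "cost t \<le> cost s2 + 30 * bits V"
      unfolding s2(3,4,7,8) by blast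
    note kt = keepD[OF t(3)]
    have "reg t rOne = 1" "0 < reg t rRem" "reg t rRem \<le> V" using t rV kt k2 Suc.prems(1) by auto
    note d = dec[OF this]
    have ks: "keep s (dec t)" using keep_trans[OF keep_trans[OF s2(2) t(3)] d(1)] .
    note kd = keepD[OF ks]
    have dm: "reg (dec t) rRem = m" using d t Suc.hyps(2) by simp
    have "\<exists>u. exec (scan probe) (dec t) = return_spmf u \<and> scanned N n V (dec t) [] u \<and>
      (reg (dec t) rRem \<le> length (inp (dec t)) \<longrightarrow> reg u rHit = of_bool (hit T ((cs @ [x]) @ take (reg (dec t) rRem) (inp (dec t)))))"
      by (rule Suc.hyps(1))
        (use dm Suc.prems Suc.hyps(2) d t V kd Cons tallied_cong[OF d(5)] in simp_all)
    then obtain u where u: "exec (scan probe) (dec t) = return_spmf u" "scanned N n V (dec t) [] u"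
      "m \<le> length zs \<longrightarrow> reg u rHit = of_bool (hit T ((cs @ [x]) @ take m zs))"
      using dm d t by auto
    have "cost (dec t) \<le> cost s + 65 * (bits V * bits V)" using d(8) t(9) s2(9) sq by linarith
    then have "scanned N n V s ([] @ []) u"
      using u(2) ks d t dm Suc.hyps(2) by (intro scanned_step[of N n V "dec t" "[]" u]) (auto simp: Cons)
    moreover have "exec (scan probe) s = return_spmf u" using s2(1) t(1) u(1) by simp
    ultimately show ?thesis using u(3) by (auto simp: Cons simp flip: Suc.hyps(2))
  qed
qed

lemma pass_probe_exec:
  assumes s: "reg s rOne = 1" "reg s rZero = 0" "reg s rK1 = 1" "reg s rT = T" "reg s rL = L" "clean s" "reg s rHit = 0"
    "reg s rX \<in> {1..N}" "set (inp s) \<subseteq> {1..N}" and T: "0 < T" and V: "2 * N \<le> V" "2 * L \<le> V" "T \<le> V" "1 \<le> V"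
  shows "\<exists>u. exec (pass probe) s = return_spmf u \<and> passed N L V s [] u \<and>
    (L \<le> length (inp s) \<longrightarrow> reg u rHit = of_bool (hit T (take L (inp s))))"
proof -
  have n: "reg s rK1 * reg s rL = L" using s by simp
  let ?p = "pass_start L s"
  have p: "keep s ?p" "inp ?p = inp s" "reg ?p rRem = L" "reg ?p rX = reg s rX" "memory ?p = memory s" "reg ?p rHit = reg s rHit"
    by (simp_all add: pass_start_def keep_def)
  note kp = keepD[OF p(1)]
  have "\<not> hit T []" using T by (simp add: hit_def)
  have "\<exists>t. exec (scan probe) ?p = return_spmf t \<and> scanned N L V ?p [] t \<and>
    (reg ?p rRem \<le> length (inp ?p) \<longrightarrow> reg t rHit = of_bool (hit T ([] @ take (reg ?p rRem) (inp ?p))))"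
    by (rule scan_probe_exec) (use s V p kp \<open>\<not> hit T []\<close> in \<open>simp_all add: tallied_def clean_def\<close>)
  then obtain t where t: "exec (scan probe) ?p = return_spmf t" "scanned N L V ?p [] t"
    "L \<le> length (inp s) \<longrightarrow> reg t rHit = of_bool (hit T (take L (inp s)))"
    unfolding p by auto
  have "\<exists>u. exec pass_end t = return_spmf u \<and> passed N L V s [] u \<and> (L \<le> length (inp s) \<longrightarrow> reg u rHit = reg t rHit)"
    by (rule pass_end_exec[OF t(2) n]) (use s V in auto)
  then show ?thesis using t by (auto simp: pass_exec[OF n])
qed

text \<open>This bounds the search although the program does not know \<open>N\<close>: a miss at
  \<open>L\<close> forces \<open>L \<le> N * T\<close>, so after doubling \<open>L\<close> is at
  most \<open>2 * N * T\<close>.\<close>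

lemma hit_pigeonhole:
  assumes "set xs \<subseteq> {1..N}" "\<not> hit T xs" "0 < T"
  shows "length xs \<le> N * T"
proof -
  have "length xs = (\<Sum>x\<in>{1..N}. count_list xs x)"
    by (rule sum_count_set[symmetric]) (use assms in auto)
  also have "\<dots> \<le> (\<Sum>x\<in>{1..N}. T)"
    using assms(2) by (intro sum_mono) (auto simp: hit_def not_le intro: less_imp_le)
  finally show ?thesis by simp
qed

definition found :: "nat \<Rightarrow> nat \<Rightarrow> nat \<Rightarrow> nat \<Rightarrow> nat list \<Rightarrow> state \<Rightarrow> bool" where
  "found T L N b xs t \<longleftrightarrow> (reg t rX = 0 \<and> algo T L xs = return_pmf []) \<or>
     (reg t rX \<in> {1..N} \<and> clean t \<and> T \<le> reg t rL \<and> reg t rL \<le> b \<and> set (inp t) \<subseteq> {1..N} \<and>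
      algo T L xs = harvest T (reg t rL) (inp t))"

text \<open>The unread input serves as a potential: each symbol consumed releases 200 units of
  \<open>bits V * bits V\<close>, which pay for the probe. The bound for \<open>collect\<close> on
  the rest can then be added without loss.\<close>

lemma search_exec:
  assumes "reg s rOne = 1" "reg s rZero = 0" "reg s rK1 = 1" "reg s rT = T" "reg s rL = L" "clean s" "reg s rHit = 0"
    "reg s rX \<in> {1..N}" "set (inp s) \<subseteq> {1..N}" "reg s rGo = 1" "0 < T" "T \<le> L" "L \<le> 2 * N * T" "4 * N * T \<le> V"
  shows "\<exists>t. exec search s = return_spmf t \<and> found T L N (2 * N * T) (inp s) t \<and> outp t = outp s \<and>
     reg t rOne = 1 \<and> reg t rZero = 0 \<and> reg t rT = T \<and> reg t rLg = reg s rLg \<and> length (inp t) \<le> length (inp s) \<and>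
     cost t + 200 * (bits V * bits V) * length (inp t) \<le> cost s + 200 * (bits V * bits V) * (length (inp s) + 1)"
  using assms
proof (induction "length (inp s)" arbitrary: s L rule: less_induct)
  case less
  let ?bb = "bits V * bits V"
  note sq = bits_sq[of V] bits_pos[of V]
  have N: "0 < N" using less.prems(8) by simp
  have NT: "N * 1 \<le> N * T" "1 * T \<le> N * T" using less.prems(11) N by (intro mult_le_mono; simp)+
  have V: "2 * N \<le> V" "2 * L \<le> V" "T \<le> V" "1 \<le> V" using NT less.prems(11-14) by linarith+
  define s1 where "s1 = charge (bits 1) s"
  define step where "step = If rX (If rHit (Const rGo 0) (Arith Add rL rL rL)) (Const rGo 0)"
  have loop: "exec search s = bind_spmf (bind_spmf (exec (pass probe) s1) (exec step)) (exec search)"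
    unfolding search_def step_def using less.prems(10) by (subst exec_While) (simp add: s1_def Let_def)
  have stop: "exec search t = return_spmf (charge (bits 0) t)" if "reg t rGo = 0" for t
    unfolding search_def using that by (subst exec_While) (simp add: Let_def)
  have b: "bits 1 \<le> bits V" "bits 0 \<le> bits V" "bits L \<le> bits V" using V by (auto intro!: bits_mono simp del: One_nat_def)
  have s1: "keep s s1" "inp s1 = inp s" "outp s1 = outp s" "cost s1 \<le> cost s + bits V"
    using b by (simp_all add: s1_def keep_def)
  have "\<exists>u. exec (pass probe) s1 = return_spmf u \<and> passed N L V s1 [] u \<and>
    (L \<le> length (inp s1) \<longrightarrow> reg u rHit = of_bool (hit T (take L (inp s1))))"
    by (rule pass_probe_exec) (use less.prems V in \<open>simp_all add: s1_def clean_def\<close>)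
  then obtain u where u: "exec (pass probe) s1 = return_spmf u" "passed N L V s1 [] u"
    "L \<le> length (inp s) \<longrightarrow> reg u rHit = of_bool (hit T (take L (inp s)))"
    unfolding s1(2) by blast
  have ku: "keep s u" using u(2) s1(1) by (auto simp: passed_def intro: keep_trans)
  note k = keepD[OF ku]
  have ou: "outp u = outp s" using u(2) s1 by (simp add: passed_def)
  have cu: "cost u \<le> cost s + bits V + 90 * ?bb * (min (length (inp s)) L + 1)" using u(2) s1 by (simp add: passed_def)
  show ?case
  proof (cases "length (inp s) < L")
    case True
    then have X: "reg u rX = 0" "inp u = []" using u(2) s1 by (simp_all add: passed_def)
    define t where "t = charge (bits 0) (charge (bits 0) (set_reg rGo 0 (charge (bits 0) u)))"
    have "exec search s = return_spmf t"
      unfolding loop u(1) using X by (simp add: step_def Let_def t_def stop)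
    moreover have "found T L N (2 * N * T) (inp s) t"
      using True X by (subst (1) found_def, subst algo.simps) (simp add: t_def)
    moreover have "cost t \<le> cost s + 200 * ?bb * (length (inp s) + 1)"
    proof -
      have "cost t \<le> cost u + 3" by (simp add: t_def bits_def)
      moreover have "200 * ?bb * (length (inp s) + 1) = 90 * ?bb * (length (inp s) + 1) + 110 * ?bb * (length (inp s) + 1)"
        by (simp add: algebra_simps)
      moreover have "?bb * 1 \<le> ?bb * (length (inp s) + 1)" by (intro mult_left_mono) auto
      moreover have "min (length (inp s)) L = length (inp s)" using True by simp
      ultimately show ?thesis using cu sq by (simp only:)
    qed
    ultimately show ?thesis using X ou k less.prems by (auto simp: t_def)
  next
    case False
    have pu: "reg u rX \<in> {1..N}" "inp u = drop L (inp s)" "clean u" "reg u rHit = of_bool (hit T (take L (inp s)))"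
      using u(2,3) s1 False by (simp_all add: passed_def)
    have ne: "0 < L" using less.prems(11,12) by simp
    have l: "length (inp s) = L + length (inp u)" using False pu(2) by simp
    have bX: "bits (reg u rX) \<le> bits V" using pu(1) V by (auto intro!: bits_mono)
    have su: "set (inp u) \<subseteq> {1..N}" using less.prems(9) pu(2) set_drop_subset by (metis order_trans)
    define P where "P = ?bb * L"
    have P: "?bb \<le> P" using mult_left_mono[of 1 L ?bb] ne by (simp add: P_def)
    have cu': "cost u \<le> cost s + bits V + 90 * P + 90 * ?bb"
      using cu False by (simp add: P_def algebra_simps)
    have tot: "200 * ?bb * (length (inp s) + 1) = 200 * P + 200 * ?bb + 200 * ?bb * length (inp u)"
      unfolding l by (simp add: P_def algebra_simps)
    show ?thesis
    proof (cases "hit T (take L (inp s))")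
      case True
      define t where "t = charge (bits 0) (charge (bits 0) (set_reg rGo 0 (charge (bits 1) (charge (bits (reg u rX)) u))))"
      have "exec search s = return_spmf t"
        unfolding loop u(1) using pu True by (simp add: step_def Let_def t_def stop)
      moreover have "found T L N (2 * N * T) (inp s) t"
        using True pu False su less.prems k ne
        by (subst (1) found_def, subst (1 2) algo.simps) (simp add: t_def clean_def)
      moreover have "cost t \<le> cost u + 2 * bits V + 2" using bX b by (simp add: t_def bits_def)
      then have "cost t + 200 * ?bb * length (inp u) \<le> cost s + 200 * ?bb * (length (inp s) + 1)"
        unfolding tot using cu' P sq by linarith
      ultimately show ?thesis using ou k less.prems l by (auto simp: t_def)
    next
      case nohit: False
      define t where "t = charge (bits L + bits L) (set_reg rL (2 * L) (charge (bits 0) (charge (bits (reg u rX)) u)))"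
      have e: "exec search s = exec search t"
        unfolding loop u(1) using pu nohit k less.prems(5) by (simp add: step_def Let_def t_def mult_2)
      have "length (take L (inp s)) \<le> N * T"
        by (rule hit_pigeonhole) (use less.prems nohit set_take_subset[of L "inp s"] in auto)
      then have L2: "2 * L \<le> 2 * N * T" using False by simp
      have "\<exists>v. exec search t = return_spmf v \<and> found T (2 * L) N (2 * N * T) (inp t) v \<and> outp v = outp t \<and>
         reg v rOne = 1 \<and> reg v rZero = 0 \<and> reg v rT = T \<and> reg v rLg = reg t rLg \<and> length (inp v) \<le> length (inp t) \<and>
         cost v + 200 * ?bb * length (inp v) \<le> cost t + 200 * ?bb * (length (inp t) + 1)"
      proof (rule less.hyps)
        show "length (inp t) < length (inp s)" using l ne by (simp add: t_def)
        show "clean t" using pu(3) by (simp add: t_def clean_def)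
        show "2 * L \<le> 2 * N * T" by (rule L2)
      qed (use less.prems k pu nohit su in \<open>simp_all add: t_def\<close>)
      then obtain v where v: "exec search t = return_spmf v" "found T (2 * L) N (2 * N * T) (inp t) v" "outp v = outp t"
         "reg v rOne = 1 \<and> reg v rZero = 0 \<and> reg v rT = T" "reg v rLg = reg t rLg" "length (inp v) \<le> length (inp t)"
         "cost v + 200 * ?bb * length (inp v) \<le> cost t + 200 * ?bb * (length (inp t) + 1)" by blast
      have it: "inp t = inp u" "outp t = outp s" "reg t rLg = reg s rLg" using ou k by (simp_all add: t_def)
      have "algo T L (inp s) = algo T (2 * L) (inp t)"
        using False nohit ne pu(2) by (subst algo.simps) (simp add: it)
      then have "found T L N (2 * N * T) (inp s) v" using v(2) by (simp add: found_def)
      moreover have "cost v + 200 * ?bb * length (inp v) \<le> cost s + 200 * ?bb * (length (inp s) + 1)"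
      proof -
        have "cost t \<le> cost u + 4 * bits V" using bX b by (simp add: t_def)
        moreover have "200 * ?bb * (length (inp t) + 1) = 200 * ?bb * length (inp u) + 200 * ?bb"
          unfolding it by (simp add: algebra_simps)
        ultimately show ?thesis unfolding tot using v(7) cu' P sq by linarith
      qed
      ultimately show ?thesis using v it l unfolding e by auto
    qed
  qed
qed

section \<open>Initialisation and the complete program\<close>

lemma prepare_exec:
  assumes s: "reg s rOne = 1" "reg s rZero = 0" "reg s rT = T" "reg s rLg = lg" "2 ^ lg = 8 * T" "reg s rL = L" "T \<le> L" "clean s"
    and V: "8 * T \<le> V" "L \<le> V" "1 \<le> V"
  obtains t lg' where "exec prepare s = return_spmf t"
    "main_ctx lg' (if L = T then 1 else 8 * T) (if L = T then 1 else L) t" "clean t"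
    "reg t rX = reg s rX" "inp t = inp s" "outp t = outp s" "cost t \<le> cost s + 20 * bits V"
proof -
  let ?b = "bits V"
  define K where "K = (if L = T then 1 else 8 * T)"
  have b: "bits L \<le> ?b" "bits T \<le> ?b" "bits (L - T) \<le> ?b" "bits (T + T) \<le> ?b" "bits (T + T + (T + T)) \<le> ?b"
    "bits (T + T + (T + T) + (T + T + (T + T))) \<le> ?b" "bits 1 \<le> ?b"
    "bits K \<le> ?b" "bits 0 \<le> ?b"
    using V by (auto intro!: bits_mono simp: K_def simp del: One_nat_def)
  have "\<exists>t. exec prepare s = return_spmf t \<and> (\<exists>lg'. main_ctx lg' K (if L = T then 1 else L) t) \<and> clean t \<and>
    reg t rX = reg s rX \<and> inp t = inp s \<and> outp t = outp s \<and> cost t \<le> cost s + 20 * bits V"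
  proof (cases "L = T")
    case True
    then show ?thesis using s b by (simp add: prepare_def Let_def main_ctx_def clean_def K_def)
  next
    case False
    then have "T < L" using s(7) by simp
    then show ?thesis using s b False by (simp add: prepare_def Let_def main_ctx_def clean_def K_def)
  qed
  then show thesis using that unfolding K_def by blast
qed

text \<open>The number of binary digits of \<open>q\<close>.\<close>

fun doublings :: "nat \<Rightarrow> nat" where
  "doublings q = (if q = 0 then 0 else Suc (doublings (q div 2)))"

declare doublings.simps[simp del]

lemma doublings_0[simp]: "doublings 0 = 0" by (simp add: doublings.simps)

lemma doublings_bounds: "0 < q \<Longrightarrow> q < 2 ^ doublings q \<and> 2 ^ doublings q \<le> 2 * q"
proof (induction q rule: doublings.induct)
  case (1 q)
  show ?case
  proof (cases "q div 2 = 0")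
    case True
    then have "q = 1" using 1 by auto
    then show ?thesis by (simp add: doublings.simps)
  next
    case False
    then have "q div 2 < 2 ^ doublings (q div 2)" "2 ^ doublings (q div 2) \<le> 2 * (q div 2)" using 1 by auto
    moreover have "doublings q = Suc (doublings (q div 2))" using 1(2) by (subst doublings.simps) simp
    moreover have "2 * (q div 2) \<le> q" "q \<le> 2 * (q div 2) + 1" by simp_all
    ultimately show ?thesis by simp
  qed
qed

definition grow_loop :: com where
  "grow_loop = While rTmp (prog [Arith Add rT rT rT, Arith Add rLg rLg rOne, Arith Div rTmp rTmp rTwo])"

lemma grow_exec:
  assumes "reg s rOne = 1" "reg s rTwo = 2" "reg s rT * 2 ^ doublings (reg s rTmp) \<le> V" "reg s rTmp \<le> V" "2 \<le> V"
    "reg s rLg + doublings (reg s rTmp) \<le> V"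
  shows "\<exists>t. exec grow_loop s = return_spmf t \<and> reg t rT = reg s rT * 2 ^ doublings (reg s rTmp) \<and>
    reg t rLg = reg s rLg + doublings (reg s rTmp) \<and> (\<forall>r. r \<notin> {rT, rLg, rTmp} \<longrightarrow> reg t r = reg s r) \<and>
    memory t = memory s \<and> inp t = inp s \<and> outp t = outp s \<and> cost t \<le> cost s + 7 * bits V * doublings (reg s rTmp) + 1"
  using assms
proof (induction "reg s rTmp" arbitrary: s rule: doublings.induct)
  case 1
  let ?q = "reg s rTmp"
  show ?case
  proof (cases "?q = 0")
    case True
    then have "exec grow_loop s = return_spmf (charge (bits 0) s)"
      unfolding grow_loop_def by (subst exec_While) (simp add: Let_def)
    then show ?thesis using True by (intro exI[of _ "charge (bits 0) s"]) (auto simp: bits_def)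
  next
    case False
    define t where "t = charge (bits ?q + bits 2) (set_reg rTmp (?q div 2) (charge (bits (reg s rLg) + bits 1) (set_reg rLg (reg s rLg + 1)
      (charge (bits (reg s rT) + bits (reg s rT)) (set_reg rT (2 * reg s rT) (charge (bits ?q) s))))))"
    have e: "exec grow_loop s = exec grow_loop t"
      unfolding grow_loop_def using False 1(2-) by (subst exec_While) (simp add: Let_def t_def mult_2)
    have D: "doublings ?q = Suc (doublings (?q div 2))" using False by (subst doublings.simps) simp
    have "reg s rT * 1 \<le> reg s rT * 2 ^ doublings ?q" by (intro mult_left_mono) auto
    then have "reg s rT \<le> V" using 1(4) by linarith
    then have b: "bits ?q \<le> bits V" "bits 2 \<le> bits V" "bits 1 \<le> bits V" "bits (reg s rT) \<le> bits V" "bits (reg s rLg) \<le> bits V"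
      using 1(2-) by (auto intro!: bits_mono simp del: One_nat_def)
    have ct: "cost t \<le> cost s + 7 * bits V" using b by (simp add: t_def)
    have "\<exists>u. exec grow_loop t = return_spmf u \<and> reg u rT = reg t rT * 2 ^ doublings (reg t rTmp) \<and>
      reg u rLg = reg t rLg + doublings (reg t rTmp) \<and> (\<forall>r. r \<notin> {rT, rLg, rTmp} \<longrightarrow> reg u r = reg t r) \<and>
      memory u = memory t \<and> inp u = inp t \<and> outp u = outp t \<and> cost u \<le> cost t + 7 * bits V * doublings (reg t rTmp) + 1"
      by (rule 1(1)) (use False 1(2-) D in \<open>simp_all add: t_def algebra_simps\<close>)
    then obtain u where u: "exec grow_loop t = return_spmf u" "reg u rT = reg t rT * 2 ^ doublings (reg t rTmp)"
      "reg u rLg = reg t rLg + doublings (reg t rTmp)" "\<forall>r. r \<notin> {rT, rLg, rTmp} \<longrightarrow> reg u r = reg t r"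
      "memory u = memory t" "inp u = inp t" "outp u = outp t" "cost u \<le> cost t + 7 * bits V * doublings (reg t rTmp) + 1"
      by blast
    have "cost u \<le> cost s + 7 * bits V * doublings ?q + 1"
      using u(8) ct unfolding D by (simp add: t_def)
    then show ?thesis using u D unfolding e by (simp add: t_def)
  qed
qed

text \<open>A power of two between \<open>\<kappa> / 512\<close> and \<open>\<kappa> / 256\<close>
  for large \<open>\<kappa>\<close>. Proportionality to \<open>\<kappa>\<close> makes the tails
  exponentially small in \<open>\<kappa>\<close>; the small factor keeps a block, whose length is of
  order \<open>T\<^sup>2 / max p\<close>, short compared with the guaranteed input length
  \<open>10 * \<kappa>\<^sup>2 / max p\<close>.\<close>

definition threshold :: "nat \<Rightarrow> nat" where
  "threshold k = 2 ^ doublings (k div 512)"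

lemma threshold_pos[simp]: "0 < threshold k" by (simp add: threshold_def)

lemma threshold_le: "threshold k \<le> k + 1"
proof (cases "k div 512 = 0")
  case False
  then have "threshold k \<le> 2 * (k div 512)" using doublings_bounds[of "k div 512"] by (simp add: threshold_def)
  also have "\<dots> \<le> k" by simp
  finally show ?thesis by simp
qed (simp add: threshold_def)

definition start_state :: "nat \<Rightarrow> nat list \<Rightarrow> state" where
  "start_state k xs = \<lparr>reg = (\<lambda>_. 0)(0 := k), memory = (\<lambda>_. 0), inp = xs, outp = [], cost = 0\<rparr>"

lemma startup_exec:
  assumes V: "600 * (k + 1) \<le> V"
  shows "\<exists>t lg. exec startup (start_state k xs) = return_spmf t \<and> reg t rOne = 1 \<and> reg t rZero = 0 \<and> reg t rK1 = 1 \<and>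
    reg t rT = threshold k \<and> reg t rL = threshold k \<and> clean t \<and> reg t rHit = 0 \<and> reg t rX = 1 \<and> reg t rGo = 1 \<and>
    reg t rLg = lg \<and> 2 ^ lg = 8 * threshold k \<and> inp t = xs \<and> outp t = [] \<and> cost t \<le> 40 * (bits V * bits V)"
proof -
  let ?b = "bits V"
  note sq = bits_sq[of V] bits_pos[of V]
  define q where "q = k div 512"
  define D where "D = doublings q"
  have T: "threshold k = 2 ^ D" by (simp add: threshold_def D_def q_def)
  have "D < 2 ^ D" by (rule less_exp)
  then have DV: "2 ^ D \<le> V" "q \<le> V" "D + 3 \<le> V" "k \<le> V" "512 \<le> V"
    using V threshold_le[of k, unfolded T] by (linarith | simp add: q_def)+
  have Db: "D \<le> ?b"
  proof -
    have "floor_log (2 ^ D) \<le> floor_log V" by (rule monoD[OF floor_log_mono DV(1)])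
    then show ?thesis by (simp add: bits_def)
  qed
  have b: "bits 1 \<le> ?b" "bits 2 \<le> ?b" "bits 3 \<le> ?b" "bits 512 \<le> ?b" "bits k \<le> ?b" "bits 0 \<le> ?b" "bits (2 ^ D) \<le> ?b"
    using DV by (auto intro!: bits_mono simp del: One_nat_def)
  let ?init = "prog [Const rOne 1, Const rTwo 2, Const rT 1, Const rLg 3, Const rTmp 512, Arith Div rTmp rKap rTmp]"
  let ?fin = "prog [Const rK1 1, Arith Add rL rT rZero, Const rX 1, Const rGo 1]"
  have "\<exists>s. exec ?init (start_state k xs) = return_spmf s \<and> reg s rOne = 1 \<and> reg s rTwo = 2 \<and> reg s rT = 1 \<and> reg s rLg = 3 \<and>
    reg s rTmp = q \<and> reg s rZero = 0 \<and> reg s rHit = 0 \<and> clean s \<and> inp s = xs \<and> outp s = [] \<and> cost s \<le> 8 * ?b"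
    using b by (simp add: start_state_def q_def clean_def)
  then obtain s where s: "exec ?init (start_state k xs) = return_spmf s" "reg s rOne = 1" "reg s rTwo = 2" "reg s rT = 1"
    "reg s rLg = 3" "reg s rTmp = q" "reg s rZero = 0" "reg s rHit = 0" "clean s" "inp s = xs" "outp s = []" "cost s \<le> 8 * ?b"
    by blast
  have "\<exists>t. exec grow_loop s = return_spmf t \<and> reg t rT = reg s rT * 2 ^ doublings (reg s rTmp) \<and>
    reg t rLg = reg s rLg + doublings (reg s rTmp) \<and> (\<forall>r. r \<notin> {rT, rLg, rTmp} \<longrightarrow> reg t r = reg s r) \<and>
    memory t = memory s \<and> inp t = inp s \<and> outp t = outp s \<and> cost t \<le> cost s + 7 * bits V * doublings (reg s rTmp) + 1"
    by (rule grow_exec) (use s DV in \<open>simp_all add: D_def[symmetric]\<close>)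
  then obtain t where t: "exec grow_loop s = return_spmf t" "reg t rT = 2 ^ D" "reg t rLg = 3 + D"
    "\<forall>r. r \<notin> {rT, rLg, rTmp} \<longrightarrow> reg t r = reg s r" "memory t = memory s" "inp t = xs" "outp t = []"
    "cost t \<le> cost s + 7 * ?b * D + 1"
    using s by (auto simp: D_def)
  have t': "reg t rOne = 1" "reg t rZero = 0" "reg t rHit = 0" "clean t" using t s by (auto simp: clean_def)
  have "\<exists>u. exec ?fin t = return_spmf u \<and> reg u rOne = 1 \<and> reg u rZero = 0 \<and> reg u rK1 = 1 \<and>
    reg u rT = 2 ^ D \<and> reg u rL = 2 ^ D \<and> clean u \<and> reg u rHit = 0 \<and> reg u rX = 1 \<and> reg u rGo = 1 \<and>
    reg u rLg = 3 + D \<and> inp u = xs \<and> outp u = [] \<and> cost u \<le> cost t + 6 * ?b"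
    using t t' b by (simp add: clean_def)
  then obtain u where u: "exec ?fin t = return_spmf u" "reg u rOne = 1 \<and> reg u rZero = 0 \<and> reg u rK1 = 1 \<and>
    reg u rT = 2 ^ D \<and> reg u rL = 2 ^ D \<and> clean u \<and> reg u rHit = 0 \<and> reg u rX = 1 \<and> reg u rGo = 1 \<and>
    reg u rLg = 3 + D \<and> inp u = xs \<and> outp u = []" "cost u \<le> cost t + 6 * ?b" by blast
  have "exec startup (start_state k xs) = bind_spmf (bind_spmf (exec ?init (start_state k xs)) (exec grow_loop)) (exec ?fin)"
    by (simp add: startup_def grow_loop_def)
  then have "exec startup (start_state k xs) = return_spmf u" by (simp only: s(1) t(1) u(1) return_bind_spmf)
  moreover have "cost u \<le> 40 * (?b * ?b)"
  proof -
    have "7 * ?b * D \<le> 7 * ?b * ?b" using Db by simp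
    then have "7 * ?b * D \<le> 7 * (?b * ?b)" by (simp only: mult.assoc)
    then show ?thesis using u(3) t(8) s(12) sq by linarith
  qed
  moreover have "(2::nat) ^ (3 + D) = 8 * 2 ^ D" by (simp add: power_add)
  ultimately show ?thesis using u unfolding T by blast
qed

text \<open>\<open>V\<close> dominates everything stored: the search leaves
  \<open>L \<le> 2 * N * T\<close>, so a pass has length of order \<open>N * T\<^sup>2\<close> and
  cell numbers are of order \<open>N * T\<close>, with \<open>T \<le> k + 1\<close>. The bit length
  of \<open>V\<close> is logarithmic in \<open>N\<close> and \<open>k\<close>.\<close>

theorem sampler_sim:
  assumes xs: "set xs \<subseteq> {1..N}" and N: "1 \<le> N" and V: "V = 600 * N * (k + 1)\<^sup>2"
  shows "sim (\<lambda>ys t. outp t = ys \<and> cost t \<le> 700 * (bits V * bits V) * (length xs + 1))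
    (algo (threshold k) (threshold k) xs) (exec sampler (start_state k xs))"
proof -
  let ?T = "threshold k" and ?bb = "bits V * bits V"
  note sq = bits_sq[of V] bits_pos[of V]
  have V1: "600 * (k + 1) \<le> V"
    using mult_le_mono[of 1 N "600 * (k + 1)" "600 * (k + 1) * (k + 1)"] N by (simp add: V power2_eq_square algebra_simps)
  have T1: "1 \<le> ?T" by (simp add: Suc_leI)
  have NTT: "600 * N * (?T * ?T) \<le> V"
    unfolding V power2_eq_square by (intro mult_le_mono threshold_le order_refl)
  have NT: "N * ?T \<le> N * (?T * ?T)" "?T \<le> N * ?T" "N \<le> N * ?T"
    using N T1 by simp_all
  obtain s lg where s: "exec startup (start_state k xs) = return_spmf s" "reg s rOne = 1" "reg s rZero = 0" "reg s rK1 = 1"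
    "reg s rT = ?T" "reg s rL = ?T" "clean s" "reg s rHit = 0" "reg s rX = 1" "reg s rGo = 1"
    "reg s rLg = lg" "2 ^ lg = 8 * ?T" "inp s = xs" "outp s = []" "cost s \<le> 40 * ?bb"
    using startup_exec[OF V1, of xs] by blast
  have "\<exists>t. exec search s = return_spmf t \<and> found ?T ?T N (2 * N * ?T) (inp s) t \<and> outp t = outp s \<and>
     reg t rOne = 1 \<and> reg t rZero = 0 \<and> reg t rT = ?T \<and> reg t rLg = reg s rLg \<and> length (inp t) \<le> length (inp s) \<and>
     cost t + 200 * ?bb * length (inp t) \<le> cost s + 200 * ?bb * (length (inp s) + 1)"
  proof (rule search_exec)
    have "600 * (N * (?T * ?T)) \<le> V" using NTT by (simp only: mult.assoc)
    then have "4 * (N * ?T) \<le> V" using NT by linarith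
    then show "4 * N * ?T \<le> V" by (simp only: mult.assoc)
  qed (use s xs N T1 NT in simp_all)
  then obtain t where t: "exec search s = return_spmf t" "found ?T ?T N (2 * N * ?T) xs t" "outp t = []"
     "reg t rOne = 1" "reg t rZero = 0" "reg t rT = ?T" "reg t rLg = lg" "length (inp t) \<le> length xs"
     "cost t + 200 * ?bb * length (inp t) \<le> cost s + 200 * ?bb * (length xs + 1)"
    unfolding s by blast
  define t1 where "t1 = charge (bits (reg t rX)) t"
  have e: "exec sampler (start_state k xs) = (if reg t rX \<noteq> 0 then bind_spmf (exec prepare t1) (exec collect) else return_spmf t1)"
    using s(1) t(1) by (simp add: sampler_def Let_def t1_def)
  define Q where "Q = ?bb * (length xs + 1)"
  have Q: "?bb \<le> Q" using mult_left_mono[of 1 "length xs + 1" ?bb] by (simp add: Q_def)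
  have tQ: "cost t + 200 * ?bb * length (inp t) \<le> 240 * Q"
    using t(9) s(15) Q by (simp add: Q_def algebra_simps)
  show ?thesis
  proof (cases "reg t rX = 0")
    case True
    then have "algo ?T ?T xs = return_pmf []" using t(2) by (simp add: found_def)
    moreover have "cost t1 \<le> 700 * ?bb * (length xs + 1)"
    proof -
      have "cost t1 \<le> cost t + 1" using True by (simp add: t1_def bits_def)
      then have "cost t1 \<le> 700 * Q" using tQ Q sq by linarith
      then show ?thesis by (simp add: Q_def algebra_simps)
    qed
    ultimately show ?thesis using True t(3) by (simp add: e t1_def sim_return)
  next
    case False
    let ?L = "reg t rL"
    let ?K = "if ?L = ?T then 1 else 8 * ?T" and ?L' = "if ?L = ?T then 1 else ?L"
    have f: "reg t rX \<in> {1..N}" "clean t" "?T \<le> ?L" "?L \<le> 2 * N * ?T" "set (inp t) \<subseteq> {1..N}"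
      "algo ?T ?T xs = harvest ?T ?L (inp t)"
      using t(2) False by (auto simp: found_def)
    have LV: "?L \<le> V" "8 * ?T \<le> V"
      using f(4)[unfolded mult.assoc] NT NTT[unfolded mult.assoc] by linarith+
    have LV: "?L \<le> V" "8 * ?T \<le> V" "1 \<le> V" "N \<le> V"
    proof -
      show "1 \<le> V" using V1 by simp
      have "N \<le> N * (?T * ?T)" using NT(1,3) by (rule order_trans[rotated])
      also have "\<dots> \<le> 600 * (N * (?T * ?T))" by simp
      also have "\<dots> \<le> V" using NTT by (simp only: mult.assoc)
      finally show "N \<le> V" .
    qed (fact LV)+
    have "reg t rX \<le> V" using f(1) LV(4) by simp
    then have ct1: "cost t1 \<le> cost t + bits V" by (simp add: t1_def bits_mono)
    obtain u lg' where u: "exec prepare t1 = return_spmf u" "main_ctx lg' ?K ?L' u" "clean u"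
      "reg u rX = reg t1 rX" "inp u = inp t1" "outp u = outp t1" "cost u \<le> cost t1 + 20 * bits V"
    proof (rule prepare_exec[of t1 ?T lg ?L V])
    qed (use t f s(12) LV in \<open>simp_all add: t1_def clean_def\<close>)
    have bd: "bounded N ?K (?K * ?L' + ?L') ?L' V"
    proof (cases "?L = ?T")
      case True
      have "N \<le> N * (?T * ?T)" using NT(1,3) by (rule order_trans[rotated])
      then have "600 * N \<le> V" using NTT[unfolded mult.assoc] by linarith
      then show ?thesis using True N by (simp add: bounded_def)
    next
      case False
      have "(8 * ?T + 1) * ?L \<le> (8 * ?T + ?T) * (2 * N * ?T)" by (intro mult_le_mono f(4)) (use T1 in simp)
      also have "\<dots> = 18 * (N * (?T * ?T))" by (simp add: algebra_simps)
      finally have "8 * ?T * ?L + ?L \<le> 18 * (N * (?T * ?T))" by (simp add: algebra_simps)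
      moreover have "N * (8 * ?T + 1) \<le> 9 * (N * (?T * ?T))"
      proof -
        have "N * (8 * ?T + 1) \<le> 9 * (N * ?T)" using T1 by (simp add: algebra_simps)
        then show ?thesis using NT(1) by linarith
      qed
      moreover have "?T \<le> N * (?T * ?T)" using NT by linarith
      moreover have "600 * (N * (?T * ?T)) \<le> V" using NTT by (simp only: mult.assoc)
      moreover have "2 * (A + 8 * T') \<le> V \<and> 2 * B \<le> V \<and> 8 * T' + 1 \<le> V"
        if "B \<le> 18 * P" "A \<le> 9 * P" "T' \<le> P" "600 * P \<le> V" "1 \<le> T'" for A B P T' :: nat
        using that by auto
      ultimately show ?thesis using False LV T1 unfolding bounded_def by (simp only: if_False)
    qed
    have "0 < ?L'" using f(3) T1 by auto
    have "sim (\<lambda>ys v. outp v = outp u @ ys \<and> cost v \<le> cost u + 200 * ?bb * (length (inp u) + 1))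
      (stream ?K ?L' (inp u)) (exec collect u)"
      by (rule collect_sim[OF u(2,3) bd \<open>0 < ?L'\<close>]) (use f u in \<open>simp_all add: t1_def\<close>)
    moreover have "stream ?K ?L' (inp u) = algo ?T ?T xs" by (simp add: f(6) harvest_def u t1_def)
    moreover have "exec sampler (start_state k xs) = exec collect u" using False by (simp add: e u(1))
    moreover have "cost u + 200 * ?bb * (length (inp u) + 1) \<le> 700 * ?bb * (length xs + 1)"
    proof -
      have i: "inp u = inp t" by (simp add: u t1_def)
      have "200 * ?bb * (length (inp u) + 1) = 200 * ?bb * length (inp t) + 200 * ?bb" unfolding i by (simp add: algebra_simps)
      then have "cost u + 200 * ?bb * (length (inp u) + 1) \<le> 700 * Q" using tQ ct1 u(7) Q sq by linarith
      then show ?thesis by (simp add: Q_def algebra_simps)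
    qed
    ultimately show ?thesis using t(3) u(6) by (auto simp: t1_def elim!: sim_mono)
  qed
qed

section \<open>Distance from independent samples and lower tail\<close>

text \<open>The pools that \<open>screen\<close> consults, one for each item. They are distinct, so
  a ball serves at most one item.\<close>

primrec keys :: "nat list \<Rightarrow> nat list \<Rightarrow> (nat \<times> nat) list" where
  "keys pre [] = []"
| "keys pre (x # xs) = (x, Suc (count_list pre x)) # keys (pre @ [x]) xs"

lemma keys_bounds: "(x, j) \<in> set (keys pre xs) \<Longrightarrow> count_list pre x < j \<and> j \<le> count_list pre x + count_list xs x"
proof (induction xs arbitrary: pre)
  case (Cons y xs)
  from Cons.prems Cons.IH[of "pre @ [y]"] show ?case by (auto split: if_splits)
qed simp

lemma distinct_keys: "distinct (keys pre xs)"
  by (induction xs arbitrary: pre) (auto dest!: keys_bounds)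

lemma map_fst_keys: "map fst (keys pre xs) = xs"
  by (induction xs arbitrary: pre) auto

lemma exp_minus_le_half:
  fixes y :: real
  assumes "0 \<le> y" "y \<le> 1"
  shows "exp (- y) \<le> 1 - y / 2"
proof -
  have "exp (- y) = 1 / exp y" by (simp add: exp_minus field_simps)
  also have "\<dots> \<le> 1 / (1 + y)"
    using assms exp_ge_add_one_self[of y] by (intro divide_left_mono) auto
  also have "\<dots> \<le> 1 - y / 2"
  proof -
    have "y * y \<le> y * 1" using assms by (intro mult_left_mono)
    then have "1 \<le> (1 - y / 2) * (1 + y)" by (simp add: algebra_simps)
    then show ?thesis using assms by (simp add: divide_le_eq)
  qed
  finally show ?thesis .
qed

text \<open>An item accepted with probability \<open>\<theta>\<close> contributes the factor
  \<open>1 - \<theta> / 2\<close>, at most \<open>exp (- \<theta> / 2)\<close>. The bound on the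
  counts makes every coin linear.\<close>

lemma E_screen_half:
  assumes K: "K > 0" and ok: "\<And>k. count M k \<le> K"
  shows "E (screen K M pre xs) (\<lambda>os. (1/2) ^ length (somes os)) \<le>
    exp (- (\<Sum>k\<leftarrow>keys pre xs. real (count M k)) / (2 * real K))"
proof (induction xs arbitrary: pre)
  case (Cons x xs)
  let ?k = "(x, Suc (count_list pre x))"
  let ?\<theta> = "real (count M ?k) / K"
  let ?R = "E (screen K M (pre @ [x]) xs) (\<lambda>os. (1/2) ^ length (somes os))"
  have R0: "0 \<le> ?R" by (intro E_ge0) auto
  have "E (screen K M pre (x # xs)) (\<lambda>os. (1/2) ^ length (somes os)) = ?\<theta> * (1/2 * ?R) + (1 - ?\<theta>) * ?R"
    using ok[of ?k] by (simp add: E_bind E_coin[OF K])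
  also have "\<dots> = (1 - ?\<theta> / 2) * ?R" by (simp add: algebra_simps)
  also have "\<dots> \<le> exp (- ?\<theta> / 2) * ?R"
    using exp_ge_add_one_self[of "- ?\<theta> / 2"] by (intro mult_right_mono R0) simp
  also have "\<dots> \<le> exp (- ?\<theta> / 2) * exp (- (\<Sum>k\<leftarrow>keys (pre @ [x]) xs. real (count M k)) / (2 * real K))"
    by (intro mult_left_mono Cons.IH) simp
  also have "\<dots> = exp (- (\<Sum>k\<leftarrow>keys pre (x # xs). real (count M k)) / (2 * real K))"
    by (simp add: add_divide_distrib diff_divide_distrib flip: exp_add)
  finally show ?case .
qed simp

lemma sum_count_list_swap: "(\<Sum>k\<leftarrow>ks. real (count_list bs k)) = (\<Sum>b\<leftarrow>bs. real (count_list ks b))"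
  for ks :: "'a list"
proof (induction ks)
  case (Cons k ks)
  have "(\<Sum>b\<leftarrow>bs. real (count_list (k # ks) b)) = real (count_list bs k) + (\<Sum>b\<leftarrow>bs. real (count_list ks b))"
    by (induction bs) auto
  with Cons show ?case by simp
qed (induction bs; simp)

lemma exp_sum_list: "exp (- (\<Sum>b\<leftarrow>bs. f b) / (c::real)) = prod_list (map (\<lambda>b. exp (- f b / c)) bs)"
proof (induction bs)
  case (Cons b bs)
  have "- (\<Sum>b\<leftarrow>b # bs. f b) / c = - f b / c + - (\<Sum>b\<leftarrow>bs. f b) / c"
    by (simp add: add_divide_distrib diff_divide_distrib)
  with Cons show ?case by (simp only: exp_add) simp
qed simp

lemma count_list_distinct: "distinct xs \<Longrightarrow> count_list xs x \<le> 1"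
  by (induction xs) (auto simp: count_list_0_iff)

text \<open>Counting from the side of the balls turns the sum over keys into a sum of independent
  terms, each at most 1 as keys are distinct. No multiplicity exceeds \<open>K\<close>, so every key
  is a genuine pool, hit by a ball with probability \<open>pmf p x / K\<close>; the
  \<open>K * L\<close> balls turn \<open>S / (4 * K * K)\<close> into
  \<open>L * S / (4 * K)\<close>, where \<open>S\<close> is the sum of \<open>pmf p x\<close> over
  \<open>T\<close>.\<close>

lemma E_balls_exp:
  assumes K: "K > 0" and p: "finite (set_pmf p)" and T: "\<And>x. count_list T x \<le> K"
  shows "E (replicate_pmf (K * L) (balls K p)) (\<lambda>bs. exp (- (\<Sum>k\<leftarrow>keys [] T. real (count_list bs k)) / (2 * real K)))
    \<le> exp (- (\<Sum>x\<leftarrow>T. real L * pmf p x) / (4 * real K))"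
proof -
  let ?\<beta> = "balls K p"
  have fin: "finite (set_pmf ?\<beta>)" using assms by simp
  have c1: "count_list (keys [] T) b \<le> 1" for b
    by (intro count_list_distinct distinct_keys)
  let ?S = "\<Sum>x\<leftarrow>T. pmf p x"
  have sum: "E ?\<beta> (\<lambda>b. real (count_list ks b)) = (\<Sum>k\<leftarrow>ks. pmf ?\<beta> k)" for ks
  proof (induction ks)
    case (Cons k ks)
    have "E ?\<beta> (\<lambda>b. real (count_list (k # ks) b)) = E ?\<beta> (\<lambda>b. of_bool (b = k) + real (count_list ks b))"
      by (intro E_cong) auto
    also have "\<dots> = pmf ?\<beta> k + (\<Sum>k\<leftarrow>ks. pmf ?\<beta> k)"
      using fin Cons by (simp add: E_add E_indicator measure_pmf_single)
    finally show ?case by simp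
  qed simp
  have "(\<Sum>k\<leftarrow>keys [] T. pmf ?\<beta> k) = (\<Sum>k\<leftarrow>keys [] T. pmf p (fst k) / K)"
  proof (intro arg_cong[of _ _ sum_list] map_cong refl)
    fix k assume "k \<in> set (keys [] T)"
    moreover obtain x j where kj: "k = (x, j)" by (cases k)
    ultimately have k: "k = (x, j)" "0 < j" "j \<le> count_list T x"
      using keys_bounds[of x j "[]" T] by simp_all
    then have "j \<le> K" using T[of x] by simp
    with k K show "pmf ?\<beta> k = pmf p (fst k) / K" by (simp add: pmf_balls)
  qed
  also have "\<dots> = (\<Sum>x\<leftarrow>map fst (keys [] T). pmf p x) / K"
    by (simp add: divide_inverse sum_list_mult_const o_def)
  finally have sum2: "(\<Sum>k\<leftarrow>keys [] T. pmf ?\<beta> k) = ?S / K" by (simp add: map_fst_keys)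
  have "E ?\<beta> (\<lambda>b. exp (- real (count_list (keys [] T) b) / (2 * real K))) \<le>
      E ?\<beta> (\<lambda>b. 1 - (1 / (4 * real K)) * real (count_list (keys [] T) b))"
  proof (intro E_mono fin)
    fix b
    have "exp (- (real (count_list (keys [] T) b) / (2 * real K))) \<le> 1 - (real (count_list (keys [] T) b) / (2 * real K)) / 2"
      using K c1[of b] by (intro exp_minus_le_half) (auto simp: divide_le_eq)
    then show "exp (- real (count_list (keys [] T) b) / (2 * real K)) \<le> 1 - (1 / (4 * real K)) * real (count_list (keys [] T) b)"
      by simp
  qed
  also have "\<dots> = 1 - ?S / (4 * real K * real K)"
    unfolding E_diff[OF fin] E_const integral_mult_right_zero sum sum2 by (simp add: field_simps)
  also have "\<dots> \<le> exp (- ?S / (4 * real K * real K))"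
    using exp_ge_add_one_self[of "- ?S / (4 * real K * real K)"] by simp
  finally have one: "E ?\<beta> (\<lambda>b. exp (- real (count_list (keys [] T) b) / (2 * real K))) \<le> exp (- ?S / (4 * real K * real K))" .
  have "E (replicate_pmf (K * L) ?\<beta>) (\<lambda>bs. exp (- (\<Sum>k\<leftarrow>keys [] T. real (count_list bs k)) / (2 * real K)))
      = E ?\<beta> (\<lambda>b. exp (- real (count_list (keys [] T) b) / (2 * real K))) ^ (K * L)"
    by (subst sum_count_list_swap) (simp only: exp_sum_list, rule E_replicate_prod[OF fin])
  also have "\<dots> \<le> exp (- ?S / (4 * real K * real K)) ^ (K * L)"
    by (intro power_mono one E_ge0) auto
  also have "\<dots> = exp (- (\<Sum>x\<leftarrow>T. real L * pmf p x) / (4 * real K))"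
    using K by (simp add: sum_list_const_mult field_simps flip: exp_of_nat_mult)
  finally show ?thesis .
qed

text \<open>Now the items are averaged out: the mean of \<open>pmf p x\<close> under
  \<open>p\<close> is the collision probability. The hypothesis on \<open>L\<close> keeps the
  exponent in the range of \<open>exp_minus_le_half\<close>.\<close>

lemma E_sample_exp:
  fixes K :: nat
  assumes K: "K > 0" and p: "finite (set_pmf p)" and L: "\<And>x. real L * pmf p x \<le> 4 * real K"
  shows "E (replicate_pmf L p) (\<lambda>T. exp (- (\<Sum>x\<leftarrow>T. real L * pmf p x) / (4 * real K)))
    \<le> exp (- (real L)\<^sup>2 * (\<Sum>x\<in>set_pmf p. (pmf p x)\<^sup>2) / (8 * real K))"
proof -
  let ?pc = "\<Sum>x\<in>set_pmf p. (pmf p x)\<^sup>2"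
  have pc: "E p (pmf p) = ?pc" using p by (simp add: E_sum_set power2_eq_square)
  have "E p (\<lambda>x. exp (- (real L * pmf p x) / (4 * real K))) \<le> E p (\<lambda>x. 1 - (real L / (8 * real K)) * pmf p x)"
  proof (intro E_mono p)
    fix x
    have "exp (- ((real L * pmf p x) / (4 * real K))) \<le> 1 - ((real L * pmf p x) / (4 * real K)) / 2"
      using K L[of x] by (intro exp_minus_le_half) (auto simp: divide_le_eq)
    then show "exp (- (real L * pmf p x) / (4 * real K)) \<le> 1 - (real L / (8 * real K)) * pmf p x" by simp
  qed
  also have "\<dots> = 1 - real L * ?pc / (8 * real K)"
    unfolding E_diff[OF p] E_const integral_mult_right_zero pc by simp
  also have "\<dots> \<le> exp (- real L * ?pc / (8 * real K))"
    using exp_ge_add_one_self[of "- real L * ?pc / (8 * real K)"] by simp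
  finally have one: "E p (\<lambda>x. exp (- (real L * pmf p x) / (4 * real K))) \<le> exp (- real L * ?pc / (8 * real K))" .
  have "E (replicate_pmf L p) (\<lambda>T. exp (- (\<Sum>x\<leftarrow>T. real L * pmf p x) / (4 * real K)))
      = E p (\<lambda>x. exp (- (real L * pmf p x) / (4 * real K))) ^ L"
    unfolding exp_sum_list by (rule E_replicate_prod[OF p])
  also have "\<dots> \<le> exp (- real L * ?pc / (8 * real K)) ^ L"
    by (intro power_mono one E_ge0) auto
  also have "\<dots> = exp (- (real L)\<^sup>2 * ?pc / (8 * real K))"
    by (simp add: power2_eq_square mult_ac flip: exp_of_nat_mult)
  finally show ?thesis .
qed

section \<open>Closeness and yield of a stream of blocks\<close>

locale source =
  fixes p s :: "nat pmf" and pc :: real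
  assumes finp[simp]: "finite (set_pmf p)"
    and sq: "pmf s x * pc = (pmf p x)\<^sup>2"
    and pc: "pc = (\<Sum>x\<in>set_pmf p. (pmf p x)\<^sup>2)"
begin

lemma pc_pos: "0 < pc"
proof -
  have "0 < (\<Sum>x\<in>set_pmf p. (pmf p x)\<^sup>2)"
    by (intro sum_pos) (auto simp: set_pmf_not_empty set_pmf_iff)
  then show ?thesis by (simp add: pc)
qed

lemma pc_le_1: "pc \<le> 1"
proof -
  have "pc = E p (pmf p)" by (simp add: pc E_sum_set power2_eq_square)
  also have "\<dots> \<le> 1" by (intro E_le) (auto simp: pmf_le_1)
  finally show ?thesis .
qed

lemma fins[simp]: "finite (set_pmf s)"
proof (rule finite_subset[OF _ finp])
  show "set_pmf s \<subseteq> set_pmf p"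
  proof
    fix x assume "x \<in> set_pmf s"
    then have "pmf s x * pc \<noteq> 0" using pc_pos by (simp add: set_pmf_iff)
    then show "x \<in> set_pmf p" by (simp add: sq set_pmf_iff)
  qed
qed

text \<open>What may go wrong in a block, under one \<open>\<delta>\<close>: the expected excess of
  a pool over \<open>K\<close> and too many copies among the other items for closeness, an
  overflowing multiplicity or pool for the yield. The condition on \<open>L * pmf p x\<close> is the
  one of \<open>E_sample_exp\<close>.\<close>

definition reliable :: "nat \<Rightarrow> nat \<Rightarrow> real \<Rightarrow> bool" where
  "reliable K L \<delta> \<longleftrightarrow> 0 < K \<and> 0 < L \<and> 0 \<le> \<delta> \<and> (\<forall>x. real L * pmf p x \<le> 4 * real K) \<and>
    (\<forall>x\<in>set_pmf p. \<forall>j. E (replicate_pmf (K * L) (balls K p))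
        (\<lambda>bs. (real (count_list bs (x, j)) - real (min (count_list bs (x, j)) K)) / K) \<le> \<delta>) \<and>
    (\<forall>x\<in>set_pmf p. \<forall>t\<le>L. measure_pmf.prob (replicate_pmf (t - 1) p) {T. K \<le> count_list T x} \<le> \<delta>) \<and>
    measure_pmf.prob (replicate_pmf L p) {T. \<exists>x. K < count_list T x} \<le> \<delta> \<and>
    measure_pmf.prob (replicate_pmf (K * L) (balls K p)) {bs. \<exists>k. K < count_list bs k} \<le> \<delta>"

text \<open>The loss of one resampling: with \<open>K * L\<close> balls the factor
  \<open>Suc n / (K * K)\<close> of \<open>resample_approx\<close> is \<open>L / K\<close>, and
  \<open>pc\<close> is bounded by 1.\<close>

definition err :: "nat \<Rightarrow> nat \<Rightarrow> real \<Rightarrow> real" where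
  "err K L \<delta> = \<delta> + 2 * (real L / K) * \<delta>"

lemma err_nonneg: "reliable K L \<delta> \<Longrightarrow> 0 \<le> err K L \<delta>"
  by (simp add: reliable_def err_def)

text \<open>Stated for any \<open>t \<le> L\<close> because the last block of a stream may be cut
  short among its items.\<close>

lemma block_near:
  assumes rel: "reliable K L \<delta>" and t: "t \<le> L"
  shows "near_iid s (t * err K L \<delta>) (bind_pmf (replicate_pmf (K * L + t) p) (block K (K * L) []))"
  unfolding near_iid_def
proof (intro allI impI)
  fix g :: "nat list \<Rightarrow> real" assume g: "\<forall>l. 0 \<le> g l \<and> g l \<le> 1"
  have K: "K > 0" and L: "L > 0" and \<delta>: "0 \<le> \<delta>" using rel by (auto simp: reliable_def)
  then obtain n where n: "K * L = Suc n" by (metis gr0_implies_Suc nat_0_less_mult_iff)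
  define D where "D = bind_pmf (replicate_pmf t p)
      (\<lambda>T. bind_pmf (replicate_pmf (Suc n) (balls K p)) (\<lambda>bs. screen K (mset bs) [] T))"
  have law: "bind_pmf (replicate_pmf (K * L + t) p) (block K (K * L) []) = map_pmf somes D"
    unfolding bind_replicate_block D_def n map_bind_pmf by (subst bind_commute_pmf) simp
  have finD: "finite (set_pmf D)" unfolding D_def using K by (auto simp del: replicate_pmf.simps)
  have "\<bar>E D (\<lambda>os. g (somes os)) - E D (\<lambda>os. E (fresh s os) (\<lambda>os. g (somes os)))\<bar> \<le> t * err K L \<delta>"
  proof (rule fresh_approx[OF finD fins])
    fix os assume "os \<in> set_pmf D"
    then show "length os = t"
      by (auto simp: D_def set_replicate_pmf length_screen simp del: replicate_pmf.simps)
  next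
    fix i and g :: "nat option list \<Rightarrow> real"
    assume i: "i < t" and g: "\<And>os. 0 \<le> g os \<and> g os \<le> 1"
    have "\<bar>E D g - E D (\<lambda>os. E (resample s i os) g)\<bar> \<le> \<delta> + 2 * (Suc n / (real K * real K)) * pc * \<delta>"
      unfolding D_def
      by (rule resample_approx[OF finp fins K i sq])
        (use rel t g in \<open>auto simp: reliable_def n[symmetric] simp del: of_nat_min\<close>)
    also have "Suc n / (real K * real K) = real L / K"
      using K by (simp add: n[symmetric] del: of_nat_Suc)
    also have "\<delta> + 2 * (real L / K) * pc * \<delta> \<le> err K L \<delta>"
      using mult_left_mono[OF pc_le_1, of "2 * (real L / K) * \<delta>"] \<delta> by (simp add: err_def mult_ac)
    finally show "\<bar>E D g - E D (\<lambda>os. E (resample s i os) g)\<bar> \<le> err K L \<delta>" .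
  qed (use g in auto)
  moreover have "E (fresh s os) (\<lambda>os. g (somes os)) = E (replicate_pmf (length (somes os)) s) g" for os
    unfolding map_somes_fresh[symmetric] by simp
  ultimately show "\<bar>E (bind_pmf (replicate_pmf (K * L + t) p) (block K (K * L) [])) g -
      E (bind_pmf (replicate_pmf (K * L + t) p) (block K (K * L) [])) (\<lambda>l. E (replicate_pmf (length l) s) g)\<bar>
      \<le> t * err K L \<delta>"
    unfolding law by simp
qed

text \<open>On an overflow \<open>F\<close> is bounded by 1, and the two overflow events cost
  \<open>\<delta>\<close> each. Otherwise the coins are linear, and the exponential averages over
  the balls and then over the items apply.\<close>

lemma block_decays:
  assumes rel: "reliable K L \<delta>"
  shows "decays (bind_pmf (replicate_pmf (K * L + L) p) (block K (K * L) []))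
    (exp (- (real L)\<^sup>2 * pc / (8 * real K))) (2 * \<delta>)"
  unfolding decays_def
proof (intro allI impI)
  fix F :: "nat list \<Rightarrow> real" and c d :: real
  assume cd: "0 \<le> c" "0 \<le> d"
    and F: "\<forall>l. 0 \<le> F l \<and> F l \<le> 1 \<and> F l \<le> d + c * (1/2) ^ length l"
  have K: "K > 0" and \<delta>: "0 \<le> \<delta>" using rel by (auto simp: reliable_def)
  let ?Bs = "replicate_pmf (K * L) (balls K p)" and ?Ts = "replicate_pmf L p"
  have fin[simp]: "finite (set_pmf ?Bs)" "finite (set_pmf ?Ts)" using K by auto
  let ?b1 = "\<lambda>T::nat list. of_bool (\<exists>x. K < count_list T x) :: real"
  let ?b2 = "\<lambda>bs::(nat \<times> nat) list. of_bool (\<exists>k. K < count_list bs k) :: real"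
  let ?w = "\<lambda>T bs. exp (- (\<Sum>k\<leftarrow>keys [] T. real (count_list bs k)) / (2 * real K))"
  have inner: "E (screen K (mset bs) [] T) (\<lambda>os. F (somes os)) \<le>
      d + ?b1 T + ?b2 bs + c * ((1 - ?b1 T) * ?w T bs)" for T bs
  proof (cases "(\<exists>x. K < count_list T x) \<or> (\<exists>k. K < count_list bs k)")
    case True
    have "E (screen K (mset bs) [] T) (\<lambda>os. F (somes os)) \<le> 1" using F by (intro E_le) auto
    moreover have "0 \<le> c * ((1 - ?b1 T) * ?w T bs)" using cd by auto
    moreover have "1 \<le> ?b1 T + ?b2 bs" using True by auto
    ultimately show ?thesis using cd by linarith
  next
    case False
    have "E (screen K (mset bs) [] T) (\<lambda>os. F (somes os)) \<le>
        E (screen K (mset bs) [] T) (\<lambda>os. d + c * (1/2) ^ length (somes os))"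
      using F by (intro E_mono) auto
    also have "\<dots> = d + c * E (screen K (mset bs) [] T) (\<lambda>os. (1/2) ^ length (somes os))"
      by (simp add: E_add)
    also have "\<dots> \<le> d + c * ?w T bs"
      using E_screen_half[OF K, of "mset bs" "[]" T] False cd
      by (intro add_left_mono mult_left_mono) (auto simp: count_mset not_less)
    finally show ?thesis using False by simp
  qed
  have "E (bind_pmf (replicate_pmf (K * L + L) p) (block K (K * L) [])) F =
      E ?Ts (\<lambda>T. E ?Bs (\<lambda>bs. E (screen K (mset bs) [] T) (\<lambda>os. F (somes os))))"
    unfolding bind_replicate_block by (simp add: E_bind E_commute[of ?Bs])
  also have "\<dots> \<le> E ?Ts (\<lambda>T. E ?Bs (\<lambda>bs. d + ?b1 T + ?b2 bs + c * ((1 - ?b1 T) * ?w T bs)))"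
    by (intro E_mono inner) auto
  also have "\<dots> = E ?Ts (\<lambda>T. d + ?b1 T + E ?Bs ?b2 + c * ((1 - ?b1 T) * E ?Bs (?w T)))"
    by (simp add: E_add)
  also have "\<dots> \<le> E ?Ts (\<lambda>T. d + ?b1 T + \<delta> + c * exp (- (\<Sum>x\<leftarrow>T. real L * pmf p x) / (4 * real K)))"
  proof (intro E_mono add_mono mult_left_mono)
    fix T
    show "E ?Bs ?b2 \<le> \<delta>" using rel by (simp add: E_indicator reliable_def)
    show "(1 - ?b1 T) * E ?Bs (?w T) \<le> exp (- (\<Sum>x\<leftarrow>T. real L * pmf p x) / (4 * real K))"
      using E_balls_exp[OF K finp, of T L] by (cases "\<exists>x. K < count_list T x") (auto simp: not_less)
  qed (use cd in auto)
  also have "\<dots> = d + E ?Ts ?b1 + \<delta> + c * E ?Ts (\<lambda>T. exp (- (\<Sum>x\<leftarrow>T. real L * pmf p x) / (4 * real K)))"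
    by (simp add: E_add)
  also have "\<dots> \<le> d + \<delta> + \<delta> + c * exp (- (real L)\<^sup>2 * pc / (8 * real K))"
  proof (intro add_mono mult_left_mono)
    show "E ?Ts ?b1 \<le> \<delta>" using rel by (simp add: E_indicator reliable_def)
    show "E ?Ts (\<lambda>T. exp (- (\<Sum>x\<leftarrow>T. real L * pmf p x) / (4 * real K))) \<le> exp (- (real L)\<^sup>2 * pc / (8 * real K))"
      unfolding pc by (rule E_sample_exp[OF K finp]) (use rel in \<open>simp add: reliable_def\<close>)
  qed (use cd in auto)
  finally show "E (bind_pmf (replicate_pmf (K * L + L) p) (block K (K * L) [])) F
      \<le> d + 2 * \<delta> + c * exp (- (real L)\<^sup>2 * pc / (8 * real K))" by simp
qed

definition "stream_law K L M = bind_pmf (replicate_pmf M p) (stream K L)"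

lemma stream_law_short:
  assumes "M < K * L + L" "K > 0" "L > 0"
  shows "stream_law K L M = bind_pmf (replicate_pmf M p) (block K (K * L) [])"
  unfolding stream_law_def
proof (intro bind_pmf_cong refl)
  fix xs assume "xs \<in> set_pmf (replicate_pmf M p)"
  then have len: "length xs = M" by (simp add: set_replicate_pmf)
  show "stream K L xs = block K (K * L) [] xs"
    by (rule stream_short) (use assms len in simp_all)
qed

lemma stream_law_long:
  assumes "L > 0"
  shows "stream_law K L (K * L + L + M) =
    bind_pmf (bind_pmf (replicate_pmf (K * L + L) p) (block K (K * L) [])) (\<lambda>u. map_pmf ((@) u) (stream_law K L M))"
proof -
  have "stream_law K L (K * L + L + M) = bind_pmf (replicate_pmf (K * L + L) p) (\<lambda>xs. bind_pmf (replicate_pmf M p)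
      (\<lambda>ys. stream K L (xs @ ys)))"
    unfolding stream_law_def replicate_pmf_distrib[of "K * L + L"] by (simp add: bind_assoc_pmf bind_return_pmf)
  also have "\<dots> = bind_pmf (replicate_pmf (K * L + L) p) (\<lambda>xs. bind_pmf (replicate_pmf M p)
      (\<lambda>ys. bind_pmf (block K (K * L) [] xs) (\<lambda>u. map_pmf ((@) u) (stream K L ys))))"
  proof (intro bind_pmf_cong refl)
    fix xs ys assume "xs \<in> set_pmf (replicate_pmf (K * L + L) p)"
    then have "length xs = K * L + L" by (simp add: set_replicate_pmf)
    then show "stream K L (xs @ ys) = bind_pmf (block K (K * L) [] xs) (\<lambda>u. map_pmf ((@) u) (stream K L ys))"
      using assms by (subst stream.simps) auto
  qed
  also have "\<dots> = bind_pmf (replicate_pmf (K * L + L) p) (\<lambda>xs. bind_pmf (block K (K * L) [] xs)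
      (\<lambda>u. bind_pmf (replicate_pmf M p) (\<lambda>ys. map_pmf ((@) u) (stream K L ys))))"
    by (subst (2) bind_commute_pmf) (rule refl)
  finally show ?thesis by (simp add: stream_law_def bind_assoc_pmf map_bind_pmf)
qed

lemma finite_stream_law[simp]: "K > 0 \<Longrightarrow> finite (set_pmf (stream_law K L M))"
  by (simp add: stream_law_def)

text \<open>Each item costs one \<open>err\<close>, and there are no more items than symbols. A
  block cut off among its balls outputs nothing and costs nothing.\<close>

lemma stream_near:
  assumes rel: "reliable K L \<delta>"
  shows "near_iid s (M * err K L \<delta>) (stream_law K L M)"
proof (induction M rule: less_induct)
  case (less M)
  have K: "K > 0" and L: "L > 0" using rel by (auto simp: reliable_def)
  note e0 = err_nonneg[OF rel]
  consider "M < K * L" | "K * L \<le> M" "M < K * L + L" | "K * L + L \<le> M" by linarith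
  then show ?case
  proof cases
    case 1
    have "bind_pmf (replicate_pmf M p) (block K (K * L) []) = bind_pmf (replicate_pmf M p) (\<lambda>_. return_pmf [])"
      using 1 by (intro bind_pmf_cong) (auto simp: set_replicate_pmf block_short)
    then show ?thesis using 1 K L e0 by (simp add: stream_law_short near_iid_return_Nil)
  next
    case 2
    then have M: "M = K * L + (M - K * L)" "M - K * L \<le> L" by auto
    have "near_iid s ((M - K * L) * err K L \<delta>) (stream_law K L M)"
      unfolding stream_law_short[OF 2(2) K L] using block_near[OF rel M(2)] M(1) by metis
    then show ?thesis by (rule near_iid_mono) (intro mult_right_mono e0, simp)
  next
    case 3
    define M' where "M' = M - (K * L + L)"
    have M: "M = K * L + L + M'" using 3 by (simp add: M'_def)
    have "near_iid s (L * err K L \<delta> + M' * err K L \<delta>) (stream_law K L M)"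
      unfolding M stream_law_long[OF L]
      by (rule near_iid_append[OF _ _ fins block_near[OF rel order_refl] less]) (use K L M in auto)
    then show ?thesis
    proof (rule near_iid_mono)
      have "real L + real M' \<le> real M" using M by simp
      from mult_right_mono[OF this e0] show "L * err K L \<delta> + M' * err K L \<delta> \<le> M * err K L \<delta>"
        by (simp add: distrib_right)
    qed
  qed
qed

text \<open>Only \<open>n\<close> full blocks are exploited. The other \<open>r\<close> symbols can
  only lengthen the output, which the trivial bound in the base case expresses.\<close>

lemma stream_decays:
  assumes rel: "reliable K L \<delta>"
  shows "decays (stream_law K L (n * (K * L + L) + r)) (exp (- (real L)\<^sup>2 * pc / (8 * real K)) ^ n) (n * (2 * \<delta>))"
proof (induction n)
  case 0
  then show ?case using rel by (auto simp: reliable_def intro!: decays_trivial)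
next
  case (Suc n)
  have K: "K > 0" and L: "L > 0" and \<delta>: "0 \<le> \<delta>" using rel by (auto simp: reliable_def)
  have "decays (stream_law K L (K * L + L + (n * (K * L + L) + r)))
     (exp (- (real L)\<^sup>2 * pc / (8 * real K)) * exp (- (real L)\<^sup>2 * pc / (8 * real K)) ^ n) (2 * \<delta> + n * (2 * \<delta>))"
    unfolding stream_law_long[OF L]
    by (rule decays_append[OF _ _ block_decays[OF rel] Suc.IH]) (use K \<delta> in auto)
  then show ?case by (simp add: algebra_simps)
qed

end

section \<open>Estimating the maximal probability\<close>

lemma E_count_power:
  fixes c :: real
  assumes "finite (set_pmf q)" "0 < c"
  shows "E (replicate_pmf n q) (\<lambda>xs. c ^ count_list xs y) \<le> exp (n * ((c - 1) * pmf q y))"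
proof -
  let ?f = "\<lambda>x. if x = y then c else 1"
  have pw: "c ^ count_list xs y = prod_list (map ?f xs)" for xs by (induction xs) auto
  have "E q ?f = E q (\<lambda>x. 1 + (c - 1) * of_bool (x = y))" by (intro E_cong) auto
  also have "\<dots> = 1 + (c - 1) * pmf q y"
    using assms by (simp add: E_add E_indicator measure_pmf_single)
  also have "\<dots> \<le> exp ((c - 1) * pmf q y)" by (rule exp_ge_add_one_self)
  finally have "E q ?f ^ n \<le> exp ((c - 1) * pmf q y) ^ n"
    using assms by (intro power_mono E_ge0) auto
  then show ?thesis unfolding pw E_replicate_prod[OF assms(1)] by (simp add: exp_of_nat_mult)
qed

lemma prob_le_E:
  assumes "finite (set_pmf P)" "\<And>x. x \<in> set_pmf P \<Longrightarrow> 0 \<le> f x" "\<And>x. x \<in> set_pmf P \<Longrightarrow> Q x \<Longrightarrow> 1 \<le> f x"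
  shows "measure_pmf.prob P {x. Q x} \<le> E P f"
  unfolding E_indicator[symmetric] using assms by (intro E_mono) auto

text \<open>Chernoff's bound with base 2: \<open>a\<close> is at least twice the mean, and the
  exponent \<open>a / 2 - a * ln 2\<close> is at most \<open>- a / 8\<close> because
  \<open>ln 2 \<ge> 5 / 8\<close>.\<close>

lemma upper_tail:
  assumes "finite (set_pmf q)" "real n * pmf q y \<le> real a / 2"
  shows "measure_pmf.prob (replicate_pmf n q) {xs. a \<le> count_list xs y} \<le> exp (- real a / 8)"
proof -
  have "measure_pmf.prob (replicate_pmf n q) {xs. a \<le> count_list xs y} \<le>
      E (replicate_pmf n q) (\<lambda>xs. 2 ^ count_list xs y / 2 ^ a)"
    using assms by (intro prob_le_E) auto
  also have "\<dots> = E (replicate_pmf n q) (\<lambda>xs. 2 ^ count_list xs y) / 2 ^ a" by simp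
  also have "\<dots> \<le> exp (n * ((2 - 1) * pmf q y)) / 2 ^ a"
    by (intro divide_right_mono E_count_power assms) auto
  also have "\<dots> \<le> exp (real a / 2) / 2 ^ a"
    using assms by (intro divide_right_mono) auto
  also have "(2::real) ^ a = exp (real a * ln 2)" by (simp add: exp_of_nat_mult)
  also have "exp (real a / 2) / exp (real a * ln 2) = exp (real a / 2 - real a * ln 2)" by (simp add: exp_diff)
  also have "\<dots> \<le> exp (- real a / 8)"
  proof -
    have "real a * (5 / 8) \<le> real a * ln 2" using ln2_ge_two_thirds by (intro mult_left_mono) auto
    then show ?thesis by simp
  qed
  finally show ?thesis .
qed

text \<open>Chernoff's bound with base 1/2: the mean is at least \<open>2 * a\<close>, and the
  exponent \<open>a * ln 2 - a\<close> is at most \<open>- a / 4\<close> because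
  \<open>ln 2 \<le> 3 / 4\<close>.\<close>

lemma lower_tail:
  assumes "finite (set_pmf q)" "2 * real a \<le> real n * pmf q y"
  shows "measure_pmf.prob (replicate_pmf n q) {xs. count_list xs y < a} \<le> exp (- real a / 4)"
proof -
  have "measure_pmf.prob (replicate_pmf n q) {xs. count_list xs y < a} \<le>
      E (replicate_pmf n q) (\<lambda>xs. 2 ^ a * (1/2) ^ count_list xs y)"
  proof (intro prob_le_E)
    fix xs assume "count_list xs y < a"
    then have "(2::real) ^ a * (1/2) ^ count_list xs y = 2 ^ (a - count_list xs y)"
      by (simp add: power_diff power_one_over field_simps)
    then show "(1::real) \<le> 2 ^ a * (1/2) ^ count_list xs y" by simp
  qed (use assms in auto)
  also have "\<dots> = 2 ^ a * E (replicate_pmf n q) (\<lambda>xs. (1/2) ^ count_list xs y)" by simp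
  also have "\<dots> \<le> 2 ^ a * exp (n * ((1/2 - 1) * pmf q y))"
    by (intro mult_left_mono E_count_power assms) auto
  also have "\<dots> \<le> 2 ^ a * exp (- real a)"
    using assms by (intro mult_left_mono) auto
  also have "(2::real) ^ a = exp (real a * ln 2)" by (simp add: exp_of_nat_mult)
  also have "exp (real a * ln 2) * exp (- real a) = exp (real a * ln 2 - real a)" by (simp add: exp_diff exp_minus field_simps)
  also have "\<dots> \<le> exp (- real a / 4)"
  proof -
    have "real a * ln 2 \<le> real a * (3 / 4)" using ln2_le_25_over_36 by (intro mult_left_mono) auto
    then show ?thesis by simp
  qed
  finally show ?thesis .
qed

lemma prob_ex_count_le:
  fixes \<epsilon> :: real
  assumes "finite A" "\<And>x. x \<in> A \<Longrightarrow> measure_pmf.prob (replicate_pmf n q) {xs. a \<le> count_list xs x} \<le> \<epsilon>"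
    "set_pmf q \<subseteq> A" "0 < a"
  shows "measure_pmf.prob (replicate_pmf n q) {xs. \<exists>x. a \<le> count_list xs x} \<le> card A * \<epsilon>"
proof -
  have "measure_pmf.prob (replicate_pmf n q) {xs. \<exists>x. a \<le> count_list xs x} \<le>
      measure_pmf.prob (replicate_pmf n q) (\<Union>x\<in>A. {xs. a \<le> count_list xs x})"
  proof (rule measure_pmf.finite_measure_mono_AE)
    show "AE xs in replicate_pmf n q. xs \<in> {xs. \<exists>x. a \<le> count_list xs x} \<longrightarrow> xs \<in> (\<Union>x\<in>A. {xs. a \<le> count_list xs x})"
    proof (intro AE_pmfI impI)
      fix xs assume xs: "xs \<in> set_pmf (replicate_pmf n q)" "xs \<in> {xs. \<exists>x. a \<le> count_list xs x}"
      then obtain x where x: "a \<le> count_list xs x" by auto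
      with assms(4) have "x \<in> set xs" by (metis count_list_0_iff le_zero_eq neq0_conv)
      then have "x \<in> A" using xs(1) assms(3) by (auto simp: set_replicate_pmf lists_def)
      with x show "xs \<in> (\<Union>x\<in>A. {xs. a \<le> count_list xs x})" by auto
    qed
  qed simp
  also have "\<dots> \<le> (\<Sum>x\<in>A. measure_pmf.prob (replicate_pmf n q) {xs. a \<le> count_list xs x})"
    by (rule measure_pmf.finite_measure_subadditive_finite[OF assms(1)]) simp
  also have "\<dots> \<le> (\<Sum>x\<in>A. \<epsilon>)" by (intro sum_mono assms(2))
  finally show ?thesis by simp
qed

section \<open>Reliable parameters and the outcome of the search\<close>

definition okay :: "'a pmf \<Rightarrow> nat \<Rightarrow> real \<Rightarrow> 'a list pmf \<Rightarrow> bool" where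
  "okay s n \<epsilon> D \<longleftrightarrow> near_iid s \<epsilon> D \<and> measure_pmf.prob D {l. length l < n} \<le> \<epsilon>"

lemma okay_mono: "okay s n \<epsilon> D \<Longrightarrow> \<epsilon> \<le> \<epsilon>' \<Longrightarrow> okay s n \<epsilon>' D"
  by (auto simp: okay_def intro: near_iid_mono)

lemma okay_bind:
  assumes fin: "finite (set_pmf P)" "\<And>x. x \<in> set_pmf P \<Longrightarrow> finite (set_pmf (D x))" "finite (set_pmf s)"
    and okay: "\<And>x. x \<in> set_pmf P \<Longrightarrow> x \<notin> B \<Longrightarrow> okay s n \<epsilon> (D x)" and \<epsilon>: "0 \<le> \<epsilon>" and B: "measure_pmf.prob P B \<le> \<tau>"
  shows "okay s n (\<epsilon> + \<tau>) (bind_pmf P D)"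
  unfolding okay_def
proof
  have "near_iid s (\<epsilon> + measure_pmf.prob P B) (bind_pmf P D)"
    using okay by (intro near_iid_bind fin \<epsilon>) (auto simp: okay_def)
  then show "near_iid s (\<epsilon> + \<tau>) (bind_pmf P D)" by (rule near_iid_mono) (use B in simp)
  have "measure_pmf.prob (bind_pmf P D) {l. length l < n} = E P (\<lambda>x. measure_pmf.prob (D x) {l. length l < n})"
    by (simp add: E_bind fin flip: E_indicator)
  also have "\<dots> \<le> E P (\<lambda>x. \<epsilon> + of_bool (x \<in> B))"
  proof (rule E_mono[OF fin(1)])
    fix x assume x: "x \<in> set_pmf P"
    have "measure_pmf.prob (D x) {l. length l < n} \<le> 1" by simp
    then have "measure_pmf.prob (D x) {l. length l < n} \<le> \<epsilon> + 1" using \<epsilon> by linarith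
    then show "measure_pmf.prob (D x) {l. length l < n} \<le> \<epsilon> + of_bool (x \<in> B)"
      using okay[OF x] \<epsilon> by (cases "x \<in> B") (auto simp: okay_def)
  qed
  also have "\<dots> = \<epsilon> + measure_pmf.prob P B" by (simp add: E_add fin E_indicator)
  finally show "measure_pmf.prob (bind_pmf P D) {l. length l < n} \<le> \<epsilon> + \<tau>" using B by simp
qed

locale sized_source = source +
  fixes N :: nat and pm :: real
  assumes supp: "set_pmf p \<subseteq> {1..N}"
    and pm_le: "pmf p x \<le> pm" and pm_ex: "\<exists>x. pmf p x = pm"
begin

lemma pm_pos: "0 < pm"
proof -
  obtain x where "x \<in> set_pmf p" using set_pmf_not_empty[of p] by blast
  then have "0 < pmf p x" by (simp add: set_pmf_iff)
  with pm_le[of x] show ?thesis by linarith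
qed

lemma pm_le_1: "pm \<le> 1" using pm_ex pmf_le_1 by metis

lemma N_pos: "1 \<le> N" using supp set_pmf_not_empty[of p] by auto

lemma pm_sq_le: "pm\<^sup>2 \<le> pc"
proof -
  obtain x where x: "pmf p x = pm" using pm_ex by blast
  then have "x \<in> set_pmf p" using pm_pos by (simp add: set_pmf_iff)
  then have "(pmf p x)\<^sup>2 \<le> pc" unfolding pc by (intro member_le_sum) auto
  then show ?thesis by (simp add: x)
qed

text \<open>With one ball and one item there are no other items and no count exceeds 1, so nothing
  can overflow and the error is 0.\<close>

lemma reliable_pairing: "reliable 1 1 0"
proof -
  have one: "count_list xs x \<le> 1" if "xs \<in> set_pmf (replicate_pmf 1 q)" for q and xs :: "'b list" and x
  proof -
    have "length xs = 1" using that by (simp only: set_replicate_pmf mem_Collect_eq)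
    with count_le_length[of xs x] show ?thesis by simp
  qed
  have f1: "E (replicate_pmf (1 * 1) (balls 1 p)) (\<lambda>bs. (real (count_list bs (x, j)) - real (min (count_list bs (x, j)) 1)) / real 1) = 0" for x j
  proof -
    have "E (replicate_pmf (1 * 1) (balls 1 p)) (\<lambda>bs. (real (count_list bs (x, j)) - real (min (count_list bs (x, j)) 1)) / real 1) =
        E (replicate_pmf (1 * 1) (balls 1 p)) (\<lambda>_. 0)"
    proof (rule E_cong)
      fix bs assume "bs \<in> set_pmf (replicate_pmf (1 * 1) (balls 1 p))"
      then have "count_list bs (x, j) \<le> 1" unfolding mult_1 by (rule one)
      then show "(real (count_list bs (x, j)) - real (min (count_list bs (x, j)) 1)) / real 1 = 0"
        by (simp only: min_absorb1) simp
    qed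
    then show ?thesis by simp
  qed
  have f2: "measure_pmf.prob (replicate_pmf (t - 1) p) {T. 1 \<le> count_list T x} \<le> 0" if "t \<le> 1" for x t
  proof -
    have "t - 1 = 0" using that by simp
    show ?thesis unfolding \<open>t - 1 = 0\<close> by simp
  qed
  have f3: "measure_pmf.prob (replicate_pmf 1 q) {xs. \<exists>x. 1 < count_list xs x} \<le> 0" for q :: "'b pmf"
  proof -
    have "set_pmf (replicate_pmf 1 q) \<inter> {xs. \<exists>x. 1 < count_list xs x} = {}"
    proof (rule equals0I)
      fix xs assume xs: "xs \<in> set_pmf (replicate_pmf 1 q) \<inter> {xs. \<exists>x. 1 < count_list xs x}"
      then obtain x where "1 < count_list xs x" by blast
      moreover have "count_list xs x \<le> 1" by (rule one[of _ q]) (use xs in blast)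
      ultimately show False by linarith
    qed
    then have "measure_pmf.prob (replicate_pmf 1 q) {xs. \<exists>x. 1 < count_list xs x} = 0"
      by (rule measure_pmf_zero_iff[THEN iffD2])
    then show ?thesis by linarith
  qed
  have f4: "real 1 * pmf p x \<le> 4 * real 1" for x using pmf_le_1[of p x] by simp
  have f3': "measure_pmf.prob (replicate_pmf (1 * 1) (balls 1 p)) {bs. \<exists>k. 1 < count_list bs k} \<le> 0"
    unfolding mult_1 by (rule f3)
  show ?thesis
    unfolding reliable_def f1 by (intro conjI allI ballI impI f2 f3 f3' f4 order_refl zero_less_one)
qed

text \<open>All means are at most \<open>4 * T = K / 2\<close>, so a count reaches \<open>K\<close>
  with probability at most \<open>exp (- K / 8) = exp (- T)\<close>. The factor \<open>N * K\<close>
  counts pairs of an element and a pool, and \<open>L\<close> bounds the excess of a pool divided by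
  \<open>K\<close>.\<close>

lemma reliable_pools:
  assumes T: "0 < T" and L: "0 < L" "real L * pm \<le> 4 * T"
  shows "reliable (8 * T) L ((N * (8 * T) + L) * exp (- real T))"
proof -
  define K where "K = 8 * T"
  define e where "e = exp (- real T)"
  have K: "0 < K" "real L * pm \<le> real K / 2" "exp (- real K / 8) = e" using T L by (simp_all add: K_def e_def)
  let ?\<delta> = "(N * K + L) * e"
  have e: "0 < e" by (simp add: e_def)
  have N: "1 \<le> real N" using N_pos by simp
  have fb: "finite (set_pmf (balls K p))" using K by simp
  have Lp: "real L * pmf p x \<le> real K / 2" for x
    using mult_left_mono[OF pm_le[of x], of "real L"] K(2) by simp
  have mb: "real (K * L) * pmf (balls K p) k \<le> real K / 2" for k
  proof -
    have "real (K * L) * pmf (balls K p) k \<le> real L * pmf p (fst k)" using K(1) by (cases k) (simp add: pmf_balls)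
    with Lp[of "fst k"] show ?thesis by linarith
  qed
  have ut: "measure_pmf.prob (replicate_pmf (K * L) (balls K p)) {bs. K \<le> count_list bs k} \<le> e" for k
    using upper_tail[OF fb mb] K(3) by simp
  have uT: "measure_pmf.prob (replicate_pmf t p) {T. K \<le> count_list T x} \<le> e" if "t \<le> L" for t x
  proof -
    have "real t * pmf p x \<le> real L * pmf p x" using that by (intro mult_right_mono) auto
    then show ?thesis using upper_tail[OF finp, of t x K] Lp[of x] K(3) by simp
  qed
  have ge: "e \<le> ?\<delta>" "L * e \<le> ?\<delta>" "N * e \<le> ?\<delta>" "N * K * e \<le> ?\<delta>"
  proof -
    have "1 \<le> N * K" using N_pos K(1) by (simp add: Suc_leI)
    then have "1 \<le> real (N * K + L)" by linarith
    then show "e \<le> ?\<delta>" using e by simp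
    have "N * 1 \<le> N * K" using K(1) by (intro mult_left_mono) auto
    then have "real N \<le> real (N * K + L)" by linarith
    then show "N * e \<le> ?\<delta>" using e by (intro mult_right_mono) auto
  qed (use e in \<open>auto intro!: mult_right_mono\<close>)
  have "E (replicate_pmf (K * L) (balls K p)) (\<lambda>bs. (real (count_list bs k) - real (min (count_list bs k) K)) / real K) \<le> ?\<delta>" for k
  proof -
    have "E (replicate_pmf (K * L) (balls K p)) (\<lambda>bs. (real (count_list bs k) - real (min (count_list bs k) K)) / real K) \<le>
        E (replicate_pmf (K * L) (balls K p)) (\<lambda>bs. real L * of_bool (K \<le> count_list bs k))"
    proof (intro E_mono)
      fix bs assume "bs \<in> set_pmf (replicate_pmf (K * L) (balls K p))"
      then have "count_list bs k \<le> K * L" using count_le_length[of bs k] by (simp add: set_replicate_pmf)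
      then have "real (count_list bs k) \<le> real K * real L" by (metis of_nat_le_iff of_nat_mult)
      then show "(real (count_list bs k) - real (min (count_list bs k) K)) / real K \<le> real L * of_bool (K \<le> count_list bs k)"
        using K(1) by (auto simp: min_def divide_le_eq mult.commute)
    qed (use fb in simp)
    also have "\<dots> = L * measure_pmf.prob (replicate_pmf (K * L) (balls K p)) {bs. K \<le> count_list bs k}"
      by (simp add: E_indicator)
    also have "\<dots> \<le> L * e" by (intro mult_left_mono ut) simp
    finally show ?thesis using ge by linarith
  qed
  moreover have "measure_pmf.prob (replicate_pmf (t - 1) p) {T. K \<le> count_list T x} \<le> ?\<delta>" if "t \<le> L" for t x
    by (rule order_trans[OF uT ge(1)]) (use that in simp)
  moreover have "measure_pmf.prob (replicate_pmf L p) {T. \<exists>x. K < count_list T x} \<le> ?\<delta>"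
  proof -
    have "measure_pmf.prob (replicate_pmf L p) {T. \<exists>x. K < count_list T x} \<le> measure_pmf.prob (replicate_pmf L p) {T. \<exists>x. K \<le> count_list T x}"
      by (intro measure_pmf.finite_measure_mono) (auto intro: less_imp_le)
    also have "\<dots> \<le> card {1..N} * e" by (rule prob_ex_count_le) (use uT K supp in auto)
    finally show ?thesis using ge by simp
  qed
  moreover have "measure_pmf.prob (replicate_pmf (K * L) (balls K p)) {bs. \<exists>k. K < count_list bs k} \<le> ?\<delta>"
  proof -
    have "measure_pmf.prob (replicate_pmf (K * L) (balls K p)) {bs. \<exists>k. K < count_list bs k} \<le>
        measure_pmf.prob (replicate_pmf (K * L) (balls K p)) {bs. \<exists>k. K \<le> count_list bs k}"
      by (intro measure_pmf.finite_measure_mono) (auto intro: less_imp_le)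
    also have "\<dots> \<le> card ({1..N} \<times> {1..K}) * e"
      by (rule prob_ex_count_le) (use ut K supp in \<open>auto simp: balls_def\<close>)
    finally show ?thesis using ge by (simp add: card_cartesian_product)
  qed
  moreover have "real L * pmf p x \<le> 4 * real K" for x using Lp[of x] by simp
  ultimately show ?thesis
    using K(1) L(1) e unfolding reliable_def K_def[symmetric] e_def[symmetric] by auto
qed

definition "algo_law T L M = bind_pmf (replicate_pmf M p) (algo T L)"
definition "harvest_law T L M = bind_pmf (replicate_pmf M p) (harvest T L)"

lemma finite_laws[simp]:
  "0 < T \<Longrightarrow> finite (set_pmf (algo_law T L M))" "0 < T \<Longrightarrow> finite (set_pmf (harvest_law T L M))"
  by (simp_all add: algo_law_def harvest_law_def)

lemma algo_law_step:
  assumes "0 < L"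
  shows "algo_law T L (L + M) = bind_pmf (replicate_pmf L p) (\<lambda>xs. if hit T xs then harvest_law T L M else algo_law T (2 * L) M)"
proof -
  have "algo_law T L (L + M) = bind_pmf (replicate_pmf L p) (\<lambda>xs. bind_pmf (replicate_pmf M p) (\<lambda>ys. algo T L (xs @ ys)))"
    unfolding algo_law_def replicate_pmf_distrib by (simp add: bind_assoc_pmf bind_return_pmf)
  also have "\<dots> = bind_pmf (replicate_pmf L p) (\<lambda>xs. bind_pmf (replicate_pmf M p)
      (\<lambda>ys. if hit T xs then harvest T L ys else algo T (2 * L) ys))"
  proof (intro bind_pmf_cong refl)
    fix xs ys assume "xs \<in> set_pmf (replicate_pmf L p)"
    then have "length xs = L" by (simp add: set_replicate_pmf)
    then show "algo T L (xs @ ys) = (if hit T xs then harvest T L ys else algo T (2 * L) ys)"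
      using assms by (subst algo.simps) auto
  qed
  also have "\<dots> = bind_pmf (replicate_pmf L p) (\<lambda>xs. if hit T xs then harvest_law T L M else algo_law T (2 * L) M)"
    by (intro bind_pmf_cong) (auto simp: algo_law_def harvest_law_def)
  finally show ?thesis .
qed

text \<open>A hit is unlikely while \<open>L * pm < T / 2\<close>, a miss once
  \<open>L * pm \<ge> 2 * T\<close>, and in between both outcomes are fine. Outside these unlikely
  events doubling happens only below \<open>2 * T\<close>, so the final \<open>L * pm\<close> lies
  between \<open>T / 2\<close> and \<open>4 * T\<close>. \<open>M + L\<close> is invariant, because
  a probe consumes \<open>L\<close> symbols while \<open>L\<close> doubles. Each probe costs
  \<open>\<tau>\<close> and at least one symbol, whence \<open>M * \<tau>\<close>.\<close>

lemma algo_okay: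
  assumes T: "0 < T" and M0: "8 * real T \<le> real M0 * pm" and \<epsilon>: "0 \<le> \<epsilon>"
    and harvest: "\<And>L M. T \<le> L \<Longrightarrow> real T \<le> 2 * (real L * pm) \<Longrightarrow> real L * pm \<le> 4 * real T \<Longrightarrow> M + 2 * L = M0 + T \<Longrightarrow>
      okay s n \<epsilon> (harvest_law T L M)"
  defines "\<tau> \<equiv> N * exp (- real T / 8)"
  shows "T \<le> L \<Longrightarrow> real L * pm < 4 * real T \<Longrightarrow> M + L = M0 + T \<Longrightarrow> okay s n (M * \<tau> + \<epsilon>) (algo_law T L M)"
proof (induction M arbitrary: L rule: less_induct)
  case (less M)
  have L0: "0 < L" using T less.prems by simp
  have \<tau>0: "0 \<le> \<tau>" by (simp add: \<tau>_def)
  \<comment> \<open>The supply suffices: \<open>2 * L * pm < 8 * T\<close> is covered by the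
    hypothesis on \<open>M0\<close>, so \<open>2 * L \<le> M0\<close>, and the invariant leaves at
    least \<open>L\<close> symbols.\<close>
  have "real (2 * L) * pm \<le> real M0 * pm" using M0 less.prems(2) by simp
  then have "2 * L \<le> M0" using pm_pos by simp
  then have "L \<le> M" using less.prems(3) by linarith
  then obtain M' where M: "M = L + M'" by (auto simp: le_iff_add)
  have M': "M' < M" "M' + 2 * L = M0 + T" using M L0 less.prems(3) by auto
  let ?D = "\<lambda>xs. if hit T xs then harvest_law T L M' else algo_law T (2 * L) M'"
  have cont: "okay s n (M' * \<tau> + \<epsilon>) (algo_law T (2 * L) M')" if "real L * pm < 2 * real T"
  proof (rule less.IH[OF M'(1)])
    have "real (2 * L) * pm = 2 * (real L * pm)" by simp
    then show "real (2 * L) * pm < 4 * real T" using that by linarith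
  qed (use M' less.prems in auto)
  have now: "okay s n (M' * \<tau> + \<epsilon>) (harvest_law T L M')" if "real T \<le> 2 * (real L * pm)"
  proof -
    have "okay s n \<epsilon> (harvest_law T L M')" by (rule harvest) (use that less.prems M' in auto)
    then show ?thesis by (rule okay_mono) (use \<tau>0 in simp)
  qed
  obtain B where B: "measure_pmf.prob (replicate_pmf L p) B \<le> \<tau>" "\<And>xs. xs \<notin> B \<Longrightarrow> okay s n (M' * \<tau> + \<epsilon>) (?D xs)"
  proof -
    consider "2 * (real L * pm) < real T" | "real T \<le> 2 * (real L * pm)" "real L * pm < 2 * real T" | "2 * real T \<le> real L * pm"
      by linarith
    then show thesis
    proof cases
      case 1
      have "measure_pmf.prob (replicate_pmf L p) {xs. \<exists>x. T \<le> count_list xs x} \<le> card {1..N} * exp (- real T / 8)"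
      proof (rule prob_ex_count_le)
        fix x
        have "real L * pmf p x \<le> real L * pm" using pm_le by (intro mult_left_mono) auto
        then show "measure_pmf.prob (replicate_pmf L p) {xs. T \<le> count_list xs x} \<le> exp (- real T / 8)"
          using 1 by (intro upper_tail) auto
      qed (use T supp in auto)
      then have "measure_pmf.prob (replicate_pmf L p) {xs. hit T xs} \<le> \<tau>" by (simp add: hit_def \<tau>_def)
      then show thesis by (rule that) (use cont 1 in auto)
    next
      case 2
      have "measure_pmf.prob (replicate_pmf L p) {} \<le> \<tau>" using \<tau>0 by simp
      then show thesis by (rule that) (use cont now 2 in auto)
    next
      case 3
      obtain x where x: "pmf p x = pm" using pm_ex by blast
      have "measure_pmf.prob (replicate_pmf L p) {xs. \<not> hit T xs} \<le> measure_pmf.prob (replicate_pmf L p) {xs. count_list xs x < T}"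
        by (intro measure_pmf.finite_measure_mono) (auto simp: hit_def not_le)
      also have "\<dots> \<le> exp (- real T / 4)" by (rule lower_tail) (use 3 x in auto)
      also have "\<dots> \<le> 1 * exp (- real T / 8)" by simp
      also have "\<dots> \<le> \<tau>" unfolding \<tau>_def using N_pos by (intro mult_right_mono) auto
      finally show thesis by (rule that) (use now 3 in auto)
    qed
  qed
  have "okay s n (M' * \<tau> + \<epsilon> + \<tau>) (bind_pmf (replicate_pmf L p) ?D)"
    by (rule okay_bind) (use B T \<epsilon> \<tau>0 in auto)
  then show ?case unfolding M algo_law_step[OF L0]
  proof (rule okay_mono)
    have "1 \<le> real L" using L0 by simp
    from mult_right_mono[OF this \<tau>0] show "M' * \<tau> + \<epsilon> + \<tau> \<le> real (L + M') * \<tau> + \<epsilon>" by (simp add: distrib_right)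
  qed
qed

lemma stream_okay:
  assumes rel: "reliable K L \<delta>" and M: "M = b * (K * L + L) + r"
    and tail: "2 ^ n * exp (- (real L)\<^sup>2 * pc / (8 * real K)) ^ b \<le> \<eta>"
    and \<epsilon>: "M * err K L \<delta> \<le> \<epsilon>" "b * (2 * \<delta>) + \<eta> \<le> \<epsilon>"
  shows "okay s n \<epsilon> (stream_law K L M)"
  unfolding okay_def
proof
  show "near_iid s \<epsilon> (stream_law K L M)" by (rule near_iid_mono[OF stream_near[OF rel] \<epsilon>(1)])
  have "measure_pmf.prob (stream_law K L M) {l. length l < n} \<le> b * (2 * \<delta>) + 2 ^ n * exp (- (real L)\<^sup>2 * pc / (8 * real K)) ^ b"
    unfolding M by (rule decays_tail[OF stream_decays[OF rel]])
  then show "measure_pmf.prob (stream_law K L M) {l. length l < n} \<le> \<epsilon>" using tail \<epsilon>(2) by linarith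
qed

end

text \<open>The law of \<open>m\<close> is that of the output length raised to at least
  \<open>n\<close>. The change matters with probability at most \<open>\<epsilon>\<close>, which
  adds to the \<open>\<epsilon>\<close> for the entries.\<close>

lemma okay_imp_mixture:
  fixes s :: "'a pmf"
  assumes fin: "finite (set_pmf D)" "finite (set_pmf s)" and ok: "okay s n \<epsilon> D"
  shows "\<exists>\<mu>. (\<forall>m\<in>set_pmf \<mu>. n \<le> m) \<and>
    (\<forall>A. \<bar>measure_pmf.prob D A - measure_pmf.prob (bind_pmf \<mu> (\<lambda>m. replicate_pmf m s)) A\<bar> \<le> 2 * \<epsilon>)"
proof (intro exI conjI allI ballI)
  let ?\<mu> = "map_pmf (\<lambda>l. max n (length l)) D"
  show "n \<le> m" if "m \<in> set_pmf ?\<mu>" for m using that by auto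
  fix A :: "'a list set"
  let ?g = "\<lambda>l. of_bool (l \<in> A) :: real"
  let ?R = "\<lambda>m. E (replicate_pmf m s) ?g"
  have R: "0 \<le> ?R m" "?R m \<le> 1" for m using fin by (auto intro!: E_ge0 E_le)
  have pE: "measure_pmf.prob P A = E P ?g" for P :: "'a list pmf" by (simp add: E_indicator)
  have "\<bar>E D ?g - E D (\<lambda>l. ?R (length l))\<bar> \<le> \<epsilon>"
    using ok by (auto simp: okay_def near_iid_def)
  moreover have "\<bar>E D (\<lambda>l. ?R (length l)) - E D (\<lambda>l. ?R (max n (length l)))\<bar> \<le> \<epsilon>"
  proof -
    have "\<bar>E D (\<lambda>l. ?R (length l)) - E D (\<lambda>l. ?R (max n (length l)))\<bar> =
        \<bar>E D (\<lambda>l. ?R (length l) - ?R (max n (length l)))\<bar>" by (subst E_diff[OF fin(1)]) simp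
    also have "\<dots> \<le> E D (\<lambda>l. \<bar>?R (length l) - ?R (max n (length l))\<bar>)" by (rule E_abs)
    also have "\<dots> \<le> E D (\<lambda>l. of_bool (length l < n))"
    proof (rule E_mono[OF fin(1)])
      fix l
      show "\<bar>?R (length l) - ?R (max n (length l))\<bar> \<le> of_bool (length l < n)"
      proof (cases "length l < n")
        case True
        have "\<bar>?R (length l) - ?R n\<bar> \<le> 1" using R[of "length l"] R[of n] unfolding abs_le_iff by linarith
        then show ?thesis using True by (simp add: max_def)
      qed (simp add: max_def)
    qed
    also have "\<dots> \<le> \<epsilon>" using ok by (simp add: E_indicator okay_def)
    finally show ?thesis .
  qed
  moreover have "E (bind_pmf ?\<mu> (\<lambda>m. replicate_pmf m s)) ?g = E D (\<lambda>l. ?R (max n (length l)))"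
    using fin by (simp add: E_bind)
  ultimately show "\<bar>measure_pmf.prob D A - measure_pmf.prob (bind_pmf ?\<mu> (\<lambda>m. replicate_pmf m s)) A\<bar> \<le> 2 * \<epsilon>"
    unfolding pE by linarith
qed

text \<open>\<open>X / 32\<close> is the promised number of outputs and \<open>X / 16\<close> a
  lower bound for the total exponent. As \<open>ln 2 \<le> 3 / 4\<close>, at least
  \<open>X / 16 - 3 * X / 128 = 5 * X / 128\<close> of it survives, which is \<open>t / 8\<close> or
  more; the rounding of \<open>n\<close> costs \<open>exp (3 / 4) \<le> 3\<close>.\<close>

lemma tail_bound:
  fixes X c t :: real
  assumes "real n \<le> X / 32 + 1" "X / 16 \<le> b * c" "16 * t \<le> 5 * X"
  shows "2 ^ n * exp (- c) ^ b \<le> 3 * exp (- t / 8)"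
proof -
  have "(2::real) ^ n = exp (n * ln 2)" by (simp add: exp_of_nat_mult)
  also have "\<dots> \<le> exp ((X / 32 + 1) * (3 / 4))"
    unfolding exp_le_cancel_iff using assms(1) ln2_le_25_over_36 by (intro mult_mono) auto
  finally have "2 ^ n * exp (- c) ^ b \<le> exp ((X / 32 + 1) * (3 / 4)) * exp (- (b * c))"
    by (simp add: mult_right_mono flip: exp_of_nat_mult)
  also have "\<dots> = exp ((X / 32 + 1) * (3 / 4) - b * c)" by (simp flip: exp_add)
  also have "\<dots> \<le> exp (3 / 4 + - t / 8)"
    unfolding exp_le_cancel_iff using assms(2,3) by (simp add: field_simps)
  also have "\<dots> = exp (3 / 4) * exp (- t / 8)" by (simp only: exp_add)
  also have "\<dots> \<le> 3 * exp (- t / 8)"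
  proof (intro mult_right_mono)
    have "exp (3 / 4 :: real) \<le> exp 1" by simp
    then show "exp (3 / 4 :: real) \<le> 3" using exp_le by linarith
  qed simp
  finally show ?thesis .
qed

section \<open>The error bound for the whole algorithm\<close>

context sized_source
begin

lemma algo_near_mixture:
  assumes \<kappa>: "1024 \<le> \<kappa>" and T: "0 < T" "real T \<le> \<kappa> / 256" and M: "10 * \<kappa>\<^sup>2 \<le> real M0 * pm"
    and n: "real n \<le> real M0 * pc / (\<kappa> * pm) / 32 + 1"
  shows "okay s n (13 * N * real M0 ^ 3 * exp (- real T / 8)) (algo_law T T M0)"
proof -
  define X where "X = real M0 * pc / (\<kappa> * pm)"
  define e where "e = exp (- real T / 8)"
  have e: "0 < e" by (simp add: e_def)
  note pos = pm_pos pc_pos N_pos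
  have \<kappa>0: "0 < \<kappa>" using \<kappa> by simp
  have M0\<kappa>: "10 * \<kappa>\<^sup>2 \<le> real M0"
  proof -
    have "real M0 * pm \<le> real M0 * 1" by (intro mult_left_mono pm_le_1) simp
    with M show ?thesis by simp
  qed
  have \<kappa>sq: "1024 * \<kappa> \<le> \<kappa>\<^sup>2" using mult_right_mono[OF \<kappa>, of \<kappa>] \<kappa>0 by (simp add: power2_eq_square)
  have M01: "1 \<le> real M0" using M0\<kappa> \<kappa>sq \<kappa> by linarith
  \<comment> \<open>The most likely element alone gives \<open>pm\<^sup>2 \<le> pc\<close>, hence a
    yield \<open>X\<close> of order at least \<open>\<kappa>\<close>.\<close>
  have X10: "10 * \<kappa> \<le> X"
  proof -
    have "10 * \<kappa> * (\<kappa> * pm) * pm = (10 * \<kappa>\<^sup>2) * pm\<^sup>2" by (simp add: power2_eq_square)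
    also have "\<dots> \<le> (real M0 * pm) * pc" by (intro mult_mono M pm_sq_le) (use pos in auto)
    finally have "10 * \<kappa> * (\<kappa> * pm) \<le> real M0 * pc" using pos by (simp add: mult.assoc mult.commute[of _ pm])
    then show ?thesis using \<kappa>0 pos by (simp add: X_def le_divide_eq)
  qed
  have tX: "16 * real T \<le> 5 * X" using X10 T \<kappa>0 by simp
  have N1: "1 \<le> real N" using N_pos by simp
  \<comment> \<open>The common unit of error: one factor \<open>M0\<close> for the number of items,
    one for \<open>L / K\<close>, and one, together with \<open>N\<close>, for the union bound in
    \<open>\<delta>\<close>.\<close>
  define Y where "Y = N * real M0 ^ 3 * e"
  have Y: "e \<le> Y" "N * (real M0)\<^sup>2 * e \<le> Y" "real M0 * (N * e) \<le> Y" "0 \<le> Y"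
  proof -
    have "1 \<le> real M0 ^ 3" using M01 by simp
    then have "1 * 1 \<le> N * real M0 ^ 3" by (intro mult_mono N1) auto
    then show "e \<le> Y" using e by (simp add: Y_def)
    have "(real M0)\<^sup>2 \<le> real M0 ^ 3" "real M0 ^ 1 \<le> real M0 ^ 3" using M01 by (intro power_increasing; simp)+
    then show "N * (real M0)\<^sup>2 * e \<le> Y" "real M0 * (N * e) \<le> Y"
      unfolding Y_def using e N1 by (auto intro!: mult_right_mono mult_left_mono simp: mult_ac)
  qed (use e in \<open>simp add: Y_def\<close>)
  have harvest: "okay s n (12 * Y) (harvest_law T L M)"
    if L: "T \<le> L" "real T \<le> 2 * (real L * pm)" "real L * pm \<le> 4 * real T" "M + 2 * L = M0 + T" for L M
  proof (cases "L = T")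
    case True
    have h: "harvest_law T L M = stream_law 1 1 M" by (simp add: True harvest_law_def harvest_def stream_law_def)
    \<comment> \<open>Stopping at the very first size means \<open>L * pm \<ge> T / 2\<close> with
      \<open>L = T\<close>, so the maximal probability is at least 1/2 and pairs of equal symbols
      are frequent.\<close>
    have pm2: "1 \<le> 2 * pm" using L(2) T True by (simp add: field_simps)
    define b where "b = M div 2"
    have M2: "M = b * (1 * 1 + 1) + M mod 2" unfolding b_def by presburger
    have MT: "M + T = M0" using L(4) True by simp
    have "real T \<le> real M0 / 4 - 1" using T \<kappa>sq M0\<kappa> \<kappa> by linarith
    then have b4: "real M0 / 4 \<le> real b" using MT by (simp add: b_def)
    have "X / 16 \<le> b * (pc / 8)"
    proof -
      have "X / 16 \<le> real M0 * pc / 32"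
      proof -
        have "2 \<le> \<kappa> * pm" using mult_mono[OF \<kappa> pm2] \<kappa>0 pos by simp
        then have "real M0 * pc / (\<kappa> * pm) \<le> real M0 * pc / 2" using pos by (intro divide_left_mono) auto
        then have "X \<le> real M0 * pc / 2" by (simp only: X_def)
        then show ?thesis by simp
      qed
      also have "\<dots> \<le> b * (pc / 8)" using mult_right_mono[OF b4, of "pc / 8"] pos by simp
      finally show ?thesis .
    qed
    from tail_bound[OF n[folded X_def] this tX]
    have "2 ^ n * exp (- (real 1)\<^sup>2 * pc / (8 * real 1)) ^ b \<le> 3 * e" by (simp add: e_def)
    then show ?thesis unfolding h
      by (rule stream_okay[OF reliable_pairing M2]) (use Y e in \<open>auto simp: err_def\<close>)
  next
    case False
    define K where "K = 8 * T"
    define n0 where "n0 = K * L + L"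
    define b where "b = M div n0"
    have h: "harvest_law T L M = stream_law K L M" using False by (simp add: harvest_law_def harvest_def stream_law_def K_def)
    have L0: "0 < L" using T L by simp
    have K0: "0 < K" using T by (simp add: K_def)
    have Mb: "M = b * (K * L + L) + M mod n0"
      unfolding b_def n0_def by (rule div_mult_mod_eq[symmetric])
    \<comment> \<open>One incomplete block and \<open>2 * L\<close> symbols of the search are a
      small part of the input: \<open>11 * T * (4 * T) \<le> 44 * (\<kappa> / 256)\<^sup>2 \<le>
      \<kappa>\<^sup>2\<close>.\<close>
    have big: "(real K + 3) * real L \<le> real M0 / 10"
    proof -
      have "real K + 3 \<le> 11 * real T" using T by (simp add: K_def)
      from mult_mono[OF this L(3)] have "(real K + 3) * (real L * pm) \<le> (11 * real T) * (4 * real T)"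
        using pm_pos by simp
      then have "(real K + 3) * real L * pm \<le> (11 * real T) * (4 * real T)" by (simp only: mult.assoc)
      also have "\<dots> \<le> 44 * (\<kappa> / 256)\<^sup>2" using mult_mono[OF T(2) T(2)] T \<kappa>0 by (simp add: power2_eq_square)
      also have "\<dots> \<le> \<kappa>\<^sup>2" by (simp add: power_divide)
      also have "\<dots> \<le> (real M0 / 10) * pm" using M by simp
      finally show ?thesis using pos by simp
    qed
    have LM0: "real L \<le> real M0"
    proof -
      have "1 * real L \<le> (real K + 3) * real L" by (intro mult_right_mono) auto
      then show ?thesis using big by simp
    qed
    have KM0: "real K \<le> real M0" using T \<kappa>sq M0\<kappa> \<kappa> by (simp add: K_def)
    have b2: "real M0 / 2 \<le> real b * ((real K + 1) * real L)"
    proof -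
      have "M < (b + 1) * n0" using L0 unfolding b_def n0_def
        by (metis Suc_eq_plus1 add_gr_0 dividend_less_div_times mult.commute mult_Suc add.commute)
      then have "real M < (real b + 1) * real n0" by (metis of_nat_1 of_nat_add of_nat_less_iff of_nat_mult)
      moreover have "real n0 = (real K + 1) * real L" by (simp add: n0_def algebra_simps)
      moreover have "real M + 2 * real L = real M0 + real T" using L(4) by (metis of_nat_add of_nat_mult of_nat_numeral)
      ultimately show ?thesis using big by (simp add: algebra_simps)
    qed
    \<comment> \<open>Three facts make room for the constant 32: full blocks use at least half of
      the input (\<open>b2\<close>), \<open>L \<ge> K / (16 * pm)\<close> because
      \<open>L * pm \<ge> T / 2\<close>, and \<open>K + 1 \<le> \<kappa> / 16\<close>.\<close>
    have "X / 16 \<le> b * ((real L)\<^sup>2 * pc / (8 * real K))"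
    proof -
      have K16: "real K + 1 \<le> \<kappa> / 16" using T by (simp add: K_def)
      have split: "m / 2 * (c / q) * (1 / (128 * a)) = m / 2 * (k / (16 * q)) * (c / (8 * k * a))"
        if "k \<noteq> 0" for m c q a k :: real using that by simp
      have split': "w * a * l * l * (c / (8 * k * a)) = w * (l\<^sup>2 * c / (8 * k))"
        if "a \<noteq> 0" for w c l a k :: real using that by (simp add: power2_eq_square)
      have LK: "real K / (16 * pm) \<le> real L" using L(2) pos by (simp add: K_def field_simps)
      have "X / 16 = (real M0 / 2) * (pc / pm) * (1 / (8 * \<kappa>))" using \<kappa>0 pos by (simp add: X_def field_simps)
      also have "\<dots> \<le> (real M0 / 2) * (pc / pm) * (1 / (128 * (real K + 1)))"
        using K16 \<kappa>0 pos by (intro mult_left_mono divide_left_mono) auto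
      also have "\<dots> = (real M0 / 2) * (real K / (16 * pm)) * (pc / (8 * real K * (real K + 1)))"
        using K0 by (intro split) simp
      also have "\<dots> \<le> (real b * ((real K + 1) * real L)) * real L * (pc / (8 * real K * (real K + 1)))"
        using pos K0 by (intro mult_right_mono mult_mono b2 LK) auto
      also have "\<dots> = b * ((real L)\<^sup>2 * pc / (8 * real K))"
        using split'[of "real K + 1" "real b" "real L" pc "real K"] by (simp add: mult.assoc)
      finally show ?thesis .
    qed
    from tail_bound[OF n[folded X_def] this tX]
    have tail: "2 ^ n * exp (- (real L)\<^sup>2 * pc / (8 * real K)) ^ b \<le> 3 * e" by (simp add: e_def)
    define \<delta> where "\<delta> = (N * (8 * T) + L) * exp (- real T)"
    have rel: "reliable K L \<delta>" unfolding \<delta>_def K_def by (rule reliable_pools[OF T(1) L0 L(3)])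
    have \<delta>0: "0 \<le> \<delta>" by (simp add: \<delta>_def)
    have \<delta>: "\<delta> \<le> 2 * N * real M0 * e"
    proof -
      have "real (N * (8 * T) + L) \<le> 2 * N * real M0"
      proof -
        have "N * real K \<le> N * real M0" by (intro mult_left_mono KM0) simp
        moreover have "1 * real L \<le> N * real M0" by (intro mult_mono LM0 N1) auto
        ultimately show ?thesis by (simp add: K_def)
      qed
      moreover have "exp (- real T) \<le> e" by (simp add: e_def)
      ultimately show ?thesis unfolding \<delta>_def by (intro mult_mono) auto
    qed
    have MM0: "real M \<le> real M0" using L(1,4) by simp
    have bM: "real b \<le> real M0" using MM0 by (simp add: b_def) (meson div_le_dividend le_trans of_nat_le_iff)
    have err: "M * err K L \<delta> \<le> 12 * Y"
    proof -
      have "2 * (real L / K) \<le> 2 * real M0"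
      proof -
        have "real L / K \<le> real L / 1" using K0 by (intro divide_left_mono) auto
        then show ?thesis using LM0 by simp
      qed
      then have "1 + 2 * (real L / K) \<le> 3 * real M0" using M01 by linarith
      then have "\<delta> * (1 + 2 * (real L / K)) \<le> (2 * N * real M0 * e) * (3 * real M0)"
        using \<delta> \<delta>0 e by (intro mult_mono) auto
      moreover have "err K L \<delta> = \<delta> * (1 + 2 * (real L / K))" by (simp add: err_def algebra_simps)
      ultimately have "M * err K L \<delta> \<le> real M0 * ((2 * N * real M0 * e) * (3 * real M0))"
        using MM0 err_nonneg[OF rel] by (intro mult_mono) auto
      also have "\<dots> = 6 * Y" by (simp add: Y_def power3_eq_cube)
      finally show ?thesis using Y by linarith
    qed
    have "b * (2 * \<delta>) + 3 * e \<le> 12 * Y"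
    proof -
      have "b * (2 * \<delta>) \<le> real M0 * (2 * (2 * N * real M0 * e))" using \<delta> \<delta>0 bM e by (intro mult_mono) auto
      also have "\<dots> = 4 * (N * (real M0)\<^sup>2 * e)" by (simp add: power2_eq_square)
      finally show ?thesis using Y by linarith
    qed
    with err show ?thesis unfolding h by (rule stream_okay[OF rel Mb tail])
  qed
  have M8: "8 * real T \<le> real M0 * pm" using T M \<kappa>sq \<kappa> by linarith
  have "okay s n (M0 * (N * exp (- real T / 8)) + 12 * Y) (algo_law T T M0)"
  proof (rule algo_okay[OF T(1) M8 _ harvest])
    show "real T * pm < 4 * real T" using mult_left_mono[OF pm_le_1, of "real T"] T(1) by simp
  qed (use Y in auto)
  then show ?thesis
  proof (rule okay_mono)
    have "M0 * (N * exp (- real T / 8)) \<le> Y" using Y(3) by (simp add: e_def)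
    then show "M0 * (N * exp (- real T / 8)) + 12 * Y \<le> 13 * N * real M0 ^ 3 * exp (- real T / 8)"
      by (simp add: Y_def e_def)
  qed
qed

end

section \<open>Counts, running time and the theorem\<close>

lemma coin_True: "0 < K \<Longrightarrow> True \<in> set_pmf (coin K k) \<Longrightarrow> 0 < k"
  by (auto simp: coin_def lessThan_empty_iff)

lemma size_filter_Suc:
  "size {#b \<in># B. fst b = x \<and> c < snd b#} = size {#b \<in># B. fst b = x \<and> Suc c < snd b#} + count B (x, Suc c)"
proof (induction B)
  case (add b B)
  then show ?case by (cases b) auto
qed simp

text \<open>Both bounds hold for every outcome of the coins: an accepted copy is an item, and it
  needs a nonempty pool of its own.\<close>

lemma screen_count:
  assumes "0 < K" "os \<in> set_pmf (screen K B pre xs)"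
  shows "count_list (somes os) y \<le> count_list xs y \<and>
    count_list (somes os) y \<le> size {#b \<in># B. fst b = y \<and> count_list pre y < snd b#}"
  using assms(2)
proof (induction xs arbitrary: pre os)
  case (Cons x xs)
  then obtain b os' where b: "b \<in> set_pmf (coin K (count B (x, Suc (count_list pre x))))"
    "os' \<in> set_pmf (screen K B (pre @ [x]) xs)" "os = (if b then Some x else None) # os'" by auto
  note IH = Cons.IH[OF b(2)]
  define k where "k = count B (x, Suc (count_list pre x))"
  have sz: "size {#b \<in># B. fst b = x \<and> count_list pre x < snd b#} =
      size {#b \<in># B. fst b = x \<and> Suc (count_list pre x) < snd b#} + k"
    unfolding k_def by (rule size_filter_Suc)
  have "0 < k" if b
    unfolding k_def by (rule coin_True[OF assms(1)]) (use b(1) that in simp)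
  then show ?case using IH b(3) sz by (cases b; cases "x = y") auto
qed simp

text \<open>Adding the two bounds of \<open>screen_count\<close> gives the factor 2, because balls
  and items are disjoint parts of the input.\<close>

lemma block_count:
  assumes "0 < K" "ys \<in> set_pmf (block K m B xs)"
  shows "2 * count_list ys y \<le> count_list (map fst B) y + count_list xs y"
  using assms(2)
proof (induction m arbitrary: B xs)
  case 0
  then obtain os where os: "os \<in> set_pmf (screen K (mset B) [] xs)" "ys = somes os" by auto
  have "size {#b \<in># mset B. fst b = y \<and> count_list [] y < snd b#} \<le> size {#b \<in># mset B. fst b = y#}"
    by (induction B) auto
  also have "\<dots> = count_list (map fst B) y" by (induction B) auto
  finally show ?case using screen_count[OF assms(1) os(1), of y] os(2) by simp
next
  case (Suc m)
  show ?case
  proof (cases xs)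
    case (Cons x zs)
    then obtain g where "ys \<in> set_pmf (block K m (B @ [(x, g)]) zs)" using Suc.prems by auto
    from Suc.IH[OF this] show ?thesis by (auto simp: Cons split: if_splits)
  qed (use Suc.prems in simp)
qed

lemma stream_count: "0 < K \<Longrightarrow> ys \<in> set_pmf (stream K L xs) \<Longrightarrow> 2 * count_list ys y \<le> count_list xs y"
proof (induction "length xs" arbitrary: xs ys rule: less_induct)
  case less
  show ?case
  proof (cases "xs = [] \<or> L = 0")
    case True
    then show ?thesis using less.prems by (subst (asm) stream.simps) simp
  next
    case False
    then obtain u v where uv: "u \<in> set_pmf (block K (K * L) [] (take (K * L + L) xs))"
      "v \<in> set_pmf (stream K L (drop (K * L + L) xs))" "ys = u @ v"
      using less.prems(2) by (subst (asm) stream.simps) auto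
    have "2 * count_list v y \<le> count_list (drop (K * L + L) xs) y"
      by (rule less.hyps[OF _ less.prems(1) uv(2)]) (use False in simp)
    moreover have "2 * count_list u y \<le> count_list (take (K * L + L) xs) y"
      using block_count[OF less.prems(1) uv(1), of y] by simp
    moreover have "count_list xs y = count_list (take (K * L + L) xs) y + count_list (drop (K * L + L) xs) y"
      unfolding count_list_append[symmetric] by simp
    ultimately show ?thesis by (simp add: uv(3))
  qed
qed

lemma algo_count: "0 < T \<Longrightarrow> ys \<in> set_pmf (algo T L xs) \<Longrightarrow> 2 * count_list ys y \<le> count_list xs y"
proof (induction T L xs arbitrary: ys rule: algo.induct)
  case (1 T L xs)
  have split: "count_list xs y = count_list (take L xs) y + count_list (drop L xs) y"
    unfolding count_list_append[symmetric] by simp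
  consider "L = 0 \<or> length xs < L" | "\<not> (L = 0 \<or> length xs < L)" "hit T (take L xs)" | "\<not> (L = 0 \<or> length xs < L)" "\<not> hit T (take L xs)"
    by blast
  then show ?case
  proof cases
    case 1
    then show ?thesis using "1.prems"(2) by (subst (asm) algo.simps) simp
  next
    case 2
    then have "ys \<in> set_pmf (harvest T L (drop L xs))" using "1.prems"(2) by (subst (asm) algo.simps) simp
    then have "2 * count_list ys y \<le> count_list (drop L xs) y"
      using "1.prems"(1) stream_count[of 1 ys 1] stream_count[of "8 * T" ys L] by (simp add: harvest_def split: if_splits)
    then show ?thesis using split by simp
  next
    case 3
    then have "ys \<in> set_pmf (algo T (2 * L) (drop L xs))" using "1.prems"(2) by (subst (asm) algo.simps) simp
    from "1.IH"[OF 3 "1.prems"(1) this] show ?thesis using split by simp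
  qed
qed

text \<open>In a constant input every pair matches, and \<open>coin 1 1\<close> accepts with
  certainty, so the output is deterministic.\<close>

lemma stream_pairing_constant: "stream 1 1 (replicate m x) = return_pmf (replicate (m div 2) x)"
proof (induction m rule: less_induct)
  case (less m)
  have c1: "coin 1 1 = return_pmf True" by (simp add: coin_def lessThan_Suc pmf_of_set_singleton)
  have bl: "block 1 1 [] [x, x] = return_pmf [x]"
    using c1 by (simp add: pmf_of_set_singleton bind_return_pmf)
  show ?case
  proof (cases "m < 2")
    case True
    then consider "m = 0" | "m = 1" by linarith
    then show ?thesis
    proof cases
      case 2
      have "stream 1 1 [] = return_pmf []" by (simp add: stream.simps)
      then show ?thesis using 2
        by (subst stream.simps) (simp add: pmf_of_set_singleton bind_return_pmf)
    qed (simp add: stream.simps)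
  next
    case False
    then obtain k where m: "m = Suc (Suc k)" by (metis add_2_eq_Suc le_Suc_ex not_less)
    have "stream 1 1 (replicate m x) = bind_pmf (block 1 (1 * 1) [] (take (1 * 1 + 1) (replicate m x)))
       (\<lambda>ys. map_pmf ((@) ys) (stream 1 1 (drop (1 * 1 + 1) (replicate m x))))"
      by (subst stream.simps) (simp add: m)
    also have "take (1 * 1 + 1) (replicate m x) = [x, x]" by (simp add: m)
    also have "drop (1 * 1 + 1) (replicate m x) = replicate k x" by (simp add: m)
    also have "stream 1 1 (replicate k x) = return_pmf (replicate (k div 2) x)" by (rule less) (simp add: m)
    finally show ?thesis unfolding mult_1 bl by (simp add: bind_return_pmf m)
  qed
qed

lemma count_list_replicate: "count_list (replicate n x) y = (if x = y then n else 0)"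
  by (induction n) auto

lemma algo_constant:
  assumes "0 < T" "T \<le> M"
  shows "algo T T (replicate M x) = return_pmf (replicate ((M - T) div 2) x)"
proof -
  have "hit T (take T (replicate M x))"
    unfolding hit_def using assms by (intro exI[of _ x]) (simp add: count_list_replicate min_def)
  then show ?thesis
    using assms by (subst algo.simps) (simp add: harvest_def stream_pairing_constant[simplified])
qed

lemma replicate_pmf_return: "replicate_pmf n (return_pmf x) = return_pmf (replicate n x)"
  by (induction n) (simp_all add: bind_return_pmf)

section \<open>Statistical distance and the polynomial running time\<close>

lemma stat_dist_le:
  assumes "\<And>A. \<bar>measure_pmf.prob P A - measure_pmf.prob Q A\<bar> \<le> \<epsilon>"
  shows "stat_dist P Q \<le> \<epsilon>"
  unfolding stat_dist_def using assms by (intro cSUP_least) auto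

lemma stat_dist_spmf_of_pmf_le:
  fixes P Q :: "'a pmf"
  assumes "\<And>A. \<bar>measure_pmf.prob P A - measure_pmf.prob Q A\<bar> \<le> \<epsilon>"
  shows "stat_dist (spmf_of_pmf P) (spmf_of_pmf Q) \<le> \<epsilon>"
proof (rule stat_dist_le)
  fix A :: "'a option set"
  have "measure_pmf.prob (spmf_of_pmf R) A = measure_pmf.prob R (Some -` A)" for R :: "'a pmf"
    unfolding spmf_of_pmf_def by (rule measure_map_pmf)
  then show "\<bar>measure_pmf.prob (spmf_of_pmf P) A - measure_pmf.prob (spmf_of_pmf Q) A\<bar> \<le> \<epsilon>"
    using assms[of "Some -` A"] by simp
qed

lemma stat_dist_le_1: "stat_dist P Q \<le> 1"
proof (rule stat_dist_le)
  fix A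
  have "0 \<le> measure_pmf.prob P A" "measure_pmf.prob P A \<le> 1" "0 \<le> measure_pmf.prob Q A" "measure_pmf.prob Q A \<le> 1" by simp_all
  then show "\<bar>measure_pmf.prob P A - measure_pmf.prob Q A\<bar> \<le> 1" by linarith
qed

lemma bits_le_ln: "0 < n \<Longrightarrow> real (bits n) \<le> 1 + 3 / 2 * ln (real n)"
proof -
  assume n: "0 < n"
  have "(2::real) ^ floor_log n \<le> real n"
    using floor_log_exp2_le[OF n] by (metis of_nat_le_iff of_nat_numeral of_nat_power)
  then have "ln ((2::real) ^ floor_log n) \<le> ln (real n)" using n by (subst ln_le_cancel_iff) auto
  then have "real (floor_log n) * ln 2 \<le> ln (real n)" by (simp add: ln_realpow)
  moreover have "real (floor_log n) * (2 / 3) \<le> real (floor_log n) * ln 2"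
    using ln2_ge_two_thirds by (intro mult_left_mono) auto
  ultimately show ?thesis by (simp add: bits_def)
qed

text \<open>The outer variable stands for \<open>ln \<kappa>\<close>, and the coefficients are
  polynomials in \<open>ln N\<close>; the value is
  \<open>400000 * (1 + ln N + ln \<kappa>)\<^sup>2\<close>.\<close>

definition cost_poly :: "real poly poly" where
  "cost_poly = [:[:1, 1:], 1:] ^ 2 * [:[:400000:]:]"

lemma poly_cost_poly: "poly (poly cost_poly [:x:]) y = 400000 * (1 + y + x)\<^sup>2"
  by (simp add: cost_poly_def algebra_simps)

lemma cost_bound:
  assumes \<kappa>: "2 \<le> \<kappa>" and N: "1 \<le> N" and m: "1 \<le> m"
    and V: "V = 600 * N * (nat \<lfloor>\<kappa>\<rfloor> + 1)\<^sup>2" and c: "c \<le> 700 * (bits V * bits V) * (m + 1)"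
  shows "real c \<le> real m * poly (poly cost_poly [:ln \<kappa>:]) (ln (real N))"
proof -
  define u where "u = 1 + ln (real N) + ln \<kappa>"
  have lnN: "0 \<le> ln (real N)" and ln\<kappa>: "0 \<le> ln \<kappa>" using N \<kappa> by simp_all
  have fl: "real (nat \<lfloor>\<kappa>\<rfloor>) \<le> \<kappa>" using \<kappa> by simp
  have "0 < V" using N by (simp add: V)
  have "real V = 600 * real N * (real (nat \<lfloor>\<kappa>\<rfloor>) + 1)\<^sup>2" unfolding V by (simp add: algebra_simps power2_eq_square)
  also have "\<dots> \<le> 2 ^ 10 * real N * (2 * \<kappa>)\<^sup>2"
  proof -
    have "real (nat \<lfloor>\<kappa>\<rfloor>) + 1 \<le> 2 * \<kappa>" using fl \<kappa> by linarith
    then have sq: "(real (nat \<lfloor>\<kappa>\<rfloor>) + 1)\<^sup>2 \<le> (2 * \<kappa>)\<^sup>2" by (intro power_mono) auto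
    show ?thesis by (rule mult_mono[OF _ sq]) auto
  qed
  finally have "ln (real V) \<le> ln (2 ^ 10 * real N * (2 * \<kappa>)\<^sup>2)" using \<open>0 < V\<close> N \<kappa> by (subst ln_le_cancel_iff) auto
  also have "\<dots> = 10 * ln 2 + ln (real N) + 2 * (ln 2 + ln \<kappa>)"
  proof -
    have gen: "ln (a * b * c) = ln a + ln b + ln c" if "0 < a" "0 < b" "0 < c" for a b c :: real
      using that by (simp add: ln_mult)
    have "ln ((2::real) ^ 10) = 10 * ln 2" "ln ((2 * \<kappa>)\<^sup>2) = 2 * (ln 2 + ln \<kappa>)"
      using \<kappa> by (subst ln_realpow; simp add: ln_mult)+
    moreover have "ln (2 ^ 10 * real N * (2 * \<kappa>)\<^sup>2) = ln (2 ^ 10) + ln (real N) + ln ((2 * \<kappa>)\<^sup>2)"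
      using N \<kappa> by (intro gen) auto
    ultimately show ?thesis by linarith
  qed
  also have "\<dots> \<le> 9 + ln (real N) + 2 * ln \<kappa>" using ln2_le_25_over_36 by simp
  finally have lnV: "ln (real V) \<le> 9 + ln (real N) + 2 * ln \<kappa>" .
  have "real (bits V) \<le> 1 + 3 / 2 * ln (real V)" by (rule bits_le_ln[OF \<open>0 < V\<close>])
  also have "\<dots> \<le> 1 + 3 / 2 * (9 + ln (real N) + 2 * ln \<kappa>)"
    by (intro add_left_mono mult_left_mono lnV) simp
  also have "\<dots> \<le> 15 * u" using lnN ln\<kappa> by (simp add: u_def)
  finally have b: "real (bits V) \<le> 15 * u" .
  have "real c \<le> 700 * (real (bits V) * real (bits V)) * (real m + 1)"
    using c by (metis (no_types, lifting) of_nat_1 of_nat_add of_nat_le_iff of_nat_mult of_nat_numeral)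
  \<comment> \<open>\<open>m + 1 \<le> 2 * m\<close> turns the bound into a multiple of the input
    length, which requires a nonempty input; \<open>700 * 15 * 15 * 2 = 315000\<close>.\<close>
  also have "\<dots> \<le> 700 * ((15 * u) * (15 * u)) * (2 * real m)"
    using b m by (intro mult_mono) (auto simp: u_def intro: order_trans[OF of_nat_0_le_iff])
  also have "\<dots> = real m * (315000 * u\<^sup>2)" by (simp add: power2_eq_square)
  also have "\<dots> \<le> real m * (400000 * u\<^sup>2)" by (intro mult_left_mono) auto
  also have "\<dots> = real m * poly (poly cost_poly [:ln \<kappa>:]) (ln (real N))"
    by (simp only: poly_cost_poly u_def)
  finally show ?thesis .
qed

lemma sim_set_spmf:
  assumes "sim R P q" "t \<in> set_spmf q"
  shows "\<exists>a\<in>set_pmf P. R a t"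
proof -
  from assms(1) obtain pq where pq: "\<And>x y. (x, y) \<in> set_spmf pq \<Longrightarrow> R x y" "spmf_of_pmf P = map_spmf fst pq" "q = map_spmf snd pq"
    unfolding sim_def by (rule rel_spmfE) blast
  from assms(2) obtain a where "(a, t) \<in> set_spmf pq" unfolding pq(3) by auto
  moreover from this have "a \<in> set_spmf (spmf_of_pmf P)" unfolding pq(2) by force
  ultimately show ?thesis using pq(1) by auto
qed

lemma sim_map_eq:
  assumes "sim R P q" "\<And>a t. R a t \<Longrightarrow> f t = a"
  shows "map_spmf f q = spmf_of_pmf P"
proof -
  have "rel_spmf (=) (spmf_of_pmf P) (map_spmf f q)"
    using assms unfolding sim_def spmf_rel_map by (auto elim: rel_spmf_mono)
  then show ?thesis by (simp add: spmf_rel_eq)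
qed

section \<open>From the simulation to the theorem\<close>

lemma run_sampler: "run sampler \<kappa> xs = exec sampler (start_state (nat \<lfloor>\<kappa>\<rfloor>) xs)"
  by (simp add: run_def start_state_def)

lemma threshold_bounds:
  assumes "1024 \<le> \<kappa>"
  shows "\<kappa> / 512 \<le> real (threshold (nat \<lfloor>\<kappa>\<rfloor>))" "real (threshold (nat \<lfloor>\<kappa>\<rfloor>)) \<le> \<kappa> / 256"
proof -
  define k q where "k = nat \<lfloor>\<kappa>\<rfloor>" and "q = k div 512"
  have k: "real k \<le> \<kappa>" "\<kappa> < real k + 1" "1024 \<le> k" using assms by (auto simp: k_def le_nat_floor) 
  have q: "512 * q \<le> k" "k + 1 \<le> 512 * (q + 1)" "0 < q" using k(3) by (auto simp: q_def)
  have T: "q < threshold k" "threshold k \<le> 2 * q" using doublings_bounds[OF q(3)] by (simp_all add: threshold_def q_def)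
  have "512 * (q + 1) \<le> 512 * threshold k" using T(1) by (intro mult_le_mono2) simp
  with q(2) have "k + 1 \<le> 512 * threshold k" by (rule order_trans)
  then have "real (k + 1) \<le> real (512 * threshold k)" by (simp only: of_nat_le_iff)
  then have "real k + 1 \<le> 512 * real (threshold k)" by simp
  then show "\<kappa> / 512 \<le> real (threshold (nat \<lfloor>\<kappa>\<rfloor>))" using k(2) by (simp flip: k_def)
  have "256 * threshold k \<le> k" using q(1) T(2) by linarith
  then have "256 * real (threshold k) \<le> real k" by (metis of_nat_le_iff of_nat_mult of_nat_numeral)
  then show "real (threshold (nat \<lfloor>\<kappa>\<rfloor>)) \<le> \<kappa> / 256" using k(1) by (simp flip: k_def)
qed

lemma threshold_small: "(\<kappa>::real) < 512 \<Longrightarrow> threshold (nat \<lfloor>\<kappa>\<rfloor>) = 1"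
proof -
  assume "\<kappa> < 512"
  then have "\<lfloor>\<kappa>\<rfloor> < 512" by (simp add: floor_less_iff)
  then have "nat \<lfloor>\<kappa>\<rfloor> < 512" by linarith
  then show ?thesis by (simp add: threshold_def)
qed

text \<open>For \<open>z \<ge> 1\<close> the trivial bound 1 suffices, and otherwise
  \<open>z ^ 3 \<le> z\<close>.\<close>

lemma min_one_cube_le:
  fixes d z :: real
  assumes "d \<le> 1" "d \<le> z ^ 3" "0 \<le> z"
  shows "d \<le> z"
proof (cases "z \<le> 1")
  case True
  then have "z ^ 3 \<le> z ^ 1" using assms(3) by (intro power_decreasing) auto
  then show ?thesis using assms by simp
qed (use assms in simp)

text \<open>All machine properties come from one simulation: the law and termination from the
  coupling, cost and multiplicities from the list coupled with a reachable final state.\<close>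

lemma sampler_run:
  assumes \<kappa>: "2 \<le> \<kappa>" and N: "1 \<le> N" and xs: "set xs \<subseteq> {1..N}"
  defines "T \<equiv> threshold (nat \<lfloor>\<kappa>\<rfloor>)"
  shows "map_spmf outp (run sampler \<kappa> xs) = spmf_of_pmf (algo T T xs)"
    and "lossless_spmf (run sampler \<kappa> xs)"
    and "xs \<noteq> [] \<Longrightarrow> halts_within sampler \<kappa> xs (real (length xs) * poly (poly cost_poly [:ln \<kappa>:]) (ln (real N)))"
    and "s \<in> set_spmf (run sampler \<kappa> xs) \<Longrightarrow> set (outp s) \<subseteq> {1..N} \<and>
      (\<forall>i\<in>{1..N}. 2 * count_list (outp s) i \<le> count_list xs i)"
proof -
  define V where "V = 600 * N * (nat \<lfloor>\<kappa>\<rfloor> + 1)\<^sup>2"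
  have sim: "sim (\<lambda>ys t. outp t = ys \<and> cost t \<le> 700 * (bits V * bits V) * (length xs + 1)) (algo T T xs) (run sampler \<kappa> xs)"
    unfolding run_sampler T_def by (rule sampler_sim[OF xs N V_def])
  show eq: "map_spmf outp (run sampler \<kappa> xs) = spmf_of_pmf (algo T T xs)"
    by (rule sim_map_eq[OF sim]) simp
  have "lossless_spmf (map_spmf outp (run sampler \<kappa> xs))" unfolding eq by simp
  then show loss: "lossless_spmf (run sampler \<kappa> xs)" by simp
  show "halts_within sampler \<kappa> xs (real (length xs) * poly (poly cost_poly [:ln \<kappa>:]) (ln (real N)))" if "xs \<noteq> []"
    unfolding halts_within_def
  proof (intro conjI loss ballI)
    fix t assume "t \<in> set_spmf (run sampler \<kappa> xs)"
    with sim_set_spmf[OF sim] have "cost t \<le> 700 * (bits V * bits V) * (length xs + 1)" by blast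
    moreover have "1 \<le> length xs" using that by (simp add: Suc_leI)
    ultimately show "real (cost t) \<le> real (length xs) * poly (poly cost_poly [:ln \<kappa>:]) (ln (real N))"
      by (intro cost_bound[OF \<kappa> N _ V_def])
  qed
  assume "s \<in> set_spmf (run sampler \<kappa> xs)"
  with sim_set_spmf[OF sim] have "outp s \<in> set_pmf (algo T T xs)" by blast
  then have cnt: "2 * count_list (outp s) i \<le> count_list xs i" for i
    by (intro algo_count[of T]) (simp_all add: T_def)
  have "set (outp s) \<subseteq> set xs"
  proof
    fix i assume "i \<in> set (outp s)"
    then have "count_list (outp s) i \<noteq> 0" by (simp add: count_list_0_iff)
    with cnt[of i] have "count_list xs i \<noteq> 0" by linarith
    then show "i \<in> set xs" by (simp add: count_list_0_iff)
  qed
  with xs cnt show "set (outp s) \<subseteq> {1..N} \<and> (\<forall>i\<in>{1..N}. 2 * count_list (outp s) i \<le> count_list xs i)" by blast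
qed

lemma sampler_law:
  assumes \<kappa>: "2 \<le> \<kappa>" and N: "1 \<le> N" and p: "set_pmf p \<subseteq> {1..N}"
  defines "T \<equiv> threshold (nat \<lfloor>\<kappa>\<rfloor>)"
  shows "bind_spmf (spmf_of_pmf (replicate_pmf M p)) (\<lambda>xs. map_spmf outp (run sampler \<kappa> xs)) =
    spmf_of_pmf (bind_pmf (replicate_pmf M p) (algo T T))"
proof -
  have "bind_pmf (replicate_pmf M p) (\<lambda>xs. map_spmf outp (run sampler \<kappa> xs)) =
      bind_pmf (replicate_pmf M p) (\<lambda>xs. spmf_of_pmf (algo T T xs))"
  proof (intro bind_pmf_cong refl)
    fix xs assume "xs \<in> set_pmf (replicate_pmf M p)"
    then have "set xs \<subseteq> {1..N}" using p by (auto simp: set_replicate_pmf)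
    then show "map_spmf outp (run sampler \<kappa> xs) = spmf_of_pmf (algo T T xs)"
      unfolding T_def by (rule sampler_run(1)[OF \<kappa> N])
  qed
  then show ?thesis by (simp add: spmf_of_pmf_bind)
qed

text \<open>As \<open>ln 1 = 0\<close>, the law must be hit exactly: the input is constant, the
  first probe succeeds, and pairing returns a deterministic number of copies.
  \<open>T \<le> M / 4\<close> leaves at least \<open>M / 4\<close> of them.\<close>

lemma distance_single:
  assumes \<kappa>: "2 \<le> \<kappa>" and p: "set_pmf p \<subseteq> {1..1}" and M: "10 * \<kappa>\<^sup>2 / max_prob 1 p \<le> real M"
  shows "\<exists>\<mu>. (\<forall>m\<in>set_pmf \<mu>. real m \<ge> real M * collision_prob 1 p / (32 * \<kappa> * max_prob 1 p)) \<and>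
    stat_dist (bind_spmf (spmf_of_pmf (replicate_pmf M p)) (\<lambda>xs. map_spmf outp (run sampler \<kappa> xs)))
      (spmf_of_pmf (bind_pmf \<mu> (\<lambda>m. replicate_pmf m (squared_pmf 1 p)))) \<le> 0"
proof -
  have p1: "p = return_pmf 1" using p by (simp add: set_pmf_subset_singleton)
  have coll: "collision_prob 1 p = 1" "max_prob 1 p = 1" by (simp_all add: p1 collision_prob_def max_prob_def)
  have sq: "squared_pmf 1 p = return_pmf 1"
  proof (rule pmf_eqI)
    fix i show "pmf (squared_pmf 1 p) i = pmf (return_pmf 1) i"
    proof -
      have "pmf (squared_pmf 1 p) i = (pmf p i)\<^sup>2" using pmf_squared[OF p, of i] unfolding coll by simp
      then show ?thesis by (cases "i = 1") (simp_all add: p1)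
    qed
  qed
  define T where "T = threshold (nat \<lfloor>\<kappa>\<rfloor>)"
  have M10: "10 * \<kappa>\<^sup>2 \<le> real M" using M unfolding coll by simp
  have \<kappa>2: "2 * \<kappa> \<le> \<kappa>\<^sup>2" using mult_right_mono[OF \<kappa>, of \<kappa>] \<kappa> by (simp add: power2_eq_square)
  have T: "real T \<le> real M / 4"
  proof (cases "\<kappa> < 512")
    case True
    then show ?thesis using threshold_small[of \<kappa>] M10 \<kappa>2 \<kappa> by (simp add: T_def)
  next
    case False
    have "real T \<le> real (nat \<lfloor>\<kappa>\<rfloor> + 1)" unfolding T_def of_nat_le_iff by (rule threshold_le)
    also have "\<dots> \<le> \<kappa> + 1" using \<kappa> by simp
    finally show ?thesis using M10 \<kappa>2 \<kappa> by linarith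
  qed
  define m where "m = (M - T) div 2"
  have TM: "T \<le> M" using T by linarith
  have "algo T T (replicate M 1) = return_pmf (replicate m 1)"
    unfolding m_def by (rule algo_constant) (use TM in \<open>simp_all add: T_def\<close>)
  then have law: "bind_spmf (spmf_of_pmf (replicate_pmf M p)) (\<lambda>xs. map_spmf outp (run sampler \<kappa> xs)) =
      spmf_of_pmf (bind_pmf (return_pmf m) (\<lambda>m. replicate_pmf m (squared_pmf 1 p)))"
    using sampler_law[OF \<kappa> order_refl p, of M] unfolding sq
    by (simp add: p1 replicate_pmf_return bind_return_pmf flip: T_def)
  have m4: "real M / 4 \<le> real m"
  proof -
    have "M \<le> 2 * m + T + 1" unfolding m_def by linarith
    then have "real M \<le> 2 * real m + real T + 1" by linarith
    then show ?thesis using T M10 \<kappa>2 \<kappa> by linarith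
  qed
  have "real M * collision_prob 1 p / (32 * \<kappa> * max_prob 1 p) \<le> real M / 4"
  proof -
    have "real M / (32 * \<kappa>) \<le> real M / 4" using \<kappa> by (intro divide_left_mono) auto
    then show ?thesis unfolding coll by simp
  qed
  then have "\<forall>k\<in>set_pmf (return_pmf m). real k \<ge> real M * collision_prob 1 p / (32 * \<kappa> * max_prob 1 p)"
    using m4 by simp
  moreover have "stat_dist P P \<le> 0" for P :: "nat list spmf" by (rule stat_dist_le) simp
  ultimately show ?thesis unfolding law by blast
qed

text \<open>\<open>T \<ge> \<kappa> / 512\<close> gives
  \<open>exp (- T / 8) \<le> exp (- \<kappa> / 4096)\<close>, and the cube root divides the rate by
  3, hence 12288. The constant 5 comes from \<open>3 \<le> 5 * ln N\<close> for
  \<open>N \<ge> 2\<close>.\<close>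

lemma distance_many:
  assumes \<kappa>: "2 \<le> \<kappa>" and N: "2 \<le> N" and p: "set_pmf p \<subseteq> {1..N}" and M: "10 * \<kappa>\<^sup>2 / max_prob N p \<le> real M"
  shows "\<exists>\<mu>. (\<forall>m\<in>set_pmf \<mu>. real m \<ge> real M * collision_prob N p / (32 * \<kappa> * max_prob N p)) \<and>
    stat_dist (bind_spmf (spmf_of_pmf (replicate_pmf M p)) (\<lambda>xs. map_spmf outp (run sampler \<kappa> xs)))
      (spmf_of_pmf (bind_pmf \<mu> (\<lambda>m. replicate_pmf m (squared_pmf N p)))) \<le>
    5 * real M * real N * ln (real N) * exp (- (1 / 12288) * \<kappa>)"
proof -
  define pm pc where "pm = max_prob N p" and "pc = collision_prob N p"
  have outside: "pmf p x = 0" if "x \<notin> {1..N}" for x using p that by (auto simp: set_pmf_iff)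
  have fin: "finite (set_pmf p)" by (rule finite_subset[OF p]) simp
  have pc: "pc = (\<Sum>x\<in>set_pmf p. (pmf p x)\<^sup>2)"
    unfolding pc_def collision_prob_def using p by (intro sum.mono_neutral_right) (auto simp: set_pmf_iff)
  have pmx: "\<exists>x. pmf p x = pm"
  proof -
    have "pm \<in> pmf p ` {1..N}" unfolding pm_def max_prob_def using N by (intro Max_in) auto
    then show ?thesis by auto
  qed
  have pm_in: "pmf p x \<le> pm" if "x \<in> {1..N}" for x
    unfolding pm_def max_prob_def using that by (intro Max_ge) auto
  have pm0: "0 \<le> pm" by (rule order_trans[OF pmf_nonneg pm_in[of 1]]) (use N in simp)
  have pm_le: "pmf p x \<le> pm" for x using pm_in[of x] outside[of x] pm0 by (cases "x \<in> {1..N}") auto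
  have pcpos: "0 < pc"
    unfolding pc by (intro sum_pos fin) (auto simp: set_pmf_not_empty set_pmf_iff)
  have sq: "pmf (squared_pmf N p) x * pc = (pmf p x)\<^sup>2" for x
    using pmf_squared[OF p, of x] pcpos by (simp add: pc_def)
  interpret sized_source p "squared_pmf N p" pc N pm
    by standard (fact fin sq pc p pm_le pmx)+
  define T where "T = threshold (nat \<lfloor>\<kappa>\<rfloor>)"
  \<comment> \<open>Since \<open>m\<close> is an integer, rounding up loses nothing in the claim;
    the additional 1 that it may cost is allowed for in \<open>tail_bound\<close>.\<close>
  define n where "n = nat \<lceil>real M * pc / (32 * \<kappa> * pm)\<rceil>"
  have pos: "0 < pm" "0 < pc" "0 < \<kappa>" using pm_pos pc_pos \<kappa> by auto
  have n: "real M * pc / (32 * \<kappa> * pm) \<le> real n" unfolding n_def by (rule real_nat_ceiling_ge)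
  have law: "bind_spmf (spmf_of_pmf (replicate_pmf M p)) (\<lambda>xs. map_spmf outp (run sampler \<kappa> xs)) =
      spmf_of_pmf (algo_law T T M)"
    unfolding algo_law_def T_def by (rule sampler_law[OF \<kappa> _ p]) (use N in simp)
  have Mpm: "10 * \<kappa>\<^sup>2 \<le> real M * pm" using M pos by (simp add: divide_le_eq flip: pm_def)
  have M10: "10 * \<kappa>\<^sup>2 \<le> real M" using Mpm mult_left_mono[OF pm_le_1, of "real M"] by simp
  have \<kappa>4: "4 \<le> \<kappa>\<^sup>2" using power_mono[OF \<kappa>, of 2] by simp
  have lnN: "2 / 3 \<le> ln (real N)"
  proof -
    have "ln 2 \<le> ln (real N)" using N by (subst ln_le_cancel_iff) auto
    then show ?thesis using ln2_ge_two_thirds by linarith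
  qed
  \<comment> \<open>The factor 3 is chosen so that its cube 27 covers \<open>2 * 13\<close>, the
    constant of \<open>algo_near_mixture\<close> doubled by \<open>okay_imp_mixture\<close>.\<close>
  let ?z = "3 * real N * real M * exp (- \<kappa> / 12288)"
  have z0: "0 \<le> ?z" by simp
  have z: "?z \<le> 5 * real M * real N * ln (real N) * exp (- (1 / 12288) * \<kappa>)"
  proof -
    have "3 \<le> 5 * ln (real N)" using lnN by linarith
    from mult_right_mono[OF this, of "real N * real M * exp (- \<kappa> / 12288)"] show ?thesis by (simp add: mult_ac)
  qed
  have "\<exists>\<mu>. (\<forall>m\<in>set_pmf \<mu>. n \<le> m) \<and>
      stat_dist (spmf_of_pmf (algo_law T T M)) (spmf_of_pmf (bind_pmf \<mu> (\<lambda>m. replicate_pmf m (squared_pmf N p)))) \<le> ?z"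
  proof (cases "\<kappa> < 1024")
    case True
    \<comment> \<open>For \<open>\<kappa> < 1024\<close> the bound exceeds 1:
      \<open>M \<ge> 40\<close>, \<open>N \<ge> 2\<close>, and
      \<open>exp (- \<kappa> / 12288) \<ge> 1 - 1 / 12\<close>.\<close>
    have "11 / 12 \<le> exp (- \<kappa> / 12288)" using exp_ge_add_one_self[of "- \<kappa> / 12288"] True by simp
    then have "3 * 2 * 40 * (11 / 12) \<le> ?z"
      using N M10 \<kappa>4 by (intro mult_mono) auto
    then have "1 \<le> ?z" by simp
    then show ?thesis
      using order_trans[OF stat_dist_le_1] by (intro exI[of _ "return_pmf n"]) auto
  next
    case False
    then have \<kappa>1024: "1024 \<le> \<kappa>" by simp
    note Tb = threshold_bounds[OF \<kappa>1024, folded T_def]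
    have nX: "real n \<le> real M * pc / (\<kappa> * pm) / 32 + 1"
    proof -
      have "0 \<le> real M * pc / (32 * \<kappa> * pm)" using pos by simp
      then have "real n \<le> real M * pc / (32 * \<kappa> * pm) + 1" unfolding n_def by linarith
      then show ?thesis by (simp add: mult_ac)
    qed
    have okay: "okay (squared_pmf N p) n (13 * N * real M ^ 3 * exp (- real T / 8)) (algo_law T T M)"
      by (rule algo_near_mixture[OF \<kappa>1024 _ Tb(2) Mpm nX]) (simp add: T_def)
    obtain \<mu> where \<mu>: "\<forall>m\<in>set_pmf \<mu>. n \<le> m"
      "\<And>A. \<bar>measure_pmf.prob (algo_law T T M) A -
        measure_pmf.prob (bind_pmf \<mu> (\<lambda>m. replicate_pmf m (squared_pmf N p))) A\<bar> \<le> 2 * (13 * N * real M ^ 3 * exp (- real T / 8))"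
      using okay_imp_mixture[OF _ _ okay] by (auto simp: T_def)
    let ?d = "stat_dist (spmf_of_pmf (algo_law T T M)) (spmf_of_pmf (bind_pmf \<mu> (\<lambda>m. replicate_pmf m (squared_pmf N p))))"
    have "?d \<le> 2 * (13 * N * real M ^ 3 * exp (- real T / 8))"
      by (rule stat_dist_spmf_of_pmf_le) (rule \<mu>(2))
    also have "\<dots> \<le> ?z ^ 3"
    proof -
      have "exp (- real T / 8) \<le> exp (- \<kappa> / 4096)" using Tb(1) by simp
      also have "exp (- \<kappa> / 4096) = exp (- \<kappa> / 12288) ^ 3" by (simp flip: exp_of_nat_mult)
      finally have e: "exp (- real T / 8) \<le> exp (- \<kappa> / 12288) ^ 3" .
      have "real N ^ 1 \<le> real N ^ 3" using N by (intro power_increasing) auto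
      then have "real N \<le> real N ^ 3" by (simp only: power_one_right)
      then have n27: "2 * 13 * real N \<le> 27 * real N ^ 3" using zero_le_power[of "real N" 3] by linarith
      have me: "real M ^ 3 * exp (- real T / 8) \<le> real M ^ 3 * exp (- \<kappa> / 12288) ^ 3"
        by (intro mult_left_mono e) simp
      have "(2 * 13 * real N) * (real M ^ 3 * exp (- real T / 8)) \<le>
          (27 * real N ^ 3) * (real M ^ 3 * exp (- \<kappa> / 12288) ^ 3)"
        by (rule mult_mono[OF n27 me]) auto
      moreover have "2 * (13 * N * real M ^ 3 * exp (- real T / 8)) = (2 * 13 * real N) * (real M ^ 3 * exp (- real T / 8))"
        by simp
      moreover have "?z ^ 3 = (27 * real N ^ 3) * (real M ^ 3 * exp (- \<kappa> / 12288) ^ 3)"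
        by (simp add: power_mult_distrib)
      ultimately show ?thesis by (simp only:)
    qed
    finally have "?d \<le> ?z" by (rule min_one_cube_le[OF stat_dist_le_1 _ z0])
    then show ?thesis using \<mu>(1) by blast
  qed
  then obtain \<mu> where \<mu>: "\<forall>m\<in>set_pmf \<mu>. n \<le> m"
      "stat_dist (spmf_of_pmf (algo_law T T M)) (spmf_of_pmf (bind_pmf \<mu> (\<lambda>m. replicate_pmf m (squared_pmf N p)))) \<le> ?z" by blast
  show ?thesis
  proof (intro exI[of _ \<mu>] conjI ballI)
    fix m assume "m \<in> set_pmf \<mu>"
    then have "real n \<le> real m" using \<mu>(1) by simp
    with n show "real M * collision_prob N p / (32 * \<kappa> * max_prob N p) \<le> real m" unfolding pm_def pc_def by linarith
  qed (use \<mu>(2) z law in simp)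
qed

theorem theorem3p3:
  "\<exists>(C1::real) (C2::real) (alg::com) (P::real poly poly). C1 > 0 \<and> C2 > 0 \<and>
     (\<forall>(\<kappa>::real) (N::nat). \<kappa> \<ge> 2 \<longrightarrow> N \<ge> 1 \<longrightarrow>
       (\<forall>xs. set xs \<subseteq> {1..N} \<longrightarrow>
          lossless_spmf (run alg \<kappa> xs) \<and>
          (xs \<noteq> [] \<longrightarrow> halts_within alg \<kappa> xs (real (length xs) * poly (poly P [:ln \<kappa>:]) (ln (real N)))) \<and>
          (\<forall>s\<in>set_spmf (run alg \<kappa> xs).
             set (outp s) \<subseteq> {1..N} \<and>
             (\<forall>i\<in>{1..N}. 2 * count_list (outp s) i \<le> count_list xs i))) \<and>
       (\<forall>(p::nat pmf) (M::nat).
          set_pmf p \<subseteq> {1..N} \<longrightarrow> real M \<ge> 10 * \<kappa>\<^sup>2 / max_prob N p \<longrightarrow>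
          (\<exists>\<mu>::nat pmf.
             (\<forall>m\<in>set_pmf \<mu>. real m \<ge> real M * collision_prob N p / (32 * \<kappa> * max_prob N p)) \<and>
             stat_dist
               (bind_spmf (spmf_of_pmf (replicate_pmf M p)) (\<lambda>xs. map_spmf outp (run alg \<kappa> xs)))
               (spmf_of_pmf (bind_pmf \<mu> (\<lambda>m. replicate_pmf m (squared_pmf N p))))
             \<le> C1 * real M * real N * ln (real N) * exp (- C2 * \<kappa>))))"
proof -
  have dist: "\<exists>\<mu>. (\<forall>m\<in>set_pmf \<mu>. real m \<ge> real M * collision_prob N p / (32 * \<kappa> * max_prob N p)) \<and>
      stat_dist (bind_spmf (spmf_of_pmf (replicate_pmf M p)) (\<lambda>xs. map_spmf outp (run sampler \<kappa> xs)))
        (spmf_of_pmf (bind_pmf \<mu> (\<lambda>m. replicate_pmf m (squared_pmf N p))))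
      \<le> 5 * real M * real N * ln (real N) * exp (- (1 / 12288) * \<kappa>)"
    if "\<kappa> \<ge> 2" "N \<ge> 1" "set_pmf p \<subseteq> {1..N}" "real M \<ge> 10 * \<kappa>\<^sup>2 / max_prob N p" for \<kappa> N p M
  proof (cases "N = 1")
    case True
    then show ?thesis using distance_single[OF that(1), of p M] that(3,4) by simp
  next
    case False
    then show ?thesis using that(2) by (intro distance_many that) simp
  qed
  show ?thesis
    by (intro exI[of _ 5] exI[of _ "1 / 12288"] exI[of _ sampler] exI[of _ cost_poly] conjI allI impI ballI)
      (simp, simp, rule sampler_run(2), assumption+, rule sampler_run(3), assumption+,
       rule sampler_run(4)[THEN conjunct1], assumption+,
       rule sampler_run(4)[THEN conjunct2, rule_format], assumption+, rule dist, assumption+)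
qed

end
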